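(* Let $d=1$ and let $\mu,\nu\in\mathcal P_2(\mathbb R)$ satisfy Assumption (A). Let $Z_0\in L^\infty(\mathcal G;\mathbb R)$, and assume that $\nu$ has convex support and admits a density (with respect to Lebesgue measure) which is bounded away from zero and infinity on its support. Let $(Z_t)_{t\ge0}$ be the $L^2$-Bass gradient flow started at $Z_0$, and let $Z^\star$ be the unique minimizer of $V$ with $\mathbb E[Z^\star]=\mathbb E[Z_0]$, to which $(Z_t)_{t\ge 0}$ converges in $L^2$. Then there is $\kappa>0$ such that for all $t\ge 0$ $$\|Z_t-Z^\star\|_{L^2}\le\|Z_0-Z^\star\|_{L^2}\cdot\exp\{-\kappa t\},$$ $$V(Z_t)-\inf V\le[V(Z_0)-\inf V]\cdot\exp\{-\kappa t\}.$$
   Context: $\mathcal P_2(\mathbb R)$ is the set of probability measures on $\mathbb R$ with finite second moment, $\gamma_1$ is the standard Gaussian measure on $\mathbb R$. Fix a probability space supporting independent random variables $X\sim\mu$ and $\Gamma\sim\gamma_1$, and put $\mathcal G:=\sigma(X)$, $\mathcal H:=\sigma(X,\Gamma)$. The lifted Bass functional is $$V(Z):=\sup_{Y\in L^2(\mathcal H;\mathbb R),\,Y\sim\nu}\mathbb E[(Z+\Gamma) Y-Z X],\qquad Z\in L^2(\mathcal G;\mathbb R).$$ For an absolutely continuous probability measure $\rho$, the Brenier map from $\rho$ to $\eta$ is the ($\rho$-a.s. unique) derivative $\nabla v$ of a convex function $v$ with $(\nabla v)_\#\rho=\eta$. We write $(f\ast\gamma_1)(z)=\int f(z+y)\,\gamma_1(dy)$;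 $\mathscr L(Z)$ is the law of $Z$. $L^2$-Bass gradient flow started at $Z_0$: an absolutely continuous curve $(Z_t)_{t\in\mathbb R_+}\subset L^2(\mathcal G;\mathbb R)$ starting at $Z_0$ such that for a.e. $t\in\mathbb R_+$, $\frac{dZ_t}{dt}=-[(\nabla v_t\ast\gamma_1)(Z_t)-X]$, where $\nabla v_t$ is the Brenier map from $\mathscr L(Z_t)\ast\gamma_1$ to $\nu$. Under Assumption (A) this flow exists, is unique, and converges in $L^2$ to the unique minimizer $Z^\star$ of $V$ with $\mathbb E[Z^\star]=\mathbb E[Z_0]$. Convex order: $\mu\le_{cx}\nu$ means $\int\phi\,d\mu\le\int\phi\,d\nu$ for all convex $\phi:\mathbb R\to\mathbb R$. The pair $(\mu,\nu)$ is irreducible if for all measurable $A,B\subseteq\mathbb R$ with $\mu(A),\nu(B)>0$ there is a martingale $(M_t)_{0\le t\le 1}$ with $M_0\sim\mu$, $M_1\sim\nu$ and $\mathbb P(M_0\in A,M_1\in B)>0$. For a probability measure $\rho$ let $C_\rho$ be the convex hull of its support; put $C:=C_\nu$ and $I:=\mathrm{int}(C)$. Assumption (A): $\mu\le_{cx}\nu$ and (A1) $(\mu,\nu)$ is irreducible; (A2) $\nu$ is compactly supported, i.e. $C$ is compact; (A3) $\mathrm{supp}(\mu)\subseteq I$, i.e. $C_\mu$ is compactly contained in $I$. *)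

theory Defs
  imports "HOL-Probability.Probability"
begin

section \<open>Measures on the real line\<close>

definition P2 :: "real measure set" where
  "P2 = {\<rho>. prob_space \<rho> \<and> sets \<rho> = sets borel \<and> integrable \<rho> (\<lambda>x. x\<^sup>2)}"

abbreviation gauss :: "real measure" where
  "gauss \<equiv> density lborel (\<lambda>x. ennreal (std_normal_density x))"

definition msupport :: "real measure \<Rightarrow> real set" where
  "msupport \<rho> = {x. \<forall>U. open U \<longrightarrow> x \<in> U \<longrightarrow> emeasure \<rho> U > 0}"

definition supp_hull :: "real measure \<Rightarrow> real set" where
  "supp_hull \<rho> = convex hull (msupport \<rho>)"

text \<open>The integral of a real convex function against a measure with finite first moment is a
  well-defined element of \<open>(-\<infinity>, \<infinity>]\<close>. Since the Bochner integral of a non-integrable function is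
  \<open>0\<close>, the inequality of these extended values is spelled out: it is void if the integral against
  \<open>\<nu>\<close> is infinite, and otherwise it forces integrability with respect to \<open>\<mu>\<close>.\<close>

definition convex_order :: "real measure \<Rightarrow> real measure \<Rightarrow> bool" where
  "convex_order \<mu> \<nu> \<longleftrightarrow>
     (\<forall>\<phi>::real \<Rightarrow> real. convex_on UNIV \<phi> \<longrightarrow> integrable \<nu> \<phi> \<longrightarrow>
        integrable \<mu> \<phi> \<and> (\<integral>x. \<phi> x \<partial>\<mu>) \<le> (\<integral>x. \<phi> x \<partial>\<nu>))"

section \<open>Irreducibility\<close>

definition martingale01 ::
  "'b measure \<Rightarrow> (real \<Rightarrow> 'b measure) \<Rightarrow> (real \<Rightarrow> 'b \<Rightarrow> real) \<Rightarrow> bool" where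
  "martingale01 P F N \<longleftrightarrow>
     (\<forall>t\<in>{0..1}. subalgebra P (F t)) \<and>
     (\<forall>s\<in>{0..1}. \<forall>t\<in>{0..1}. s \<le> t \<longrightarrow> sets (F s) \<subseteq> sets (F t)) \<and>
     (\<forall>t\<in>{0..1}. N t \<in> borel_measurable (F t) \<and> integrable P (N t)) \<and>
     (\<forall>s\<in>{0..1}. \<forall>t\<in>{0..1}. s \<le> t \<longrightarrow>
        (AE \<omega> in P. real_cond_exp P (F s) (N t) \<omega> = N s \<omega>))"

text \<open>One cannot quantify existentially over types, so the probability space carrying the
  martingale lives on the type \<open>real \<Rightarrow> real\<close> of paths. This is no restriction: a martingale on any
  probability space is a martingale in its own filtration, and its law on path space makes the
  coordinate process a martingale with the same finite-dimensional distributions.\<close>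

definition irreducible_pair :: "real measure \<Rightarrow> real measure \<Rightarrow> bool" where
  "irreducible_pair \<mu> \<nu> \<longleftrightarrow>
     (\<forall>A\<in>sets borel. \<forall>B\<in>sets borel. emeasure \<mu> A > 0 \<longrightarrow> emeasure \<nu> B > 0 \<longrightarrow>
        (\<exists>(P :: (real \<Rightarrow> real) measure) F N.
           prob_space P \<and> martingale01 P F N \<and>
           distr P borel (N 0) = \<mu> \<and> distr P borel (N 1) = \<nu> \<and>
           emeasure P {\<omega> \<in> space P. N 0 \<omega> \<in> A \<and> N 1 \<omega> \<in> B} > 0))"

definition assumption_A :: "real measure \<Rightarrow> real measure \<Rightarrow> bool" where
  "assumption_A \<mu> \<nu> \<longleftrightarrow>
     convex_order \<mu> \<nu> \<and> irreducible_pair \<mu> \<nu> \<and>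
     compact (supp_hull \<nu>) \<and> msupport \<mu> \<subseteq> interior (supp_hull \<nu>)"

section \<open>Brenier maps\<close>

text \<open>\<open>S\<close> is the interior of the effective domain of a convex function with values in
  \<open>(-\<infinity>, \<infinity>]\<close>; it equals \<open>UNIV\<close> whenever \<open>\<rho>\<close> has full support, as for a law convolved with a
  Gaussian. The map is only determined up to \<open>\<rho>\<close>-null sets.\<close>

definition brenier_map :: "real measure \<Rightarrow> real measure \<Rightarrow> (real \<Rightarrow> real) \<Rightarrow> bool" where
  "brenier_map \<rho> \<eta> T \<longleftrightarrow>
     T \<in> borel_measurable borel \<and> distr \<rho> borel T = \<eta> \<and>
     (\<exists>(v::real \<Rightarrow> real) S. open S \<and> convex S \<and> convex_on S v \<and>
        (AE x in \<rho>. x \<in> S \<and> (v has_real_derivative T x) (at x)))"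

definition gauss_conv :: "(real \<Rightarrow> real) \<Rightarrow> real \<Rightarrow> real" where
  "gauss_conv f z = (\<integral>y. f (z + y) \<partial>gauss)"

section \<open>Square-integrable random variables\<close>

text \<open>Elements of \<open>L\<^sup>2(F)\<close> are represented by \<open>F\<close>-measurable functions, not by classes.\<close>

definition L2 :: "'a measure \<Rightarrow> 'a measure \<Rightarrow> ('a \<Rightarrow> real) set" where
  "L2 M F = {Y. Y \<in> borel_measurable F \<and> integrable M (\<lambda>\<omega>. (Y \<omega>)\<^sup>2)}"

definition Linf :: "'a measure \<Rightarrow> 'a measure \<Rightarrow> ('a \<Rightarrow> real) set" where
  "Linf M F = {Y. Y \<in> borel_measurable F \<and> (\<exists>c. AE \<omega> in M. \<bar>Y \<omega>\<bar> \<le> c)}"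

definition l2norm :: "'a measure \<Rightarrow> ('a \<Rightarrow> real) \<Rightarrow> real" where
  "l2norm M Y = sqrt (\<integral>\<omega>. (Y \<omega>)\<^sup>2 \<partial>M)"

text \<open>Absolute continuity of a curve on the half-line is meant on every compact interval.\<close>

definition L2_abs_cont :: "'a measure \<Rightarrow> (real \<Rightarrow> 'a \<Rightarrow> real) \<Rightarrow> bool" where
  "L2_abs_cont M Z \<longleftrightarrow>
     (\<forall>T\<ge>0. \<forall>\<epsilon>>0. \<exists>\<delta>>0. \<forall>(n::nat) a b.
        (\<forall>i<n. 0 \<le> a i \<and> a i \<le> b i \<and> b i \<le> T) \<longrightarrow>
        disjoint_family_on (\<lambda>i. {a i<..<b i}) {..<n} \<longrightarrow>
        (\<Sum>i<n. b i - a i) < \<delta> \<longrightarrow>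
        (\<Sum>i<n. l2norm M (\<lambda>\<omega>. Z (b i) \<omega> - Z (a i) \<omega>)) < \<epsilon>)"

text \<open>Requiring \<open>D\<close> to be square-integrable is needed because \<open>l2norm\<close> is \<open>0\<close>, and not \<open>\<infinity>\<close>,
  outside of \<open>L\<^sup>2\<close>.\<close>

definition has_L2_derivative ::
  "'a measure \<Rightarrow> (real \<Rightarrow> 'a \<Rightarrow> real) \<Rightarrow> ('a \<Rightarrow> real) \<Rightarrow> real \<Rightarrow> bool" where
  "has_L2_derivative M Z D t \<longleftrightarrow>
     D \<in> L2 M M \<and>
     ((\<lambda>s. l2norm M (\<lambda>\<omega>. (Z s \<omega> - Z t \<omega>) / (s - t) - D \<omega>)) \<longlongrightarrow> 0) (at t within {0..})"

section \<open>The lifted Bass functional and its gradient flow\<close>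

definition sigX :: "'a measure \<Rightarrow> ('a \<Rightarrow> real) \<Rightarrow> 'a measure" where
  "sigX M X = vimage_algebra (space M) X borel"

definition sigXG :: "'a measure \<Rightarrow> ('a \<Rightarrow> real) \<Rightarrow> ('a \<Rightarrow> real) \<Rightarrow> 'a measure" where
  "sigXG M X \<Gamma> = vimage_algebra (space M) (\<lambda>\<omega>. (X \<omega>, \<Gamma> \<omega>)) (borel \<Otimes>\<^sub>M borel)"

text \<open>Supremum and infimum are taken in the reals. For \<open>X\<close>, \<open>Z\<close> square-integrable and \<open>\<nu>\<close> in
  \<open>P2\<close> the set in the supremum is nonempty (it contains a monotone transform of \<open>\<Gamma>\<close>) and bounded
  (Cauchy-Schwarz); if moreover \<open>\<mu>\<close> is below \<open>\<nu>\<close> in convex order, then the functional is bounded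
  below (test with \<open>Y\<close> such that \<open>(X, Y)\<close> is a martingale coupling).\<close>

definition bass_V ::
  "'a measure \<Rightarrow> ('a \<Rightarrow> real) \<Rightarrow> ('a \<Rightarrow> real) \<Rightarrow> real measure \<Rightarrow> ('a \<Rightarrow> real) \<Rightarrow> real" where
  "bass_V M X \<Gamma> \<nu> Z =
     (SUP Y \<in> {Y \<in> L2 M (sigXG M X \<Gamma>). distr M borel Y = \<nu>}.
        \<integral>\<omega>. (Z \<omega> + \<Gamma> \<omega>) * Y \<omega> - Z \<omega> * X \<omega> \<partial>M)"

definition bass_inf ::
  "'a measure \<Rightarrow> ('a \<Rightarrow> real) \<Rightarrow> ('a \<Rightarrow> real) \<Rightarrow> real measure \<Rightarrow> real" where
  "bass_inf M X \<Gamma> \<nu> = (INF Z \<in> L2 M (sigX M X). bass_V M X \<Gamma> \<nu> Z)"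

definition bass_minimizer ::
  "'a measure \<Rightarrow> ('a \<Rightarrow> real) \<Rightarrow> ('a \<Rightarrow> real) \<Rightarrow> real measure \<Rightarrow> ('a \<Rightarrow> real) \<Rightarrow> bool" where
  "bass_minimizer M X \<Gamma> \<nu> Zs \<longleftrightarrow>
     Zs \<in> L2 M (sigX M X) \<and>
     (\<forall>W \<in> L2 M (sigX M X). bass_V M X \<Gamma> \<nu> Zs \<le> bass_V M X \<Gamma> \<nu> W)"

definition bass_flow ::
  "'a measure \<Rightarrow> ('a \<Rightarrow> real) \<Rightarrow> real measure \<Rightarrow> ('a \<Rightarrow> real) \<Rightarrow> (real \<Rightarrow> 'a \<Rightarrow> real) \<Rightarrow> bool" where
  "bass_flow M X \<nu> Z0 Z \<longleftrightarrow>
     (\<forall>t\<ge>0. Z t \<in> L2 M (sigX M X)) \<and>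
     L2_abs_cont M Z \<and>
     (AE \<omega> in M. Z 0 \<omega> = Z0 \<omega>) \<and>
     (AE t in lborel. 0 \<le> t \<longrightarrow>
        (\<exists>T. brenier_map (distr M borel (Z t) \<star> gauss) \<nu> T \<and>
             has_L2_derivative M Z (\<lambda>\<omega>. - (gauss_conv T (Z t \<omega>) - X \<omega>)) t))"

end

theory Submission
  imports Defs
begin

text \<open>In dimension one the supremum defining \<open>V Z\<close> is attained at \<open>S Z = T\<^sub>Z (Z + \<Gamma>)\<close>, where
  \<open>T\<^sub>Z\<close> is the increasing map from the law of \<open>Z + \<Gamma>\<close> to \<open>\<nu>\<close>. The law of \<open>Z + \<Gamma>\<close> has a density
  at most \<open>1\<close> and that of \<open>\<nu>\<close> is at least \<open>c1\<close>, so \<open>T\<^sub>Z\<close> is \<open>1/c1\<close>-Lipschitz, and the quadratic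
  gain in Kantorovich duality gives
  \<open>c1/2 * E[(S Z - S W)\<^sup>2] \<le> E[(S Z - S W) (Z - W)]\<close>.

  If \<open>W\<close> minimizes \<open>V\<close>, then the gradient vanishes at \<open>W\<close>, i.e. \<open>T\<^sub>W * \<gamma> (W) = X\<close>, and \<open>W\<close> is
  bounded because \<open>X\<close> stays away from the end points of the support of \<open>\<nu>\<close>. For the same reason the
  drift of the flow points inwards outside a large interval, so \<open>Z\<^sub>t\<close> is bounded uniformly in \<open>t\<close>.

  For \<open>Z\<close> and \<open>W\<close> with values in \<open>[-R, R]\<close> and equal means, condition on the position
  \<open>x = Z + \<Gamma>\<close>, which has a density bounded below on \<open>[-1, 1]\<close> given \<open>(Z, W)\<close>. There
  \<open>S Z - S W = T\<^sub>Z x - T\<^sub>W (x + W - Z)\<close>; the first term is constant and \<open>T\<^sub>W\<close> increases at least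
  linearly, so the mean square is at least a multiple of the variance of \<open>W - Z\<close>. This is strong
  monotonicity of the gradient, and exponential decay of both the distance and the functional
  follows by a Gronwall argument.\<close>

section \<open>Absolutely continuous functions and Dini derivatives\<close>

text \<open>The curve is differentiable only at almost every time, and \<open>V\<close> is handled
  through subgradients alone, so no chain rule is available. Each functional of the curve is treated
  as a real function whose left Dini derivative is bounded almost everywhere, and absolute
  continuity turns such a bound into decay. Run with rate 0, this argument conserves the mean, keeps
  the distance to \<open>W\<close> from growing and controls the excess of \<open>|Z t|\<close> over
  a level; run with a positive rate it gives both claims.

  The order is forced. The constant in strong monotonicity needs a sup bound on \<open>Z\<close>,
  the inward drift only a second-moment bound. Plain monotonicity bounds second moments, then the
  drift bounds \<open>Z\<close>, and only then is the rate uniform in time.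

  The computations use \<open>S Z\<close>, which depends on X and \<Gamma>, rather than its
  conditional expectation given X: the quadratic gain and the comparison on \<open>[-1, 1]\<close>
  both concern the mean square of \<open>S Z - S W\<close>. With f the standard normal density, the
  rate is \<open>c1 * f (1 + R) * (f (1 + 3 * R) / c2)^2\<close>, where \<open>R\<close> bounds both
  the flow and \<open>W\<close>.\<close>

definition abs_cont_on :: "real \<Rightarrow> real \<Rightarrow> (real \<Rightarrow> real) \<Rightarrow> bool" where
  "abs_cont_on a b g \<longleftrightarrow>
     (\<forall>\<epsilon>>0. \<exists>\<delta>>0. \<forall>(n::nat) u v.
        (\<forall>i<n. a \<le> u i \<and> u i \<le> v i \<and> v i \<le> b) \<longrightarrow>
        disjoint_family_on (\<lambda>i. {u i<..<v i}) {..<n} \<longrightarrow>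
        (\<Sum>i<n. v i - u i) < \<delta> \<longrightarrow>
        (\<Sum>i<n. \<bar>g (v i) - g (u i)\<bar>) < \<epsilon>)"

lemma abs_cont_on_subinterval:
  assumes "abs_cont_on a b g" "a \<le> c" "d \<le> b"
  shows "abs_cont_on c d g"
  unfolding abs_cont_on_def
proof (intro allI impI)
  fix \<epsilon> :: real assume "\<epsilon> > 0"
  with assms(1) obtain \<delta> where "\<delta> > 0" and \<delta>: "\<And>(n::nat) u v. (\<forall>i<n. a \<le> u i \<and> u i \<le> v i \<and> v i \<le> b) \<Longrightarrow>
        disjoint_family_on (\<lambda>i. {u i<..<v i}) {..<n} \<Longrightarrow>
        (\<Sum>i<n. v i - u i) < \<delta> \<Longrightarrow>
        (\<Sum>i<n. \<bar>g (v i) - g (u i)\<bar>) < \<epsilon>"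
    unfolding abs_cont_on_def by blast
  show "\<exists>\<delta>>0. \<forall>(n::nat) u v. (\<forall>i<n. c \<le> u i \<and> u i \<le> v i \<and> v i \<le> d) \<longrightarrow>
        disjoint_family_on (\<lambda>i. {u i<..<v i}) {..<n} \<longrightarrow>
        (\<Sum>i<n. v i - u i) < \<delta> \<longrightarrow>
        (\<Sum>i<n. \<bar>g (v i) - g (u i)\<bar>) < \<epsilon>"
    using \<open>\<delta> > 0\<close> assms(2,3) by (intro exI[of _ \<delta>]) (auto intro!: \<delta> intro: order_trans)
qed

lemma abs_cont_on_add_linear:
  assumes "abs_cont_on a b g"
  shows "abs_cont_on a b (\<lambda>t. g t + c * t)"
  unfolding abs_cont_on_def
proof (intro allI impI)
  fix \<epsilon> :: real assume "\<epsilon> > 0"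
  hence "\<epsilon> / 2 > 0" by simp
  with assms obtain \<delta> where "\<delta> > 0" and \<delta>: "\<And>(n::nat) u v. (\<forall>i<n. a \<le> u i \<and> u i \<le> v i \<and> v i \<le> b) \<Longrightarrow>
        disjoint_family_on (\<lambda>i. {u i<..<v i}) {..<n} \<Longrightarrow>
        (\<Sum>i<n. v i - u i) < \<delta> \<Longrightarrow>
        (\<Sum>i<n. \<bar>g (v i) - g (u i)\<bar>) < \<epsilon> / 2"
    unfolding abs_cont_on_def by blast
  define \<delta>' where "\<delta>' = min \<delta> (\<epsilon> / (2 * (\<bar>c\<bar> + 1)))"
  have "\<delta>' > 0" using \<open>\<delta> > 0\<close> \<open>\<epsilon> > 0\<close> by (auto simp: \<delta>'_def intro!: divide_pos_pos)
  moreover have "(\<Sum>i<n. \<bar>g (v i) + c * v i - (g (u i) + c * u i)\<bar>) < \<epsilon>"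
    if *: "\<forall>i<n. a \<le> u i \<and> u i \<le> v i \<and> v i \<le> b" and 
      **: "disjoint_family_on (\<lambda>i. {u i<..<v i}) {..<n}" "(\<Sum>i<n. v i - u i) < \<delta>'" for n :: nat and u v
  proof -
    have "(\<Sum>i<n. \<bar>g (v i) + c * v i - (g (u i) + c * u i)\<bar>)
        \<le> (\<Sum>i<n. \<bar>g (v i) - g (u i)\<bar> + \<bar>c\<bar> * (v i - u i))"
    proof (rule sum_mono)
      fix i assume "i \<in> {..<n}"
      hence "u i \<le> v i" using * by auto
      have "\<bar>g (v i) + c * v i - (g (u i) + c * u i)\<bar> = \<bar>(g (v i) - g (u i)) + c * (v i - u i)\<bar>"
        by (simp add: algebra_simps)
      also have "\<dots> \<le> \<bar>g (v i) - g (u i)\<bar> + \<bar>c * (v i - u i)\<bar>" by (rule abs_triangle_ineq)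
      also have "\<bar>c * (v i - u i)\<bar> = \<bar>c\<bar> * (v i - u i)" using \<open>u i \<le> v i\<close> by (simp add: abs_mult)
      finally show "\<bar>g (v i) + c * v i - (g (u i) + c * u i)\<bar> \<le> \<bar>g (v i) - g (u i)\<bar> + \<bar>c\<bar> * (v i - u i)" .
    qed
    also have "\<dots> = (\<Sum>i<n. \<bar>g (v i) - g (u i)\<bar>) + \<bar>c\<bar> * (\<Sum>i<n. v i - u i)"
      by (simp only: sum.distrib sum_distrib_left)
    also have "\<dots> < \<epsilon> / 2 + (\<bar>c\<bar> + 1) * \<delta>'"
    proof (rule add_less_le_mono)
      show "(\<Sum>i<n. \<bar>g (v i) - g (u i)\<bar>) < \<epsilon> / 2" using * ** by (intro \<delta>) (auto simp: \<delta>'_def)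
      have "0 \<le> (\<Sum>i<n. v i - u i)" using * by (intro sum_nonneg) auto
      thus "\<bar>c\<bar> * (\<Sum>i<n. v i - u i) \<le> (\<bar>c\<bar> + 1) * \<delta>'" using ** by (intro mult_mono) auto
    qed
    also have "(\<bar>c\<bar> + 1) * \<delta>' \<le> (\<bar>c\<bar> + 1) * (\<epsilon> / (2 * (\<bar>c\<bar> + 1)))"
      by (intro mult_left_mono) (auto simp: \<delta>'_def)
    also have "\<dots> = \<epsilon> / 2" by (simp add: field_simps add_nonneg_eq_0_iff)
    finally show ?thesis by simp
  qed
  ultimately show "\<exists>\<delta>>0. \<forall>(n::nat) u v. (\<forall>i<n. a \<le> u i \<and> u i \<le> v i \<and> v i \<le> b) \<longrightarrow>
        disjoint_family_on (\<lambda>i. {u i<..<v i}) {..<n} \<longrightarrow>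
        (\<Sum>i<n. v i - u i) < \<delta> \<longrightarrow>
        (\<Sum>i<n. \<bar>g (v i) + c * v i - (g (u i) + c * u i)\<bar>) < \<epsilon>" by blast
qed

lemma abs_cont_on_imp_continuous_on:
  assumes "abs_cont_on a b g"
  shows "continuous_on {a..b} g"
  unfolding continuous_on_iff
proof (intro ballI allI impI)
  fix x \<epsilon> :: real assume x: "x \<in> {a..b}" and "\<epsilon> > 0"
  with assms obtain \<delta> where "\<delta> > 0" and \<delta>: "\<And>(n::nat) u v. (\<forall>i<n. a \<le> u i \<and> u i \<le> v i \<and> v i \<le> b) \<Longrightarrow>
        disjoint_family_on (\<lambda>i. {u i<..<v i}) {..<n} \<Longrightarrow>
        (\<Sum>i<n. v i - u i) < \<delta> \<Longrightarrow>
        (\<Sum>i<n. \<bar>g (v i) - g (u i)\<bar>) < \<epsilon>"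
    unfolding abs_cont_on_def by blast
  have "dist (g y) (g x) < \<epsilon>" if "y \<in> {a..b}" "dist y x < \<delta>" for y
    using \<delta>[of 1 "\<lambda>_. x" "\<lambda>_. y"] \<delta>[of 1 "\<lambda>_. y" "\<lambda>_. x"] x that
    by (cases "x \<le> y") (auto simp: disjoint_family_on_def dist_real_def)
  thus "\<exists>d>0. \<forall>x'\<in>{a..b}. dist x' x < d \<longrightarrow> dist (g x') (g x) < \<epsilon>"
    using \<open>\<delta> > 0\<close> by blast
qed

text \<open>A Cousin-type sweep from \<open>b\<close> down to \<open>a\<close>. Exceptional points lie in an open set \<open>U\<close> of small
  measure; the variation \<open>\<psi>\<close> of \<open>g\<close> over \<open>U\<close> is small by absolute continuity and pays for the
  increase of \<open>g\<close> near these points.\<close>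

lemma abs_cont_on_decreasing:
  fixes g :: "real \<Rightarrow> real"
  assumes ab: "a \<le> b" and ac: "abs_cont_on a b g"
    and dini: "AE t in lborel. a < t \<and> t \<le> b \<longrightarrow>
                 (\<forall>\<epsilon>>0. \<forall>\<^sub>F s in at_left t. g t - g s \<le> \<epsilon> * (t - s))"
  shows "g b \<le> g a"
proof -
  have key: "g b \<le> g a + \<epsilon> * (b - a) + \<epsilon>" if "\<epsilon> > 0" for \<epsilon> :: real
  proof -
    from ac \<open>\<epsilon> > 0\<close> obtain \<delta> where "\<delta> > 0" and \<delta>: "\<And>(n::nat) u v. (\<forall>i<n. a \<le> u i \<and> u i \<le> v i \<and> v i \<le> b) \<Longrightarrow>
        disjoint_family_on (\<lambda>i. {u i<..<v i}) {..<n} \<Longrightarrow>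
        (\<Sum>i<n. v i - u i) < \<delta> \<Longrightarrow>
        (\<Sum>i<n. \<bar>g (v i) - g (u i)\<bar>) < \<epsilon>"
      unfolding abs_cont_on_def by blast
    obtain N where N': "\<And>t. t \<in> space lborel - N \<Longrightarrow> a < t \<and> t \<le> b \<longrightarrow>
                 (\<forall>\<epsilon>>0. \<forall>\<^sub>F s in at_left t. g t - g s \<le> \<epsilon> * (t - s))"
      and N: "N \<in> null_sets lborel"
      by (rule AE_E3[OF dini], rule that)
    have Nd: "\<forall>\<^sub>F s in at_left t. g t - g s \<le> \<epsilon> * (t - s)" if "t \<notin> N" "a < t" "t \<le> b" for t
      using N'[of t] that \<open>\<epsilon> > 0\<close> by simp
    from N obtain U where U: "open U" "N \<subseteq> U" "emeasure lborel (U - N) < ennreal \<delta>"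
      using outer_regular_lborel[of N \<delta>] \<open>\<delta> > 0\<close> by (auto simp: null_sets_def)
    have mU: "emeasure lborel U < ennreal \<delta>"
    proof -
      have "emeasure lborel U \<le> emeasure lborel (U - N) + emeasure lborel N"
        using U N by (intro order.trans[OF emeasure_mono emeasure_subadditive]) auto
      also have "\<dots> < ennreal \<delta>" using U N by (simp add: null_sets_def)
      finally show ?thesis .
    qed
    define fam where "fam t n u v \<longleftrightarrow> (\<forall>i<n. a \<le> u i \<and> u i \<le> v i \<and> v i \<le> t \<and> {u i<..<v i} \<subseteq> U) \<and>
         disjoint_family_on (\<lambda>i. {u i<..<v i}) {..<n}" for t and n :: nat and u v :: "nat \<Rightarrow> real"
    define vs where "vs n u v = (\<Sum>i<n. \<bar>g (v i) - g (u i)\<bar>)" for n :: nat and u v :: "nat \<Rightarrow> real"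
    define \<psi> where "\<psi> t = Sup {x. \<exists>n u v. fam t n u v \<and> x = vs n u v}" for t
    have vs_le: "vs n u v \<le> \<epsilon>" if "fam t n u v" "t \<le> b" for t n u v
    proof -
      have "ennreal (\<Sum>i<n. v i - u i) = (\<Sum>i<n. emeasure lborel {u i<..<v i})"
        using that by (subst sum_ennreal[symmetric]) (auto simp: fam_def intro!: sum.cong)
      also have "\<dots> = emeasure lborel (\<Union>i<n. {u i<..<v i})"
        using that by (intro sum_emeasure) (auto simp: fam_def)
      also have "\<dots> \<le> emeasure lborel U"
        using that U by (intro emeasure_mono) (auto simp: fam_def)
      also have "\<dots> < ennreal \<delta>" by (rule mU)
      finally have "(\<Sum>i<n. v i - u i) < \<delta>"
        by (subst (asm) ennreal_less_iff) (use that in \<open>auto simp: fam_def intro!: sum_nonneg\<close>)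
      thus ?thesis using that unfolding vs_def
        by (intro less_imp_le[OF \<delta>]) (auto simp: fam_def intro: order_trans)
    qed
    have bdd: "bdd_above {x. \<exists>n u v. fam t n u v \<and> x = vs n u v}" if "t \<le> b" for t
      using vs_le[OF _ that] by (intro bdd_aboveI[of _ \<epsilon>]) blast
    have fam0: "fam t 0 (\<lambda>_. 0) (\<lambda>_. 0)" for t by (auto simp: fam_def disjoint_family_on_def)
    have vs0: "vs 0 u v = 0" for u v by (simp add: vs_def)
    have \<psi>_le: "\<psi> t \<le> \<epsilon>" if "t \<le> b" for t
      unfolding \<psi>_def using vs_le[OF _ that] fam0 by (intro cSup_least) blast+
    have \<psi>_ge: "0 \<le> \<psi> t" if "t \<le> b" for t
      unfolding \<psi>_def using fam0 vs0 by (intro cSup_upper bdd that) fastforce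
    \<comment> \<open>The interval \<open>(s, t)\<close> is appended to a family left of
      \<open>s\<close>; disjointness holds because that family ends by \<open>s\<close>.\<close>
    have step: "\<psi> s + \<bar>g t - g s\<bar> \<le> \<psi> t" if st: "a \<le> s" "s \<le> t" "t \<le> b" "{s<..<t} \<subseteq> U" for s t
    proof -
      have "\<psi> s \<le> \<psi> t - \<bar>g t - g s\<bar>"
      proof (subst \<psi>_def, rule cSup_least)
        show "{x. \<exists>n u v. fam s n u v \<and> x = vs n u v} \<noteq> {}" using fam0 by blast
        fix x assume "x \<in> {x. \<exists>n u v. fam s n u v \<and> x = vs n u v}"
        then obtain n u v where x: "fam s n u v" "x = vs n u v" by blast
        have "fam t (Suc n) (u(n := s)) (v(n := t))"
          unfolding fam_def
        proof
          show "\<forall>i<Suc n. a \<le> (u(n := s)) i \<and> (u(n := s)) i \<le> (v(n := t)) i \<and> (v(n := t)) i \<le> t \<and>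
              {(u(n := s)) i<..<(v(n := t)) i} \<subseteq> U"
            using x(1) st unfolding fam_def by (auto simp: less_Suc_eq)
          have "{u i<..<v i} \<inter> {s<..<t} = {}" if "i < n" for i
            using x(1) that unfolding fam_def by auto
          thus "disjoint_family_on (\<lambda>i. {(u(n := s)) i<..<(v(n := t)) i}) {..<Suc n}"
            using x(1) unfolding fam_def disjoint_family_on_def
            by (simp add: less_Suc_eq Ball_def) (metis min.commute max.commute)
        qed
        hence "vs (Suc n) (u(n := s)) (v(n := t)) \<le> \<psi> t"
          unfolding \<psi>_def by (intro cSup_upper bdd st) blast
        also have "vs (Suc n) (u(n := s)) (v(n := t)) = x + \<bar>g t - g s\<bar>"
          unfolding vs_def x(2) by simp
        finally show "x \<le> \<psi> t - \<bar>g t - g s\<bar>" by simp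
      qed
      thus ?thesis by simp
    qed
    have \<psi>_mono: "\<psi> s \<le> \<psi> t" if "s \<le> t" "t \<le> b" for s t
      unfolding \<psi>_def
    proof (rule cSup_subset_mono)
      show "{x. \<exists>n u v. fam s n u v \<and> x = vs n u v} \<noteq> {}" using fam0 by blast
      show "{x. \<exists>n u v. fam s n u v \<and> x = vs n u v} \<subseteq> {x. \<exists>n u v. fam t n u v \<and> x = vs n u v}"
        using that unfolding fam_def by (blast intro: order_trans)
    qed (rule bdd[OF that(2)])
    \<comment> \<open>The term \<open>\<epsilon> * t\<close> pays for the increase at ordinary
      points and \<psi> for that at exceptional ones: in both cases \<open>G t \<le> G s\<close> for
      \<open>s\<close> slightly left of \<open>t\<close>. Together the two corrections cost at most
      \<open>\<epsilon> * (b - a) + \<epsilon>\<close>.\<close>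
    define G where "G t = g t - \<epsilon> * t - \<psi> t" for t
    define A where "A = {s\<in>{a..b}. \<forall>r\<in>{s..b}. G b \<le> G r}"
    have bA: "b \<in> A" using ab by (auto simp: A_def)
    have bddA: "bdd_below A" by (intro bdd_belowI[of _ a]) (auto simp: A_def)
    define s0 where "s0 = Inf A"
    have s0: "a \<le> s0" "s0 \<le> b"
      unfolding s0_def using bA bddA by (auto intro!: cInf_greatest cInf_lower simp: A_def)
    have right: "G b \<le> G r" if r: "s0 < r" "r \<le> b" for r
    proof -
      obtain s where "s \<in> A" "s < r" using r(1) bA bddA unfolding s0_def by (subst (asm) cInf_less_iff) auto
      thus ?thesis using r by (auto simp: A_def)
    qed
    have at_s0: "G b \<le> G s0"
    proof (cases "s0 = b")
      case False
      hence "s0 < b" using s0 by simp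
      have "continuous_on {s0..b} g"
        using abs_cont_on_imp_continuous_on[OF ac] by (rule continuous_on_subset) (use s0 in auto)
      hence "(g \<longlongrightarrow> g s0) (at s0 within {s0..b})"
        using \<open>s0 < b\<close> by (simp add: continuous_on_def)
      hence lim: "(g \<longlongrightarrow> g s0) (at_right s0)"
        using \<open>s0 < b\<close> by (simp add: at_within_Icc_at_right)
      \<comment> \<open>Only \<open>g\<close> is passed to the limit. The monotone \<psi> is frozen
        at its smaller value \<open>\<psi> s0\<close>, so its possible jumps do no harm.\<close>
      have "((\<lambda>r. g r - \<epsilon> * r - \<psi> s0) \<longlongrightarrow> g s0 - \<epsilon> * s0 - \<psi> s0) (at_right s0)"
        by (intro tendsto_intros lim)
      moreover have "\<forall>\<^sub>F r in at_right s0. G b \<le> g r - \<epsilon> * r - \<psi> s0"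
        using \<open>s0 < b\<close> unfolding eventually_at_right_field
      proof (intro exI[of _ b] conjI allI impI)
        fix r assume "s0 < r" "r < b"
        thus "G b \<le> g r - \<epsilon> * r - \<psi> s0"
          using right[of r] \<psi>_mono[of s0 r] by (auto simp: G_def)
      qed
      ultimately show ?thesis unfolding G_def[of s0]
        by (intro tendsto_lowerbound[of _ _ "at_right s0"]) auto
    qed simp
    have "s0 = a"
    proof (rule ccontr)
      assume "s0 \<noteq> a"
      hence "a < s0" using s0 by simp
      obtain c where c: "c < s0" "\<And>s. c < s \<Longrightarrow> s < s0 \<Longrightarrow> a \<le> s \<Longrightarrow> G s0 \<le> G s"
      proof (cases "s0 \<in> N")
        case True
        hence "s0 \<in> U" using U by auto
        then obtain e where e: "e > 0" "ball s0 e \<subseteq> U" using U by (meson openE)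
        show thesis
        proof (rule that[of "s0 - e"])
          fix s assume s: "s0 - e < s" "s < s0" "a \<le> s"
          have "{s<..<s0} \<subseteq> U" using e s by (force simp: dist_real_def)
          from step[OF s(3) _ s0(2) this] s
          have "\<psi> s + \<bar>g s0 - g s\<bar> \<le> \<psi> s0" by simp
          moreover have "\<epsilon> * s \<le> \<epsilon> * s0" using s \<open>\<epsilon> > 0\<close> by simp
          ultimately show "G s0 \<le> G s" unfolding G_def by linarith
        qed (use e in auto)
      next
        case False
        from Nd[OF this \<open>a < s0\<close> s0(2)] obtain c where c: "c < s0"
          "\<And>s. c < s \<Longrightarrow> s < s0 \<Longrightarrow> g s0 - g s \<le> \<epsilon> * (s0 - s)"
          by (auto simp: eventually_at_left_field)
        show thesis
        proof (rule that[OF c(1)])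
          fix s assume s: "c < s" "s < s0" "a \<le> s"
          show "G s0 \<le> G s" using c(2)[OF s(1,2)] \<psi>_mono[of s s0] s s0
            unfolding G_def by (simp add: algebra_simps)
        qed
      qed
      define r where "r = (max a c + s0) / 2"
      have r: "a \<le> r" "c < r" "r < s0" using \<open>a < s0\<close> c(1) by (auto simp: r_def max_def)
      have "r \<in> A" unfolding A_def
      proof (intro CollectI conjI ballI)
        show "r \<in> {a..b}" using r s0 by auto
        fix q assume q: "q \<in> {r..b}"
        consider "q < s0" | "q = s0" | "q > s0" by linarith
        thus "G b \<le> G q"
        proof cases
          case 1
          hence "G s0 \<le> G q" using q r by (intro c(2)) auto
          thus ?thesis using at_s0 by simp
        qed (use at_s0 right q in auto)
      qed
      hence "s0 \<le> r" unfolding s0_def using bddA by (intro cInf_lower) auto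
      thus False using r by simp
    qed
    with at_s0 have "G b \<le> G a" by simp
    thus ?thesis using \<psi>_le[of b] \<psi>_ge[OF ab] unfolding G_def by (simp add: algebra_simps)
  qed
  have "((\<lambda>\<epsilon>. g a + \<epsilon> * (b - a) + \<epsilon>) \<longlongrightarrow> g a + 0 * (b - a) + 0) (at_right 0)"
    by (intro tendsto_intros)
  moreover have "\<forall>\<^sub>F \<epsilon> in at_right 0. g b \<le> g a + \<epsilon> * (b - a) + \<epsilon>"
    using key by (auto simp: eventually_at_right_field intro!: exI[of _ 1])
  ultimately have "g b \<le> g a + 0 * (b - a) + 0"
    by (intro tendsto_lowerbound[of _ _ "at_right (0::real)"]) auto
  thus ?thesis by simp
qed

text \<open>The factor \<open>(1 + \<kappa>T/n)\<^sup>-\<^sup>n\<close> comes from \<open>n\<close> implicit Euler steps; this avoids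
  differentiating \<open>exp (\<kappa> t) * g t\<close>.\<close>

lemma abs_cont_on_exp_decay:
  fixes g :: "real \<Rightarrow> real"
  assumes ac: "\<And>T. 0 \<le> T \<Longrightarrow> abs_cont_on 0 T g"
    and nonneg: "\<And>t. 0 \<le> t \<Longrightarrow> 0 \<le> g t" and "\<kappa> \<ge> 0"
    and dini: "AE t in lborel. 0 < t \<longrightarrow>
                 (\<forall>\<epsilon>>0. \<forall>\<^sub>F s in at_left t. g t - g s \<le> (\<epsilon> - \<kappa> * g t) * (t - s))"
    and "0 \<le> T"
  shows "g T \<le> g 0 * exp (- \<kappa> * T)"
proof -
  have dec: "g t \<le> g s" if "0 \<le> s" "s \<le> t" for s t
  proof (rule abs_cont_on_decreasing[OF that(2)])
    show "abs_cont_on s t g" by (rule abs_cont_on_subinterval[OF ac[of t]]) (use that in auto)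
    show "AE r in lborel. s < r \<and> r \<le> t \<longrightarrow> (\<forall>\<epsilon>>0. \<forall>\<^sub>F q in at_left r. g r - g q \<le> \<epsilon> * (r - q))"
      using dini
    proof eventually_elim
      case (elim r)
      show ?case
      proof (intro impI allI)
        fix \<epsilon> :: real assume r: "s < r \<and> r \<le> t" and "\<epsilon> > 0"
        hence "\<forall>\<^sub>F q in at_left r. g r - g q \<le> (\<epsilon> - \<kappa> * g r) * (r - q)" using elim that by auto
        moreover have "\<forall>\<^sub>F q in at_left r. q < r" by (simp add: eventually_at_left_field) (meson gt_ex lt_ex)
        ultimately show "\<forall>\<^sub>F q in at_left r. g r - g q \<le> \<epsilon> * (r - q)"
        proof eventually_elim
          case (elim q)
          have "\<kappa> * g r * (r - q) \<ge> 0" using \<open>\<kappa> \<ge> 0\<close> nonneg[of r] r that elim by auto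
          thus ?case using elim(1) by (simp add: algebra_simps)
        qed
      qed
    qed
  qed
  \<comment> \<open>On \<open>[s, t]\<close> the rate \<open>\<kappa> * g r\<close> is at least its
    value at the right end point, by the monotonicity just shown. Hence \<open>g\<close> plus a
    linear function with that constant slope is nonincreasing, which is one implicit Euler
    step.\<close>
  have step: "g t * (1 + \<kappa> * (t - s)) \<le> g s" if "0 \<le> s" "s \<le> t" for s t
  proof -
    have "g t + (\<kappa> * g t) * t \<le> g s + (\<kappa> * g t) * s"
    proof (rule abs_cont_on_decreasing[OF that(2), where g = "\<lambda>r. g r + (\<kappa> * g t) * r"])
      show "abs_cont_on s t (\<lambda>r. g r + (\<kappa> * g t) * r)"
        by (intro abs_cont_on_add_linear abs_cont_on_subinterval[OF ac[of t]]) (use that in auto)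
      show "AE r in lborel. s < r \<and> r \<le> t \<longrightarrow> (\<forall>\<epsilon>>0. \<forall>\<^sub>F q in at_left r.
          g r + \<kappa> * g t * r - (g q + \<kappa> * g t * q) \<le> \<epsilon> * (r - q))"
        using dini
      proof eventually_elim
        case (elim r)
        show ?case
        proof (intro impI allI)
          fix \<epsilon> :: real assume r: "s < r \<and> r \<le> t" and "\<epsilon> > 0"
          hence "\<forall>\<^sub>F q in at_left r. g r - g q \<le> (\<epsilon> - \<kappa> * g r) * (r - q)" using elim that by auto
          moreover have "\<forall>\<^sub>F q in at_left r. q < r" by (simp add: eventually_at_left_field) (meson gt_ex lt_ex)
          ultimately show "\<forall>\<^sub>F q in at_left r. g r + \<kappa> * g t * r - (g q + \<kappa> * g t * q) \<le> \<epsilon> * (r - q)"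
          proof eventually_elim
            case (elim q)
            have "\<kappa> * (r - q) * g t \<le> \<kappa> * (r - q) * g r" using \<open>\<kappa> \<ge> 0\<close> dec[of r t] r that elim
              by (intro mult_left_mono) auto
            thus ?case using elim(1) by (simp add: algebra_simps)
          qed
        qed
      qed
    qed
    thus ?thesis by (simp add: algebra_simps)
  qed
  have pow: "g (real k * h) * (1 + \<kappa> * h) ^ k \<le> g 0" if "h \<ge> 0" for k :: nat and h
  proof (induction k)
    case (Suc k)
    have "g (real (Suc k) * h) * (1 + \<kappa> * h) \<le> g (real k * h)"
      using step[of "real k * h" "real (Suc k) * h"] that by (simp add: algebra_simps)
    hence "g (real (Suc k) * h) * (1 + \<kappa> * h) * (1 + \<kappa> * h) ^ k \<le> g (real k * h) * (1 + \<kappa> * h) ^ k"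
      using \<open>\<kappa> \<ge> 0\<close> that by (intro mult_right_mono) auto
    also have "\<dots> \<le> g 0" by (rule Suc)
    finally show ?case by (simp add: mult.assoc)
  qed simp
  have "(\<lambda>n. (1 + (\<kappa> * T) / real n) ^ n) \<longlonglongrightarrow> exp (\<kappa> * T)"
    by (rule tendsto_exp_limit_sequentially)
  hence "(\<lambda>n. g T * (1 + (\<kappa> * T) / real n) ^ n) \<longlonglongrightarrow> g T * exp (\<kappa> * T)"
    by (intro tendsto_intros)
  moreover have "\<forall>\<^sub>F n in sequentially. g T * (1 + (\<kappa> * T) / real n) ^ n \<le> g 0"
    using eventually_gt_at_top[of 0]
  proof eventually_elim
    case (elim n)
    thus ?case using pow[of "T / real n" n] \<open>0 \<le> T\<close> by simp
  qed
  ultimately have "g T * exp (\<kappa> * T) \<le> g 0"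
    by (intro tendsto_upperbound[of _ _ sequentially]) auto
  thus ?thesis by (simp add: exp_minus field_simps)
qed

section \<open>Square-integrable functions\<close>

lemma L2_D:
  assumes "f \<in> L2 M M"
  shows "f \<in> borel_measurable M" "integrable M (\<lambda>x. (f x)\<^sup>2)"
  using assms by (auto simp: L2_def)

lemma L2_mult_integrable:
  assumes "f \<in> L2 M M" "g \<in> L2 M M"
  shows "integrable M (\<lambda>x. f x * g x)"
proof (rule Bochner_Integration.integrable_bound)
  show "integrable M (\<lambda>x. (f x)\<^sup>2 + (g x)\<^sup>2)" using assms by (auto simp: L2_def)
  show "(\<lambda>x. f x * g x) \<in> borel_measurable M"
    using L2_D(1)[OF assms(1)] L2_D(1)[OF assms(2)] by measurable
  show "AE x in M. norm (f x * g x) \<le> norm ((f x)\<^sup>2 + (g x)\<^sup>2)"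
  proof (rule AE_I2)
    fix x
    have "2 * (\<bar>f x\<bar> * \<bar>g x\<bar>) \<le> (f x)\<^sup>2 + (g x)\<^sup>2"
      using sum_squares_bound[of "\<bar>f x\<bar>" "\<bar>g x\<bar>"] by simp
    moreover have "0 \<le> \<bar>f x\<bar> * \<bar>g x\<bar>" by simp
    ultimately have "\<bar>f x\<bar> * \<bar>g x\<bar> \<le> (f x)\<^sup>2 + (g x)\<^sup>2" by linarith
    thus "norm (f x * g x) \<le> norm ((f x)\<^sup>2 + (g x)\<^sup>2)"
      by (simp add: abs_mult)
  qed
qed

lemma L2_bound:
  assumes "g \<in> L2 M M" "f \<in> borel_measurable M" "AE x in M. \<bar>f x\<bar> \<le> \<bar>g x\<bar>"
  shows "f \<in> L2 M M"
  unfolding L2_def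
proof (intro CollectI conjI)
  show "integrable M (\<lambda>x. (f x)\<^sup>2)"
  proof (rule Bochner_Integration.integrable_bound[OF L2_D(2)[OF assms(1)]])
    show "(\<lambda>x. (f x)\<^sup>2) \<in> borel_measurable M" using assms(2) by measurable
    show "AE x in M. norm ((f x)\<^sup>2) \<le> norm ((g x)\<^sup>2)"
      using assms(3) by eventually_elim (simp add: abs_le_square_iff)
  qed
qed (rule assms(2))

lemma L2_add:
  assumes "f \<in> L2 M F" "g \<in> L2 M F" "subalgebra M F"
  shows "(\<lambda>x. f x + g x) \<in> L2 M F"
proof -
  have "f \<in> L2 M M" "g \<in> L2 M M" 
    using assms by (auto simp: L2_def intro: measurable_from_subalg)
  hence "integrable M (\<lambda>x. (f x)\<^sup>2 + 2 * (f x * g x) + (g x)\<^sup>2)"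
    by (intro Bochner_Integration.integrable_add integrable_mult_right L2_mult_integrable L2_D(2))
  thus ?thesis using assms by (auto simp: L2_def power2_sum algebra_simps)
qed

lemma L2_scale:
  assumes "f \<in> L2 M F"
  shows "(\<lambda>x. c * f x) \<in> L2 M F"
  using assms by (auto simp: L2_def power_mult_distrib)

lemma L2_diff:
  assumes "f \<in> L2 M F" "g \<in> L2 M F" "subalgebra M F"
  shows "(\<lambda>x. f x - g x) \<in> L2 M F"
  using L2_add[OF assms(1) L2_scale[OF assms(2), of "-1"] assms(3)] by simp

lemma subalgebra_refl [simp]: "subalgebra M M"
  by (simp add: subalgebra_def)

lemma l2norm_nonneg [simp]: "0 \<le> l2norm M f"
  by (simp add: l2norm_def integral_nonneg_AE)

lemma l2norm_power2: "(l2norm M f)\<^sup>2 = (\<integral>x. (f x)\<^sup>2 \<partial>M)"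
  by (simp add: l2norm_def integral_nonneg_AE)

lemma l2norm_minus_commute: "l2norm M (\<lambda>x. f x - g x) = l2norm M (\<lambda>x. g x - f x)"
  by (simp add: l2norm_def power2_commute)

lemma l2norm_Cauchy_Schwarz:
  assumes f: "f \<in> L2 M M" and g: "g \<in> L2 M M"
  shows "\<bar>\<integral>x. f x * g x \<partial>M\<bar> \<le> l2norm M f * l2norm M g"
proof -
  define a b c where "a = (\<integral>x. (f x)\<^sup>2 \<partial>M)" and "b = (\<integral>x. f x * g x \<partial>M)" and "c = (\<integral>x. (g x)\<^sup>2 \<partial>M)"
  have ac: "a \<ge> 0" "c \<ge> 0" by (auto simp: a_def c_def integral_nonneg_AE)
  have quad: "0 \<le> s\<^sup>2 * a - 2 * s * t * b + t\<^sup>2 * c" for s t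
  proof -
    have "0 \<le> (\<integral>x. (s * f x - t * g x)\<^sup>2 \<partial>M)" by (simp add: integral_nonneg_AE)
    also have "\<dots> = (\<integral>x. s\<^sup>2 * (f x)\<^sup>2 - 2 * s * t * (f x * g x) + t\<^sup>2 * (g x)\<^sup>2 \<partial>M)"
      by (intro Bochner_Integration.integral_cong) (auto simp: power2_eq_square algebra_simps)
    also have "\<dots> = s\<^sup>2 * a - 2 * s * t * b + t\<^sup>2 * c"
      using L2_D(2)[OF f] L2_D(2)[OF g] L2_mult_integrable[OF f g]
      by (simp add: a_def b_def c_def)
    finally show ?thesis .
  qed
  have "b\<^sup>2 \<le> a * c"
  proof (cases "c = 0")
    case True
    have "b = 0"
    proof (rule ccontr)
      \<comment> \<open>For \<open>c = 0\<close> the quadratic form is linear in its second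
        argument; at \<open>(b, (a + 1) / 2)\<close> it equals \<open>- b^2\<close>.\<close>
      assume "b \<noteq> 0"
      have "0 \<le> b\<^sup>2 * a - (a + 1) * b\<^sup>2" 
        using quad[of b "(a + 1) / 2"] True by (simp add: power2_eq_square algebra_simps)
      hence "b\<^sup>2 \<le> 0" by (simp add: algebra_simps)
      thus False using \<open>b \<noteq> 0\<close> by simp
    qed
    thus ?thesis using ac by simp
  next
    case False
    hence "c > 0" using ac by simp
    have "0 \<le> c * (a * c - b\<^sup>2)" using quad[of c b] by (simp add: power2_eq_square algebra_simps)
    thus ?thesis using \<open>c > 0\<close> by (simp add: zero_le_mult_iff)
  qed
  hence "sqrt (b\<^sup>2) \<le> sqrt (a * c)" by (rule real_sqrt_le_mono)
  thus ?thesis by (simp add: l2norm_def a_def b_def c_def real_sqrt_mult)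
qed

lemma l2norm_mono:
  assumes "g \<in> L2 M M" "f \<in> borel_measurable M" "AE x in M. \<bar>f x\<bar> \<le> \<bar>g x\<bar>"
  shows "l2norm M f \<le> l2norm M g"
  unfolding l2norm_def
proof (intro real_sqrt_le_mono integral_mono_AE)
  show "integrable M (\<lambda>x. (f x)\<^sup>2)" "integrable M (\<lambda>x. (g x)\<^sup>2)"
    using L2_bound[OF assms] assms(1) by (auto dest: L2_D)
  show "AE x in M. (f x)\<^sup>2 \<le> (g x)\<^sup>2"
    using assms(3) by eventually_elim (simp add: abs_le_square_iff)
qed

lemma l2norm_triangle:
  assumes f: "f \<in> L2 M M" and g: "g \<in> L2 M M"
  shows "l2norm M (\<lambda>x. f x + g x) \<le> l2norm M f + l2norm M g"
proof (rule power2_le_imp_le)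
  have "(l2norm M (\<lambda>x. f x + g x))\<^sup>2 = (\<integral>x. (f x)\<^sup>2 + 2 * (f x * g x) + (g x)\<^sup>2 \<partial>M)"
    by (simp add: l2norm_power2 power2_sum algebra_simps)
  also have "\<dots> = (l2norm M f)\<^sup>2 + 2 * (\<integral>x. f x * g x \<partial>M) + (l2norm M g)\<^sup>2"
    using L2_D(2)[OF f] L2_D(2)[OF g] L2_mult_integrable[OF f g] by (simp add: l2norm_power2)
  also have "\<dots> \<le> (l2norm M f + l2norm M g)\<^sup>2"
    using l2norm_Cauchy_Schwarz[OF f g] by (simp add: power2_sum)
  finally show "(l2norm M (\<lambda>x. f x + g x))\<^sup>2 \<le> (l2norm M f + l2norm M g)\<^sup>2" .
qed simp

lemma l2norm_reverse_triangle:
  assumes f: "f \<in> L2 M M" and g: "g \<in> L2 M M"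
  shows "\<bar>l2norm M f - l2norm M g\<bar> \<le> l2norm M (\<lambda>x. f x - g x)"
  using l2norm_triangle[OF L2_diff[OF f g] g] l2norm_triangle[OF L2_diff[OF g f] f]
    l2norm_minus_commute[of M f g] by simp

lemma (in prob_space) L2_const: "(\<lambda>_. c) \<in> L2 M M"
  by (simp add: L2_def)

lemma (in prob_space) L2_integrable: "f \<in> L2 M M \<Longrightarrow> integrable M f"
  using L2_mult_integrable[OF _ L2_const[of 1]] by simp

lemma (in prob_space) L2_bounded:
  assumes "f \<in> borel_measurable M" "AE x in M. \<bar>f x\<bar> \<le> c"
  shows "f \<in> L2 M M"
  by (rule L2_bound[OF L2_const[of c] assms(1)]) (use assms(2) in \<open>eventually_elim, auto\<close>)

lemma (in prob_space) expectation_abs_le_l2norm: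
  assumes "f \<in> L2 M M"
  shows "(\<integral>x. \<bar>f x\<bar> \<partial>M) \<le> l2norm M f"
proof -
  have "(\<lambda>x. \<bar>f x\<bar>) \<in> L2 M M"
    using assms by (auto simp: L2_def)
  from l2norm_Cauchy_Schwarz[OF this L2_const[of 1]] show ?thesis
    by (simp add: l2norm_def prob_space)
qed

section \<open>Quadratic gain in Kantorovich duality\<close>

text \<open>Isolates what the quadratic gain requires of a transport map, without any measures. The
  range is an open interval: every value strictly inside is attained, and a competitor with the same
  law stays there almost surely.\<close>

locale transport_map =
  fixes T :: "real \<Rightarrow> real" and \<alpha> \<beta> L :: real
  assumes strict_mono_T: "strict_mono T"
    and range_T: "range T = {\<alpha><..<\<beta>}"
    and L_pos: "0 < L"
    and Lipschitz_T: "x \<le> y \<Longrightarrow> T y - T x \<le> L * (y - x)"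
begin

lemma T_le_iff: "T x \<le> T y \<longleftrightarrow> x \<le> y"
  using strict_mono_T by (rule strict_mono_less_eq)

lemma T_in: "\<alpha> < T x" "T x < \<beta>"
  using range_T by (auto simp: set_eq_iff image_iff)

lemma T_surj: "\<alpha> < y \<Longrightarrow> y < \<beta> \<Longrightarrow> \<exists>x. T x = y"
  using range_T by (metis greaterThanLessThan_iff rangeE)

lemma abs_T_le: "\<bar>T x\<bar> \<le> max \<bar>\<alpha>\<bar> \<bar>\<beta>\<bar>"
  using T_in[of x] by (auto simp: max_def)

lemma continuous_T: "continuous_on UNIV T"
proof -
  have "L-lipschitz_on UNIV T"
  proof (rule lipschitz_onI)
    fix x y
    show "dist (T x) (T y) \<le> L * dist x y"
      using Lipschitz_T[of x y] Lipschitz_T[of y x] T_le_iff[of x y] T_le_iff[of y x]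
      by (cases "x \<le> y") (auto simp: dist_real_def)
  qed (use L_pos in simp)
  thus ?thesis by (rule lipschitz_on_continuous_on)
qed

lemma measurable_T [measurable]: "T \<in> borel_measurable borel"
  using continuous_T by (rule borel_measurable_continuous_onI)

text \<open>\<open>v\<close> is the primitive of \<open>T\<close> and \<open>w\<close> its convex conjugate; the quadratic gain in Young's
  inequality is the usual consequence of the smoothness of \<open>v\<close>.\<close>

lemma ex_potentials:
  obtains v w :: "real \<Rightarrow> real" where
    "v \<in> borel_measurable borel" "w \<in> borel_measurable borel"
    "\<And>x. \<bar>v x\<bar> \<le> \<bar>v 0\<bar> + max \<bar>\<alpha>\<bar> \<bar>\<beta>\<bar> * \<bar>x\<bar>"
    "\<And>x. w (T x) = x * T x - v x"
    "\<And>x y. \<alpha> < y \<Longrightarrow> y < \<beta> \<Longrightarrow> (T x - y)\<^sup>2 / (2 * L) \<le> v x + w y - x * y"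
proof -
  have "\<exists>v. \<forall>x::real. -\<infinity> < ereal x \<longrightarrow> ereal x < \<infinity> \<longrightarrow> (v has_vector_derivative T x) (at x)"
    using continuous_T by (intro einterval_antiderivative) (auto simp: continuous_on_eq_continuous_at)
  then obtain v where v: "\<And>x. (v has_real_derivative T x) (at x)"
    by (auto simp: has_real_derivative_iff_has_vector_derivative)
  have tangent: "v x + T x * (y - x) \<le> v y" for x y
  proof (cases x y rule: linorder_cases)
    case less
    from MVT2[OF less, of v T] v obtain z where z: "x < z" "z < y" "v y - v x = (y - x) * T z" by blast
    have "(y - x) * T x \<le> (y - x) * T z" using z by (intro mult_left_mono) (auto simp: T_le_iff)
    thus ?thesis using z by (simp add: algebra_simps)
  next
    case greater
    from MVT2[OF greater, of v T] v obtain z where z: "y < z" "z < x" "v x - v y = (x - y) * T z" by blast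
    have "(x - y) * T z \<le> (x - y) * T x" using z by (intro mult_left_mono) (auto simp: T_le_iff)
    thus ?thesis using z by (simp add: algebra_simps)
  qed simp
  have smooth: "v y \<le> v x + T x * (y - x) + L / 2 * (y - x)\<^sup>2" for x y
  proof -
    define h where "h s = v s - T x * (s - x) - L / 2 * (s - x)\<^sup>2" for s
    have h: "(h has_real_derivative (T s - T x - L * (s - x))) (at s)" for s
      unfolding h_def by (auto intro!: derivative_eq_intros v)
    have "h y \<le> h x"
    proof (cases x y rule: linorder_cases)
      case less
      from MVT2[OF less, of h "\<lambda>s. T s - T x - L * (s - x)"] h obtain z where z: "x < z" "z < y" "h y - h x = (y - x) * (T z - T x - L * (z - x))" by blast
      have "(y - x) * (T z - T x - L * (z - x)) \<le> 0"
        using Lipschitz_T[of x z] z by (intro mult_nonneg_nonpos) auto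
      thus ?thesis using z by simp
    next
      case greater
      from MVT2[OF greater, of h "\<lambda>s. T s - T x - L * (s - x)"] h obtain z where z: "y < z" "z < x" "h x - h y = (x - y) * (T z - T x - L * (z - x))" by blast
      have "0 \<le> (x - y) * (T z - T x - L * (z - x))"
        using Lipschitz_T[of z x] z by (intro mult_nonneg_nonneg) (auto simp: algebra_simps)
      thus ?thesis using z by simp
    qed simp
    thus ?thesis by (simp add: h_def)
  qed
  \<comment> \<open>The inverse of \<open>T\<close>, with default value 0 outside the range. There
    \<open>w\<close> below is not the conjugate of \<open>v\<close>, so Young's inequality is
    claimed only for \<open>y\<close> in \<open>(\<alpha>, \<beta>)\<close>.\<close>
  define A where "A y = (if \<alpha> < y \<and> y < \<beta> then inv T y else 0)" for y
  have inj: "inj T" using strict_mono_T by (rule strict_mono_imp_inj_on)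
  have AT: "A (T x) = x" for x using T_in[of x] by (simp add: A_def inv_f_f[OF inj])
  have TA: "T (A y) = y" if "\<alpha> < y" "y < \<beta>" for y
    using T_surj[OF that] that by (auto simp: A_def inv_f_f[OF inj])
  have A_meas: "A \<in> borel_measurable borel"
  proof -
    have "A x \<le> A y" if "\<alpha> < x" "x \<le> y" "y < \<beta>" for x y
      using that TA[of x] TA[of y] T_le_iff[of "A x" "A y"] by auto
    hence "A \<in> borel_measurable (restrict_space borel {\<alpha><..<\<beta>})"
      by (intro borel_measurable_mono_on_fnc) (auto simp: mono_on_def)
    moreover have "{y. \<alpha> < y \<and> y < \<beta>} = {\<alpha><..<\<beta>}" by auto
    ultimately have "(\<lambda>y. if y \<in> {\<alpha><..<\<beta>} then A y else 0) \<in> borel_measurable borel"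
      by (intro measurable_If_restrict_space_iff[THEN iffD2]) auto
    moreover have "(\<lambda>y. if y \<in> {\<alpha><..<\<beta>} then A y else 0) = A" by (auto simp: A_def fun_eq_iff)
    ultimately show ?thesis by simp
  qed
  have v_meas: "v \<in> borel_measurable borel"
    using v by (intro borel_measurable_continuous_onI)
      (auto simp: continuous_on_eq_continuous_at intro: DERIV_isCont)
  define w where "w y = y * A y - v (A y)" for y
  show ?thesis
  proof (rule that[of v w])
    show "w \<in> borel_measurable borel" unfolding w_def using A_meas v_meas by measurable
    show "\<bar>v x\<bar> \<le> \<bar>v 0\<bar> + max \<bar>\<alpha>\<bar> \<bar>\<beta>\<bar> * \<bar>x\<bar>" for x
    proof -
      have "\<bar>T y * x\<bar> \<le> max \<bar>\<alpha>\<bar> \<bar>\<beta>\<bar> * \<bar>x\<bar>" for y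
        unfolding abs_mult by (intro mult_right_mono abs_T_le) auto
      from this[of 0] this[of x] show ?thesis using tangent[of 0 x] tangent[of x 0] by (simp add: abs_le_iff) linarith
    qed
    show "w (T x) = x * T x - v x" for x by (simp add: w_def AT)
    show "(T x - y)\<^sup>2 / (2 * L) \<le> v x + w y - x * y" if "\<alpha> < y" "y < \<beta>" for x y
    proof -
      define a where "a = A y"
      have y: "y = T a" using TA[OF that] by (simp add: a_def)
      \<comment> \<open>The supporting line at \<open>a\<close> and the quadratic upper bound at
        \<open>x\<close> are compared at the point \<open>x - d\<close>. This \<open>d\<close>
        maximizes \<open>(T x - T a) * d - L / 2 * d^2\<close>, and the maximum is the gain.\<close>
      define d where "d = (T x - T a) / L"
      have "v a + T a * (x - d - a) \<le> v (x - d)" by (rule tangent)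
      also have "v (x - d) \<le> v x + T x * (- d) + L / 2 * d\<^sup>2" using smooth[of "x - d" x] by simp
      finally have "v a + T a * (x - a) + (T x - T a) * d - L / 2 * d\<^sup>2 \<le> v x"
        by (simp add: algebra_simps)
      moreover have "(T x - T a) * d - L / 2 * d\<^sup>2 = (T x - T a)\<^sup>2 / (2 * L)"
        using L_pos by (simp add: d_def field_simps power2_eq_square)
      moreover have "w y = T a * a - v a" by (simp add: w_def a_def[symmetric] y[symmetric])
      ultimately show ?thesis unfolding y by (simp add: algebra_simps)
    qed
  qed (rule v_meas)
qed

end

text \<open>Young's inequality is integrated along \<open>(U, Y)\<close>. Since \<open>Y\<close> and
  \<open>T U\<close> have the same law, \<open>w Y\<close> and \<open>w (T U)\<close> have the same
  integral, so the potentials cancel and the gain remains. No bound on \<open>w\<close> is at hand;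
  its integrability is likewise transferred through the common law.\<close>

lemma (in prob_space) transport_gap:
  assumes "transport_map T \<alpha> \<beta> L" and U: "integrable M U" and Y: "Y \<in> borel_measurable M"
    and eq: "distr M borel Y = distr M borel (\<lambda>\<omega>. T (U \<omega>))"
  shows "(\<integral>\<omega>. (T (U \<omega>) - Y \<omega>)\<^sup>2 \<partial>M) / (2 * L) \<le> (\<integral>\<omega>. U \<omega> * (T (U \<omega>) - Y \<omega>) \<partial>M)"
    and "AE \<omega> in M. \<alpha> < Y \<omega> \<and> Y \<omega> < \<beta>"
proof -
  interpret transport_map T \<alpha> \<beta> L by fact
  have Um [measurable]: "U \<in> borel_measurable M" using U by auto
  note Y [measurable]
  have "AE y in distr M borel Y. \<alpha> < y \<and> y < \<beta>"
    unfolding eq by (subst AE_distr_iff) (auto simp: T_in)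
  thus Yin: "AE \<omega> in M. \<alpha> < Y \<omega> \<and> Y \<omega> < \<beta>"
    by (subst (asm) AE_distr_iff) auto
  obtain v w :: "real \<Rightarrow> real" where vm [measurable]: "v \<in> borel_measurable borel" and
    wm [measurable]: "w \<in> borel_measurable borel" and
    v_le: "\<And>x. \<bar>v x\<bar> \<le> \<bar>v 0\<bar> + max \<bar>\<alpha>\<bar> \<bar>\<beta>\<bar> * \<bar>x\<bar>" and
    wT: "\<And>x. w (T x) = x * T x - v x" and
    young: "\<And>x y. \<alpha> < y \<Longrightarrow> y < \<beta> \<Longrightarrow> (T x - y)\<^sup>2 / (2 * L) \<le> v x + w y - x * y"
    using ex_potentials by blast
  have intv: "integrable M (\<lambda>\<omega>. v (U \<omega>))"
  proof (rule Bochner_Integration.integrable_bound)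
    show "integrable M (\<lambda>\<omega>. \<bar>v 0\<bar> + max \<bar>\<alpha>\<bar> \<bar>\<beta>\<bar> * \<bar>U \<omega>\<bar>)" using U by auto
    show "AE \<omega> in M. norm (v (U \<omega>)) \<le> norm (\<bar>v 0\<bar> + max \<bar>\<alpha>\<bar> \<bar>\<beta>\<bar> * \<bar>U \<omega>\<bar>)"
      using v_le by (intro AE_I2) (auto intro: order_trans[OF _ abs_ge_self])
  qed measurable
  have intUY: "integrable M (\<lambda>\<omega>. U \<omega> * Y' \<omega>)"
    if [measurable]: "Y' \<in> borel_measurable M" and "AE \<omega> in M. \<alpha> < Y' \<omega> \<and> Y' \<omega> < \<beta>" for Y'
  proof (rule Bochner_Integration.integrable_bound)
    show "integrable M (\<lambda>\<omega>. max \<bar>\<alpha>\<bar> \<bar>\<beta>\<bar> * U \<omega>)" using U by auto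
    show "AE \<omega> in M. norm (U \<omega> * Y' \<omega>) \<le> norm (max \<bar>\<alpha>\<bar> \<bar>\<beta>\<bar> * U \<omega>)"
      using that(2)
    proof eventually_elim
      case (elim \<omega>)
      hence "\<bar>Y' \<omega>\<bar> * \<bar>U \<omega>\<bar> \<le> max \<bar>\<alpha>\<bar> \<bar>\<beta>\<bar> * \<bar>U \<omega>\<bar>" by (intro mult_right_mono) (auto simp: max_def)
      thus ?case by (simp add: abs_mult mult.commute)
    qed
  qed measurable
  have intUT: "integrable M (\<lambda>\<omega>. U \<omega> * T (U \<omega>))"
    by (rule intUY) (auto simp: T_in)
  note intUY' = intUY[OF Y Yin]
  have intwT: "integrable M (\<lambda>\<omega>. w (T (U \<omega>)))" unfolding wT using intUT intv by auto
  have "integrable (distr M borel Y) w"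
    unfolding eq using intwT by (subst integrable_distr_eq) auto
  hence intwY: "integrable M (\<lambda>\<omega>. w (Y \<omega>))" by (subst (asm) integrable_distr_eq) auto
  have "(\<integral>\<omega>. w (Y \<omega>) \<partial>M) = (\<integral>y. w y \<partial>distr M borel Y)" by (subst integral_distr) auto
  also have "\<dots> = (\<integral>\<omega>. w (T (U \<omega>)) \<partial>M)" unfolding eq by (subst integral_distr) auto
  also have "\<dots> = (\<integral>\<omega>. U \<omega> * T (U \<omega>) - v (U \<omega>) \<partial>M)" unfolding wT ..
  finally have wY: "(\<integral>\<omega>. w (Y \<omega>) \<partial>M) = (\<integral>\<omega>. U \<omega> * T (U \<omega>) \<partial>M) - (\<integral>\<omega>. v (U \<omega>) \<partial>M)"
    using intUT intv by simp
  have intsq: "integrable M (\<lambda>\<omega>. (T (U \<omega>) - Y \<omega>)\<^sup>2)"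
  proof (rule Bochner_Integration.integrable_bound)
    show "integrable M (\<lambda>\<omega>. (\<beta> - \<alpha>)\<^sup>2)" by auto
    show "AE \<omega> in M. norm ((T (U \<omega>) - Y \<omega>)\<^sup>2) \<le> norm ((\<beta> - \<alpha>)\<^sup>2)"
      using Yin
    proof eventually_elim
      case (elim \<omega>)
      hence "\<bar>T (U \<omega>) - Y \<omega>\<bar> \<le> \<bar>\<beta> - \<alpha>\<bar>" using T_in[of "U \<omega>"] by linarith
      thus ?case by (simp add: abs_le_square_iff)
    qed
  qed measurable
  have "(\<integral>\<omega>. (T (U \<omega>) - Y \<omega>)\<^sup>2 / (2 * L) \<partial>M) \<le> (\<integral>\<omega>. v (U \<omega>) + w (Y \<omega>) - U \<omega> * Y \<omega> \<partial>M)"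
  proof (rule integral_mono_AE)
    show "AE \<omega> in M. (T (U \<omega>) - Y \<omega>)\<^sup>2 / (2 * L) \<le> v (U \<omega>) + w (Y \<omega>) - U \<omega> * Y \<omega>"
      using Yin by eventually_elim (auto intro: young)
  qed (use intsq intv intwY intUY' in auto)
  also have "\<dots> = (\<integral>\<omega>. U \<omega> * T (U \<omega>) \<partial>M) - (\<integral>\<omega>. U \<omega> * Y \<omega> \<partial>M)"
    using intv intwY intUY' wY by simp
  also have "\<dots> = (\<integral>\<omega>. U \<omega> * (T (U \<omega>) - Y \<omega>) \<partial>M)"
    using intUT intUY' by (simp add: right_diff_distrib)
  finally show "(\<integral>\<omega>. (T (U \<omega>) - Y \<omega>)\<^sup>2 \<partial>M) / (2 * L) \<le> (\<integral>\<omega>. U \<omega> * (T (U \<omega>) - Y \<omega>) \<partial>M)" by simp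
qed

section \<open>Monotone maps on the line\<close>

lemma (in prob_space) second_moment_tail:
  assumes "f \<in> L2 M M" "0 < a"
  shows "prob {\<omega> \<in> space M. a \<le> \<bar>f \<omega>\<bar>} \<le> (\<integral>\<omega>. (f \<omega>)\<^sup>2 \<partial>M) / a\<^sup>2"
proof -
  note L2_D[OF assms(1), measurable]
  have "prob {\<omega> \<in> space M. a\<^sup>2 \<le> (f \<omega>)\<^sup>2} \<le> (\<integral>\<omega>. (f \<omega>)\<^sup>2 \<partial>M) / a\<^sup>2"
    using assms L2_D[OF assms(1)] by (intro integral_Markov_inequality_measure[where A="{}"]) auto
  also have "{\<omega> \<in> space M. a\<^sup>2 \<le> (f \<omega>)\<^sup>2} = {\<omega> \<in> space M. a \<le> \<bar>f \<omega>\<bar>}"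
    using assms(2) by (auto simp: abs_le_square_iff[symmetric])
  finally show ?thesis .
qed

text \<open>The quantile composition: the inverse distribution function of \<nu> applied to the
  distribution function of \<rho>. The search is confined to \<open>(\<alpha>, \<beta>)\<close>,
  where the former is injective, so that the description is unique.\<close>

definition monotone_map :: "real measure \<Rightarrow> real \<Rightarrow> real \<Rightarrow> real measure \<Rightarrow> real \<Rightarrow> real" where
  "monotone_map \<nu> \<alpha> \<beta> \<rho> x = (THE y. \<alpha> < y \<and> y < \<beta> \<and> cdf \<nu> y = cdf \<rho> x)"

text \<open>The density bounds are recorded as two-sided linear bounds on the distribution function.
  The lower one makes the monotone map onto \<nu> Lipschitz, the upper one keeps it from being
  flat.\<close>

locale transport_target =
  fixes \<nu> :: "real measure" and \<alpha> \<beta> c1 c2 :: real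
  assumes real_distribution_\<nu>: "real_distribution \<nu>"
    and c1_pos: "0 < c1"
    and cdf_\<alpha>: "cdf \<nu> \<alpha> = 0" and cdf_\<beta>: "cdf \<nu> \<beta> = 1"
    and cdf_lower: "\<alpha> \<le> y \<Longrightarrow> y \<le> y' \<Longrightarrow> y' \<le> \<beta> \<Longrightarrow> c1 * (y' - y) \<le> cdf \<nu> y' - cdf \<nu> y"
    and cdf_upper: "\<alpha> \<le> y \<Longrightarrow> y \<le> y' \<Longrightarrow> y' \<le> \<beta> \<Longrightarrow> cdf \<nu> y' - cdf \<nu> y \<le> c2 * (y' - y)"
begin

sublocale \<nu>: real_distribution \<nu> by (rule real_distribution_\<nu>)

lemma \<alpha>_less_\<beta>: "\<alpha> < \<beta>"
  using \<nu>.cdf_nondecreasing[of \<beta> \<alpha>] cdf_\<alpha> cdf_\<beta> by (rule_tac ccontr) simp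

lemma c2_pos: "0 < c2"
proof -
  have "0 < c1 * (\<beta> - \<alpha>)" using c1_pos \<alpha>_less_\<beta> by simp
  also have "\<dots> \<le> c2 * (\<beta> - \<alpha>)" by (rule order_trans[OF cdf_lower cdf_upper]) (use \<alpha>_less_\<beta> in auto)
  finally show ?thesis using \<alpha>_less_\<beta> by (simp add: zero_less_mult_iff)
qed

lemma cdf_strict: "\<alpha> \<le> y \<Longrightarrow> y < y' \<Longrightarrow> y' \<le> \<beta> \<Longrightarrow> cdf \<nu> y < cdf \<nu> y'"
  using cdf_lower[of y y'] mult_pos_pos[OF c1_pos, of "y' - y"] by simp

lemma continuous_cdf: "continuous_on {\<alpha>..\<beta>} (cdf \<nu>)"
proof -
  have "c2-lipschitz_on {\<alpha>..\<beta>} (cdf \<nu>)"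
  proof (rule lipschitz_onI)
    fix x y assume "x \<in> {\<alpha>..\<beta>}" "y \<in> {\<alpha>..\<beta>}"
    thus "dist (cdf \<nu> x) (cdf \<nu> y) \<le> c2 * dist x y"
      using cdf_upper[of x y] cdf_upper[of y x] \<nu>.cdf_nondecreasing[of x y] \<nu>.cdf_nondecreasing[of y x]
      by (cases "x \<le> y") (auto simp: dist_real_def)
  qed (use c2_pos in simp)
  thus ?thesis by (rule lipschitz_on_continuous_on)
qed

lemma measure_point:
  assumes "\<alpha> < y" "y < \<beta>"
  shows "measure \<nu> {y} = 0"
proof -
  have "isCont (cdf \<nu>) y"
    by (rule continuous_on_interior[OF continuous_cdf]) (use assms in auto)
  thus ?thesis using \<nu>.isCont_cdf by simp
qed

lemma cdf_inj: "\<alpha> \<le> y \<Longrightarrow> y \<le> \<beta> \<Longrightarrow> \<alpha> \<le> y' \<Longrightarrow> y' \<le> \<beta> \<Longrightarrow> cdf \<nu> y = cdf \<nu> y' \<Longrightarrow> y = y'"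
  using cdf_strict[of y y'] cdf_strict[of y' y] by (cases y y' rule: linorder_cases) auto

lemma AE_\<nu>_in: "AE y in \<nu>. \<alpha> < y \<and> y < \<beta>"
proof -
  have "continuous (at \<beta> within {\<alpha>..\<beta>}) (cdf \<nu>)"
    using continuous_cdf \<alpha>_less_\<beta> by (simp add: continuous_on_eq_continuous_within)
  hence "(cdf \<nu> \<longlongrightarrow> 1) (at_left \<beta>)"
    using \<alpha>_less_\<beta> cdf_\<beta> by (simp add: continuous_within at_within_Icc_at_left)
  with \<nu>.cdf_at_left[of \<beta>] have "measure \<nu> {..<\<beta>} = 1"
    by (intro tendsto_unique[of "at_left \<beta>"]) auto
  hence 1: "AE y in \<nu>. y \<in> {..<\<beta>}" by (intro \<nu>.AE_prob_1) auto
  have "measure \<nu> {..\<alpha>} = 0" using cdf_\<alpha> by (simp add: cdf_def)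
  hence "{..\<alpha>} \<in> null_sets \<nu>" by (simp add: \<nu>.emeasure_eq_measure null_sets_def)
  hence "AE y in \<nu>. y \<notin> {..\<alpha>}" by (rule AE_not_in)
  with 1 show ?thesis by eventually_elim auto
qed

end

text \<open>Gaussian smoothing provides both properties: positivity of the normal density gives
  strictness, and its upper bound 1 gives the Lipschitz constant 1.\<close>

locale regular_source = transport_target \<nu> \<alpha> \<beta> c1 c2 for \<nu> \<alpha> \<beta> c1 c2 +
  fixes \<rho> :: "real measure"
  assumes real_distribution_\<rho>: "real_distribution \<rho>"
    and cdf_\<rho>_strict: "x < y \<Longrightarrow> cdf \<rho> x < cdf \<rho> y"
    and cdf_\<rho>_Lipschitz: "x \<le> y \<Longrightarrow> cdf \<rho> y - cdf \<rho> x \<le> y - x"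
begin

sublocale \<rho>: real_distribution \<rho> by (rule real_distribution_\<rho>)

abbreviation T where "T \<equiv> monotone_map \<nu> \<alpha> \<beta> \<rho>"

lemma cdf_\<rho>_01: "0 < cdf \<rho> x" "cdf \<rho> x < 1"
  using cdf_\<rho>_strict[of "x - 1" x] cdf_\<rho>_strict[of x "x + 1"] \<rho>.cdf_nonneg[of "x - 1"]
    \<rho>.cdf_bounded_prob[of "x + 1"] by auto

lemma monotone_map_unique: "\<alpha> < y \<Longrightarrow> y < \<beta> \<Longrightarrow> cdf \<nu> y = cdf \<rho> x \<Longrightarrow> T x = y"
  unfolding monotone_map_def using cdf_inj by (intro the_equality) auto

lemma monotone_map: "\<alpha> < T x" "T x < \<beta>" "cdf \<nu> (T x) = cdf \<rho> x"
proof -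
  have "\<exists>y\<ge>\<alpha>. y \<le> \<beta> \<and> cdf \<nu> y = cdf \<rho> x"
    using cdf_\<rho>_01[of x] cdf_\<alpha> cdf_\<beta> \<alpha>_less_\<beta> continuous_cdf by (intro IVT') auto
  then obtain y where y: "\<alpha> \<le> y" "y \<le> \<beta>" "cdf \<nu> y = cdf \<rho> x" by blast
  moreover have "y \<noteq> \<alpha>" "y \<noteq> \<beta>" using y cdf_\<alpha> cdf_\<beta> cdf_\<rho>_01[of x] by auto
  ultimately have "\<alpha> < y" "y < \<beta>" by auto
  thus "\<alpha> < T x" "T x < \<beta>" "cdf \<nu> (T x) = cdf \<rho> x" using monotone_map_unique[of y x] y by auto
qed

text \<open>The \<nu>-mass between \<alpha> and \<open>T x\<close> is \<open>cdf \<rho> x\<close>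
  and costs at least \<open>c1\<close> per unit length, so tails of \<rho> control how far
  \<open>T x\<close> is from the end points.\<close>

lemma monotone_map_tails:
  shows "T x \<le> \<alpha> + cdf \<rho> x / c1" "\<beta> - (1 - cdf \<rho> x) / c1 \<le> T x"
  using cdf_lower[of \<alpha> "T x"] cdf_lower[of "T x" \<beta>] monotone_map[of x] cdf_\<alpha> cdf_\<beta> c1_pos
  by (auto simp: field_simps)

lemma monotone_map_mono: "x \<le> y \<Longrightarrow> T x \<le> T y"
  using cdf_strict[of "T y" "T x"] monotone_map[of x] monotone_map[of y] \<rho>.cdf_nondecreasing[of x y]
  by (rule_tac ccontr) auto

lemma monotone_map_strict: "x < y \<Longrightarrow> T x < T y"
  using monotone_map_mono[of x y] monotone_map[of x] monotone_map[of y] cdf_\<rho>_strict[of x y]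
  by (cases "T x = T y") auto

lemma monotone_map_lower:
  assumes "x \<le> y" "l * (y - x) \<le> cdf \<rho> y - cdf \<rho> x"
  shows "l / c2 * (y - x) \<le> T y - T x"
  using cdf_upper[of "T x" "T y"] monotone_map[of x] monotone_map[of y] monotone_map_mono[OF assms(1)] c2_pos assms(2)
  by (simp add: field_simps)

lemma monotone_map_surj:
  assumes "\<alpha> < y" "y < \<beta>"
  shows "\<exists>x. T x = y"
proof -
  have "1-lipschitz_on UNIV (cdf \<rho>)"
  proof (rule lipschitz_onI)
    fix x y :: real
    show "dist (cdf \<rho> x) (cdf \<rho> y) \<le> 1 * dist x y"
      using cdf_\<rho>_Lipschitz[of x y] cdf_\<rho>_Lipschitz[of y x] \<rho>.cdf_nondecreasing[of x y] \<rho>.cdf_nondecreasing[of y x]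
      by (cases "x \<le> y") (auto simp: dist_real_def)
  qed simp
  hence cont: "continuous_on UNIV (cdf \<rho>)" by (rule lipschitz_on_continuous_on)
  have y01: "0 < cdf \<nu> y" "cdf \<nu> y < 1" using cdf_strict[of \<alpha> y] cdf_strict[of y \<beta>] assms cdf_\<alpha> cdf_\<beta> by auto
  have "\<forall>\<^sub>F x in at_bot. cdf \<rho> x < cdf \<nu> y"
    using \<rho>.cdf_lim_at_bot y01(1) by (rule order_tendstoD)
  then obtain a where a: "cdf \<rho> a < cdf \<nu> y" by (auto simp: eventually_at_bot_linorder)
  have "\<forall>\<^sub>F x in at_top. cdf \<nu> y < cdf \<rho> x"
    using \<rho>.cdf_lim_at_top_prob y01(2) by (rule order_tendstoD)
  then obtain b where b: "cdf \<nu> y < cdf \<rho> b" by (auto simp: eventually_at_top_linorder)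
  have "a \<le> b" using a b \<rho>.cdf_nondecreasing[of b a] by (rule_tac ccontr) auto
  hence "\<exists>x\<ge>a. x \<le> b \<and> cdf \<rho> x = cdf \<nu> y"
    using a b by (intro IVT' continuous_on_subset[OF cont]) auto
  thus ?thesis using monotone_map_unique[OF assms] by metis
qed

sublocale transport_map T \<alpha> \<beta> "1 / c1"
proof
  show "strict_mono T" by (rule strict_monoI) (rule monotone_map_strict)
  show "range T = {\<alpha><..<\<beta>}"
    using monotone_map monotone_map_surj by (auto simp: image_iff) (metis)
  show "0 < 1 / c1" using c1_pos by simp
  show "T y - T x \<le> 1 / c1 * (y - x)" if "x \<le> y" for x y
    using cdf_lower[of "T x" "T y"] monotone_map[of x] monotone_map[of y] monotone_map_mono[OF that]
      cdf_\<rho>_Lipschitz[OF that] c1_pos by (simp add: field_simps)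
qed

lemma distr_monotone_map: "distr \<rho> borel T = \<nu>"
proof (rule cdf_unique)
  show "real_distribution (distr \<rho> borel T)"
    by (rule \<rho>.real_distribution_distr) simp
  have *: "cdf (distr \<rho> borel T) y = measure \<rho> {x. T x \<le> y}" for y
    unfolding cdf_def by (subst measure_distr) (auto intro!: arg_cong2[where f=measure])
  have "cdf (distr \<rho> borel T) y = cdf \<nu> y" for y
  proof -
    consider "y \<le> \<alpha>" | "\<alpha> < y" "y < \<beta>" | "\<beta> \<le> y" by linarith
    thus ?thesis
    proof cases
      case 1
      hence "{x. T x \<le> y} = {}" using monotone_map(1) by (auto simp: not_le intro: order_le_less_trans)
      moreover have "cdf \<nu> y = 0" using \<nu>.cdf_nondecreasing[OF 1] \<nu>.cdf_nonneg[of y] cdf_\<alpha> by simp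
      ultimately show ?thesis by (simp add: *)
    next
      case 2
      then obtain x where x: "T x = y" using monotone_map_surj by blast
      hence "{x'. T x' \<le> y} = {..x}" by (auto simp: T_le_iff)
      hence "measure \<rho> {x'. T x' \<le> y} = cdf \<rho> x" by (simp add: cdf_def)
      thus ?thesis using monotone_map(3)[of x] x by (simp add: *)
    next
      case 3
      hence "{x. T x \<le> y} = UNIV" using monotone_map(2) by (auto intro: less_imp_le order_less_le_trans)
      moreover have "cdf \<nu> y = 1" using \<nu>.cdf_nondecreasing[OF 3] \<nu>.cdf_bounded_prob[of y] cdf_\<beta> by simp
      ultimately show ?thesis using \<rho>.prob_space by (simp add: *)
    qed
  qed
  thus "cdf (distr \<rho> borel T) = cdf \<nu>" by auto
qed (rule real_distribution_\<nu>)

text \<open>Both maps are nondecreasing and push \<open>\<rho>\<close> to \<open>\<nu>\<close>, which forces their distribution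
  functions to agree.\<close>

lemma brenier_map_AE_eq:
  assumes "brenier_map \<rho> \<nu> B"
  shows "AE x in \<rho>. B x = T x"
proof -
  from assms obtain v S where B [measurable]: "B \<in> borel_measurable borel" and dB: "distr \<rho> borel B = \<nu>"
    and S: "open S" "convex S" "convex_on S v"
    and deriv: "AE x in \<rho>. x \<in> S \<and> (v has_real_derivative B x) (at x)"
    unfolding brenier_map_def by blast
  define E where "E = {x \<in> S. (v has_real_derivative B x) (at x)}"
  have AE_E: "AE x in \<rho>. x \<in> E" using deriv by eventually_elim (simp add: E_def)
  have mono: "B x \<le> B y" if "x \<in> E" "y \<in> E" "x < y" for x y
  proof -
    have "v y - v x \<ge> B x * (y - x)" "v x - v y \<ge> B y * (x - y)"
      using that S by (auto intro!: convex_on_imp_above_tangent[of S] convex_connected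
          simp: E_def interior_open intro: has_field_derivative_at_within)
    hence "B x * (y - x) \<le> B y * (y - x)" by (simp add: algebra_simps)
    thus ?thesis using that by simp
  qed
  have "AE y in \<nu>. \<alpha> < y \<and> y < \<beta>" by (rule AE_\<nu>_in)
  hence "AE x in \<rho>. \<alpha> < B x \<and> B x < \<beta>"
    unfolding dB[symmetric] by (subst (asm) AE_distr_iff) auto
  with AE_E show ?thesis
  proof eventually_elim
    case (elim x)
    have "cdf \<rho> x \<le> measure \<rho> {x'. B x' \<le> B x}"
      unfolding cdf_def
    proof (rule \<rho>.finite_measure_mono_AE)
      show "AE x' in \<rho>. x' \<in> {..x} \<longrightarrow> x' \<in> {x'. B x' \<le> B x}"
        using AE_E by eventually_elim (use mono elim in \<open>auto simp: le_less\<close>)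
      show "{x'. B x' \<le> B x} \<in> \<rho>.events" by measurable
    qed
    also have "measure \<rho> {x'. B x' \<le> B x} = cdf \<nu> (B x)"
      unfolding cdf_def dB[symmetric] by (subst measure_distr) (auto intro!: arg_cong2[where f=measure])
    finally have 1: "cdf \<rho> x \<le> cdf \<nu> (B x)" .
    \<comment> \<open>For the reverse bound only the strict inequality \<open>B x' < B x\<close>
      forces \<open>x' \<le> x\<close>, as \<open>B\<close> is merely nondecreasing. Dropping the
      point \<open>B x\<close> costs nothing: it lies in \<open>(\<alpha>, \<beta>)\<close>, where
      \<nu> has no atom.\<close>
    have "{..B x} = {..<B x} \<union> {B x}" by auto
    hence "cdf \<nu> (B x) \<le> measure \<nu> {..<B x} + measure \<nu> {B x}"
      unfolding cdf_def by (simp only:) (rule measure_Un_le, auto)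
    also have "measure \<nu> {B x} = 0" using measure_point elim by blast
    also have "measure \<nu> {..<B x} = measure \<rho> {x'. B x' < B x}"
      unfolding dB[symmetric] by (subst measure_distr) (auto intro!: arg_cong2[where f=measure])
    also have "\<dots> \<le> measure \<rho> {..x}"
    proof (rule \<rho>.finite_measure_mono_AE)
      show "AE x' in \<rho>. x' \<in> {x'. B x' < B x} \<longrightarrow> x' \<in> {..x}"
        using AE_E by eventually_elim (use mono[of x] elim in \<open>auto simp: not_le[symmetric]\<close>)
    qed auto
    finally have 2: "cdf \<nu> (B x) \<le> cdf \<rho> x" by (simp add: cdf_def)
    show ?case using 1 2 elim by (intro monotone_map_unique[symmetric]) auto
  qed
qed

end

section \<open>The Bass functional\<close>

lemma std_normal_density_le_1: "std_normal_density x \<le> 1"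
proof -
  have "1 \<le> sqrt (2 * pi)" using pi_gt3 by (simp add: real_le_rsqrt)
  moreover have "exp (- x\<^sup>2 / 2) \<le> 1" by simp
  ultimately have "exp (- x\<^sup>2 / 2) \<le> sqrt (2 * pi)" by linarith
  thus ?thesis
    by (simp add: std_normal_density_def divide_le_eq)
qed

lemma std_normal_density_antimono:
  assumes "\<bar>x\<bar> \<le> \<bar>y\<bar>"
  shows "std_normal_density y \<le> std_normal_density x"
proof -
  have "x\<^sup>2 \<le> y\<^sup>2" using assms by (simp add: abs_le_square_iff)
  thus ?thesis by (simp add: std_normal_density_def divide_right_mono)
qed

lemma std_normal_density_pos: "0 < std_normal_density x"
  by (simp add: normal_density_pos)

lemma prob_space_gauss: "prob_space gauss"
  by (rule prob_space_normal_density) simp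

text \<open>The strict gaps between \<open>[m1, m2]\<close> and the end points \<alpha>, \<beta> are
  what makes the drift point inwards. The equality of barycentres \<open>mean_X\<close> makes the
  flow conserve the mean.\<close>

locale bass_setting = prob_space M + transport_target \<nu> \<alpha> \<beta> c1 c2
  for M :: "'a measure" and \<nu> \<alpha> \<beta> c1 c2 +
  fixes X \<Gamma> :: "'a \<Rightarrow> real" and m1 m2 :: real
  assumes X_meas [measurable]: "X \<in> borel_measurable M"
    and \<Gamma>_meas [measurable]: "\<Gamma> \<in> borel_measurable M"
    and distr_\<Gamma>: "distr M borel \<Gamma> = gauss"
    and indep: "indep_var borel X borel \<Gamma>"
    and X_in: "AE \<omega> in M. m1 \<le> X \<omega> \<and> X \<omega> \<le> m2"
    and m12: "\<alpha> < m1" "m2 < \<beta>"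
    and mean_X: "(\<integral>\<omega>. X \<omega> \<partial>M) = (\<integral>y. y \<partial>\<nu>)"
begin

abbreviation G where "G \<equiv> sigX M X"
abbreviation H where "H \<equiv> sigXG M X \<Gamma>"

lemma space_G [simp]: "space G = space M" by (simp add: sigX_def)
lemma space_H [simp]: "space H = space M" by (simp add: sigXG_def)

lemma sets_G: "sets G = {X -` A \<inter> space M |A. A \<in> sets borel}"
  unfolding sigX_def by (rule sets_vimage_algebra2) auto

lemma subalgebra_G: "subalgebra M G"
  unfolding subalgebra_def by (auto simp: sets_G)

lemma XG_meas_H: "X \<in> borel_measurable H" "\<Gamma> \<in> borel_measurable H"
proof -
  have "(\<lambda>\<omega>. (X \<omega>, \<Gamma> \<omega>)) \<in> measurable H (borel \<Otimes>\<^sub>M borel)"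
    unfolding sigXG_def by (rule measurable_vimage_algebra1) (simp add: space_pair_measure)
  from measurable_compose[OF this measurable_fst] measurable_compose[OF this measurable_snd]
  show "X \<in> borel_measurable H" "\<Gamma> \<in> borel_measurable H" by auto
qed

lemma subalgebra_HG: "subalgebra H G"
  unfolding subalgebra_def sets_G
  using measurable_sets[OF XG_meas_H(1)] by auto

lemma subalgebra_H: "subalgebra M H"
  unfolding subalgebra_def
proof
  have "(\<lambda>\<omega>. (X \<omega>, \<Gamma> \<omega>)) \<in> measurable M (borel \<Otimes>\<^sub>M borel)" by measurable
  thus "sets H \<subseteq> sets M" unfolding sigXG_def by (rule sets_image_in_sets[rotated]) simp
qed simp

lemma G_meas: "f \<in> borel_measurable G \<Longrightarrow> f \<in> borel_measurable M"
  using subalgebra_G by (rule measurable_from_subalg)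

lemma G_meas_H: "f \<in> borel_measurable G \<Longrightarrow> f \<in> borel_measurable H"
  using subalgebra_HG by (rule measurable_from_subalg)

lemma L2_G: "f \<in> L2 M G \<Longrightarrow> f \<in> L2 M M"
  by (auto simp: L2_def intro: G_meas)

section \<open>Integrating out the independent Gaussian variable\<close>

lemma id_meas_G: "(\<lambda>\<omega>. \<omega>) \<in> measurable M G"
proof (rule measurableI)
  fix A assume "A \<in> sets G"
  hence "A \<in> sets M" using subalgebra_G by (auto simp: subalgebra_def)
  moreover have "(\<lambda>\<omega>. \<omega>) -` A \<inter> space M = A" using sets.sets_into_space[OF calculation] by blast
  ultimately show "(\<lambda>\<omega>. \<omega>) -` A \<inter> space M \<in> sets M" by simp
qed simp

lemma pair_meas: "(\<lambda>\<omega>. (\<omega>, \<Gamma> \<omega>)) \<in> measurable M (G \<Otimes>\<^sub>M borel)"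
  by (rule measurable_Pair[OF id_meas_G \<Gamma>_meas])

text \<open>Independence is expressed for the identity map into the \<sigma>-algebra
  \<open>G\<close> instead of for X. Integrands may then depend on \<omega> through arbitrary
  \<open>G\<close>-measurable functions, which never have to be factored through X.\<close>

lemma joint_law: "distr M G (\<lambda>\<omega>. \<omega>) \<Otimes>\<^sub>M gauss = distr M (G \<Otimes>\<^sub>M borel) (\<lambda>\<omega>. (\<omega>, \<Gamma> \<omega>))"
proof (rule pair_measure_eqI)
  show "sigma_finite_measure (distr M G (\<lambda>\<omega>. \<omega>))"
    using prob_space_distr[OF id_meas_G] by (simp add: prob_space_imp_sigma_finite)
  show "sigma_finite_measure gauss" using prob_space_gauss by (simp add: prob_space_imp_sigma_finite)
  show "sets (distr M G (\<lambda>\<omega>. \<omega>) \<Otimes>\<^sub>M gauss) = sets (distr M (G \<Otimes>\<^sub>M borel) (\<lambda>\<omega>. (\<omega>, \<Gamma> \<omega>)))"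
    by (simp cong: sets_pair_measure_cong)
  fix A B assume A: "A \<in> sets (distr M G (\<lambda>\<omega>. \<omega>))" and B: "B \<in> sets gauss"
  from A obtain A' where A': "A' \<in> sets borel" "A = X -` A' \<inter> space M" by (auto simp: sets_G)
  have B': "B \<in> sets borel" using B by simp
  have "emeasure (distr M G (\<lambda>\<omega>. \<omega>)) A * emeasure gauss B = emeasure M (X -` A' \<inter> space M) * emeasure M (\<Gamma> -` B \<inter> space M)"
  proof -
    have "(\<lambda>\<omega>. \<omega>) -` A \<inter> space M = X -` A' \<inter> space M" using A'(2) by blast
    hence "emeasure (distr M G (\<lambda>\<omega>. \<omega>)) A = emeasure M (X -` A' \<inter> space M)"
      using emeasure_distr[OF id_meas_G, of A] A by simp
    moreover have "emeasure gauss B = emeasure M (\<Gamma> -` B \<inter> space M)"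
      unfolding distr_\<Gamma>[symmetric] using B' by (simp add: emeasure_distr)
    ultimately show ?thesis by simp
  qed
  also have "\<dots> = emeasure M ((\<lambda>\<omega>. (X \<omega>, \<Gamma> \<omega>)) -` (A' \<times> B) \<inter> space M)"
    using indep_varD[OF indep A'(1) B'] by (simp add: emeasure_eq_measure ennreal_mult'')
  also have "\<dots> = emeasure (distr M (G \<Otimes>\<^sub>M borel) (\<lambda>\<omega>. (\<omega>, \<Gamma> \<omega>))) (A \<times> B)"
  proof -
    have "(\<lambda>\<omega>. (X \<omega>, \<Gamma> \<omega>)) -` (A' \<times> B) \<inter> space M = (\<lambda>\<omega>. (\<omega>, \<Gamma> \<omega>)) -` (A \<times> B) \<inter> space M"
      using A'(2) by blast
    moreover have "A \<times> B \<in> sets (G \<Otimes>\<^sub>M borel)" using A B' by simp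
    ultimately show ?thesis using emeasure_distr[OF pair_meas] by simp
  qed
  finally show "emeasure (distr M G (\<lambda>\<omega>. \<omega>)) A * emeasure gauss B
      = emeasure (distr M (G \<Otimes>\<^sub>M borel) (\<lambda>\<omega>. (\<omega>, \<Gamma> \<omega>))) (A \<times> B)" .
qed

lemma nn_integral_indep:
  assumes P [measurable]: "case_prod P \<in> borel_measurable (G \<Otimes>\<^sub>M borel)"
  shows "(\<integral>\<^sup>+\<omega>. P \<omega> (\<Gamma> \<omega>) \<partial>M) = (\<integral>\<^sup>+\<omega>. \<integral>\<^sup>+g. P \<omega> g \<partial>gauss \<partial>M)"
proof -
  interpret g: prob_space gauss by (rule prob_space_gauss)
  have Pm: "case_prod P \<in> borel_measurable (distr M G (\<lambda>\<omega>. \<omega>) \<Otimes>\<^sub>M gauss)"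
    using P by (simp cong: measurable_cong_sets sets_pair_measure_cong)
  have "(\<integral>\<^sup>+\<omega>. P \<omega> (\<Gamma> \<omega>) \<partial>M) = (\<integral>\<^sup>+\<omega>. case_prod P (\<omega>, \<Gamma> \<omega>) \<partial>M)" by simp
  also have "\<dots> = (\<integral>\<^sup>+z. case_prod P z \<partial>distr M (G \<Otimes>\<^sub>M borel) (\<lambda>\<omega>. (\<omega>, \<Gamma> \<omega>)))"
    using P by (intro nn_integral_distr[OF pair_meas, symmetric]) simp
  also have "\<dots> = (\<integral>\<^sup>+z. case_prod P z \<partial>(distr M G (\<lambda>\<omega>. \<omega>) \<Otimes>\<^sub>M gauss))"
    by (simp only: joint_law)
  also have "\<dots> = (\<integral>\<^sup>+\<omega>. \<integral>\<^sup>+g. P \<omega> g \<partial>gauss \<partial>distr M G (\<lambda>\<omega>. \<omega>))"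
    by (rule g.nn_integral_fst[OF Pm, symmetric, unfolded prod.case])
  also have "\<dots> = (\<integral>\<^sup>+\<omega>. \<integral>\<^sup>+g. P \<omega> g \<partial>gauss \<partial>M)"
    by (rule nn_integral_distr[OF id_meas_G g.borel_measurable_nn_integral[OF Pm]])
  finally show ?thesis .
qed

lemma integral_indep:
  assumes P [measurable]: "case_prod P \<in> borel_measurable (G \<Otimes>\<^sub>M borel)"
    and int: "integrable M (\<lambda>\<omega>. P \<omega> (\<Gamma> \<omega>) :: real)"
  shows "(\<integral>\<omega>. P \<omega> (\<Gamma> \<omega>) \<partial>M) = (\<integral>\<omega>. (\<integral>g. P \<omega> g \<partial>gauss) \<partial>M)"
proof -
  interpret g: prob_space gauss by (rule prob_space_gauss)
  have Pm': "case_prod P \<in> borel_measurable (G \<Otimes>\<^sub>M gauss)"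
    using P by (simp cong: measurable_cong_sets sets_pair_measure_cong)
  interpret R: prob_space "distr M G (\<lambda>\<omega>. \<omega>)" by (rule prob_space_distr[OF id_meas_G])
  interpret pair_prob_space "distr M G (\<lambda>\<omega>. \<omega>)" gauss ..
  have "integrable (distr M (G \<Otimes>\<^sub>M borel) (\<lambda>\<omega>. (\<omega>, \<Gamma> \<omega>))) (case_prod P)"
    using int by (simp add: integrable_distr_eq[OF pair_meas P])
  hence intP: "integrable (distr M G (\<lambda>\<omega>. \<omega>) \<Otimes>\<^sub>M gauss) (case_prod P)" by (simp only: joint_law)
  have "(\<integral>\<omega>. P \<omega> (\<Gamma> \<omega>) \<partial>M) = (\<integral>\<omega>. case_prod P (\<omega>, \<Gamma> \<omega>) \<partial>M)" by simp
  also have "\<dots> = (\<integral>z. case_prod P z \<partial>distr M (G \<Otimes>\<^sub>M borel) (\<lambda>\<omega>. (\<omega>, \<Gamma> \<omega>)))"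
    by (rule integral_distr[OF pair_meas P, symmetric])
  also have "\<dots> = (\<integral>z. case_prod P z \<partial>(distr M G (\<lambda>\<omega>. \<omega>) \<Otimes>\<^sub>M gauss))"
    by (simp only: joint_law)
  also have "\<dots> = (\<integral>\<omega>. \<integral>g. P \<omega> g \<partial>gauss \<partial>distr M G (\<lambda>\<omega>. \<omega>))"
    using integral_fst[OF intP] by (simp add: case_prod_unfold)
  also have "\<dots> = (\<integral>\<omega>. \<integral>g. P \<omega> g \<partial>gauss \<partial>M)"
    by (rule integral_distr[OF id_meas_G g.borel_measurable_lebesgue_integral[OF Pm']])
  finally show ?thesis .
qed

section \<open>The smoothed law and its monotone map onto \<nu>\<close>

definition law :: "('a \<Rightarrow> real) \<Rightarrow> real measure" where
  "law Z = distr M borel (\<lambda>\<omega>. Z \<omega> + \<Gamma> \<omega>)"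

definition tmap :: "('a \<Rightarrow> real) \<Rightarrow> real \<Rightarrow> real" where
  "tmap Z = monotone_map \<nu> \<alpha> \<beta> (law Z)"

definition S :: "('a \<Rightarrow> real) \<Rightarrow> 'a \<Rightarrow> real" where
  "S Z \<omega> = tmap Z (Z \<omega> + \<Gamma> \<omega>)"

text \<open>Links \<open>law\<close> to the convolution in the definition of the flow: Z generates a
  sub-\<sigma>-algebra of \<open>G\<close> and so inherits independence from \<Gamma>.\<close>

lemma law_eq_convolution:
  assumes "Z \<in> borel_measurable G"
  shows "law Z = (distr M borel Z \<star> gauss)"
proof -
  have "sigma_sets (space M) {Z -` A \<inter> space M |A. A \<in> sets borel} \<subseteq> sets G"
  proof -
    have "{Z -` A \<inter> space M |A. A \<in> sets borel} \<subseteq> sets G" using measurable_sets[OF assms] by auto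
    from sets.sigma_sets_subset[OF this] show ?thesis by simp
  qed
  also have "sets G = sigma_sets (space M) {X -` A \<inter> space M |A. A \<in> sets borel}"
    unfolding sigX_def by (rule sets_vimage_algebra)
  finally have "indep_var borel Z borel \<Gamma>"
    using indep G_meas[OF assms] unfolding indep_var_eq indep_sets2_eq by blast
  hence "distr M borel (\<lambda>\<omega>. Z \<omega> + \<Gamma> \<omega>) = (distr M borel Z \<star> distr M borel \<Gamma>)"
    using G_meas[OF assms] by (intro sum_indep_random_variable) auto
  thus ?thesis by (simp add: law_def distr_\<Gamma>)
qed

lemma real_distribution_law:
  assumes "Z \<in> borel_measurable G"
  shows "real_distribution (law Z)"
proof -
  note G_meas[OF assms, measurable]
  show ?thesis unfolding law_def by (intro real_distribution_distr) measurable
qed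

lemma emeasure_law_Ioc:
  assumes Z [measurable]: "Z \<in> borel_measurable G"
  shows "emeasure (law Z) {x<..y} = (\<integral>\<^sup>+\<omega>. \<integral>\<^sup>+g. ennreal (std_normal_density g) * indicator {x - Z \<omega><..y - Z \<omega>} g \<partial>lborel \<partial>M)"
proof -
  note G_meas[OF Z, measurable]
  have "emeasure (law Z) {x<..y} = (\<integral>\<^sup>+z. indicator {x<..y} z \<partial>law Z)"
    by (simp add: law_def)
  also have "\<dots> = (\<integral>\<^sup>+\<omega>. indicator {x<..y} (Z \<omega> + \<Gamma> \<omega>) \<partial>M)"
    unfolding law_def by (subst nn_integral_distr) auto
  also have "\<dots> = (\<integral>\<^sup>+\<omega>. \<integral>\<^sup>+g. indicator {x<..y} (Z \<omega> + g) \<partial>gauss \<partial>M)"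
    by (rule nn_integral_indep[where P = "\<lambda>\<omega> g. indicator {x<..y} (Z \<omega> + g)"]) measurable
  also have "\<dots> = (\<integral>\<^sup>+\<omega>. \<integral>\<^sup>+g. ennreal (std_normal_density g) * indicator {x<..y} (Z \<omega> + g) \<partial>lborel \<partial>M)"
    by (subst nn_integral_density) auto
  also have "\<dots> = (\<integral>\<^sup>+\<omega>. \<integral>\<^sup>+g. ennreal (std_normal_density g) * indicator {x - Z \<omega><..y - Z \<omega>} g \<partial>lborel \<partial>M)"
    by (intro nn_integral_cong) (auto simp: indicator_def)
  finally show ?thesis .
qed

lemma cdf_law_Lipschitz:
  assumes "Z \<in> borel_measurable G" "x \<le> y"
  shows "cdf (law Z) y - cdf (law Z) x \<le> y - x"
proof (cases "x = y")
  case False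
  hence "x < y" using assms by simp
  interpret \<rho>: real_distribution "law Z" by (rule real_distribution_law[OF assms(1)])
  have "emeasure (law Z) {x<..y} \<le> (\<integral>\<^sup>+\<omega>. ennreal (y - x) \<partial>M)"
    unfolding emeasure_law_Ioc[OF assms(1)]
  proof (intro nn_integral_mono)
    fix \<omega>
    have "(\<integral>\<^sup>+g. ennreal (std_normal_density g) * indicator {x - Z \<omega><..y - Z \<omega>} g \<partial>lborel)
        \<le> (\<integral>\<^sup>+g. indicator {x - Z \<omega><..y - Z \<omega>} g \<partial>lborel)"
      using std_normal_density_le_1 by (intro nn_integral_mono) (auto simp: indicator_def ennreal_le_1)
    also have "\<dots> = ennreal (y - x)" using \<open>x < y\<close> by simp
    finally show "(\<integral>\<^sup>+g. ennreal (std_normal_density g) * indicator {x - Z \<omega><..y - Z \<omega>} g \<partial>lborel) \<le> ennreal (y - x)" .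
  qed
  also have "\<dots> = ennreal (y - x)" by (simp add: emeasure_space_1)
  finally have "measure (law Z) {x<..y} \<le> y - x"
    using \<open>x < y\<close> by (simp add: \<rho>.emeasure_eq_measure)
  thus ?thesis using \<rho>.cdf_diff_eq[OF \<open>x < y\<close>] by simp
qed simp

text \<open>On the event \<open>|Z| \<le> R\<close> a point of \<open>[-K, K]\<close> is reached by
  a shift of \<Gamma> of size at most \<open>K + R\<close>. The probability \<open>p\<close> stays a
  parameter: it is 1 for bounded variables and 1/2, by Chebyshev's inequality, for general
  square-integrable ones.\<close>

lemma cdf_law_lower:
  assumes Z: "Z \<in> borel_measurable G" and xy: "- K \<le> x" "x \<le> y" "y \<le> K"
    and p: "p \<le> prob {\<omega> \<in> space M. \<bar>Z \<omega>\<bar> \<le> R}" "0 \<le> p"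
  shows "p * std_normal_density (K + R) * (y - x) \<le> cdf (law Z) y - cdf (law Z) x"
proof (cases "x = y")
  case False
  hence "x < y" using xy by simp
  interpret \<rho>: real_distribution "law Z" by (rule real_distribution_law[OF Z])
  note G_meas[OF Z, measurable]
  let ?n = "std_normal_density (K + R)"
  have "ennreal (p * ?n * (y - x)) \<le> ennreal (prob {\<omega> \<in> space M. \<bar>Z \<omega>\<bar> \<le> R} * (?n * (y - x)))"
    using xy p by (intro ennreal_leI) (simp add: mult.assoc mult_right_mono)
  also have "\<dots> = (\<integral>\<^sup>+\<omega>. ennreal (?n * (y - x)) * indicator {\<omega> \<in> space M. \<bar>Z \<omega>\<bar> \<le> R} \<omega> \<partial>M)"
    using xy by (subst nn_integral_cmult_indicator) (auto simp: emeasure_eq_measure ennreal_mult' mult.commute)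
  also have "\<dots> \<le> emeasure (law Z) {x<..y}"
    unfolding emeasure_law_Ioc[OF Z]
  proof (intro nn_integral_mono)
    fix \<omega>
    have "ennreal (?n * (y - x)) \<le> (\<integral>\<^sup>+g. ennreal (std_normal_density g) * indicator {x - Z \<omega><..y - Z \<omega>} g \<partial>lborel)"
      if "\<bar>Z \<omega>\<bar> \<le> R"
    proof -
      have "ennreal (?n * (y - x)) = (\<integral>\<^sup>+g. ennreal ?n * indicator {x - Z \<omega><..y - Z \<omega>} g \<partial>lborel)"
        using \<open>x < y\<close> by (subst nn_integral_cmult_indicator) (auto simp: ennreal_mult'')
      also have "\<dots> \<le> (\<integral>\<^sup>+g. ennreal (std_normal_density g) * indicator {x - Z \<omega><..y - Z \<omega>} g \<partial>lborel)"
        using that xy by (intro nn_integral_mono) 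
          (auto simp: indicator_def intro!: ennreal_leI std_normal_density_antimono)
      finally show ?thesis .
    qed
    thus "ennreal (?n * (y - x)) * indicator {\<omega> \<in> space M. \<bar>Z \<omega>\<bar> \<le> R} \<omega>
       \<le> (\<integral>\<^sup>+g. ennreal (std_normal_density g) * indicator {x - Z \<omega><..y - Z \<omega>} g \<partial>lborel)"
      by (auto simp: indicator_def)
  qed
  finally have "p * ?n * (y - x) \<le> measure (law Z) {x<..y}"
    using \<open>x < y\<close> by (simp add: \<rho>.emeasure_eq_measure)
  thus ?thesis using \<rho>.cdf_diff_eq[OF \<open>x < y\<close>] by simp
qed simp

lemma regular_source_law:
  assumes "Z \<in> L2 M G"
  shows "regular_source \<nu> \<alpha> \<beta> c1 c2 (law Z)"
proof (intro regular_source.intro regular_source_axioms.intro)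
  have Z [measurable]: "Z \<in> borel_measurable G" using assms by (auto simp: L2_def)
  have Z2: "Z \<in> L2 M M" using assms by (rule L2_G)
  note G_meas[OF Z, measurable]
  show "transport_target \<nu> \<alpha> \<beta> c1 c2" by (rule transport_target_axioms)
  show "real_distribution (law Z)" by (rule real_distribution_law[OF Z])
  show "cdf (law Z) y - cdf (law Z) x \<le> y - x" if "x \<le> y" for x y
    using cdf_law_Lipschitz[OF Z that] .
  show "cdf (law Z) x < cdf (law Z) y" if "x < y" for x y
  proof -
    define q where "q = (\<integral>\<omega>. (Z \<omega>)\<^sup>2 \<partial>M)"
    have "0 \<le> q" by (simp add: q_def integral_nonneg_AE)
    \<comment> \<open>Chosen so that \<open>2 * q \<le> R^2\<close>; Chebyshev's inequality then
      leaves probability at least 1/2 for \<open>|Z| \<le> R\<close>.\<close>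
    define R where "R = q + 2"
    have "R > 0" using \<open>0 \<le> q\<close> by (simp add: R_def)
    have "prob {\<omega> \<in> space M. R \<le> \<bar>Z \<omega>\<bar>} \<le> q / R\<^sup>2"
      unfolding q_def by (rule second_moment_tail[OF Z2 \<open>R > 0\<close>])
    also have "2 * q \<le> R\<^sup>2"
      using \<open>0 \<le> q\<close> mult_nonneg_nonneg[OF \<open>0 \<le> q\<close> \<open>0 \<le> q\<close>] by (simp add: R_def power2_eq_square algebra_simps)
    hence "q / R\<^sup>2 \<le> 1 / 2" using \<open>R > 0\<close> by (simp add: field_simps)
    finally have "1 - prob {\<omega> \<in> space M. R \<le> \<bar>Z \<omega>\<bar>} \<ge> 1 / 2" by simp
    also have "1 - prob {\<omega> \<in> space M. R \<le> \<bar>Z \<omega>\<bar>} = prob {\<omega> \<in> space M. \<not> R \<le> \<bar>Z \<omega>\<bar>}"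
      by (rule prob_neg[symmetric]) measurable
    also have "\<dots> \<le> prob {\<omega> \<in> space M. \<bar>Z \<omega>\<bar> \<le> R}" by (intro finite_measure_mono) auto
    finally have "(1 / 2) * std_normal_density (max \<bar>x\<bar> \<bar>y\<bar> + R) * (y - x) \<le> cdf (law Z) y - cdf (law Z) x"
      using that by (intro cdf_law_lower[OF Z]) (auto simp: max_def)
    moreover have "0 < (1 / 2) * std_normal_density (max \<bar>x\<bar> \<bar>y\<bar> + R) * (y - x)"
      using that std_normal_density_pos by (intro mult_pos_pos) auto
    ultimately show ?thesis by linarith
  qed
qed

end


lemma abs_le_max_abs: "a \<le> y \<Longrightarrow> y \<le> b \<Longrightarrow> \<bar>y\<bar> \<le> max \<bar>a\<bar> \<bar>b :: real\<bar>"
  by (auto simp: max_def)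

section \<open>First-order calculus for the Bass functional\<close>

context bass_setting
begin

abbreviation V where "V \<equiv> bass_V M X \<Gamma> \<nu>"

lemma X_L2: "X \<in> L2 M M"
proof (rule L2_bounded)
  show "AE \<omega> in M. \<bar>X \<omega>\<bar> \<le> max \<bar>m1\<bar> \<bar>m2\<bar>" using X_in by eventually_elim (auto simp: max_def)
qed (rule X_meas)

lemma X_meas_G: "X \<in> borel_measurable G"
  unfolding sigX_def by (rule measurable_vimage_algebra1) simp

lemma X_L2_G: "X \<in> L2 M G"
  using X_L2 X_meas_G by (auto simp: L2_def)

lemma \<Gamma>_L2: "\<Gamma> \<in> L2 M M"
proof -
  have "integrable lborel (\<lambda>x. std_normal_density x *\<^sub>R x\<^sup>2)"
    using integrable_std_normal_moment[of 2] by simp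
  hence "integrable gauss (\<lambda>x. x\<^sup>2)" by (subst integrable_density) auto
  hence "integrable M (\<lambda>\<omega>. (\<Gamma> \<omega>)\<^sup>2)"
    unfolding distr_\<Gamma>[symmetric] by (subst (asm) integrable_distr_eq) auto
  thus ?thesis by (simp add: L2_def)
qed

lemmas L2_M_intros = L2_add[OF _ _ subalgebra_refl] L2_diff[OF _ _ subalgebra_refl] X_L2 \<Gamma>_L2

lemma transport_tmap:
  assumes "Z \<in> L2 M G"
  shows "transport_map (tmap Z) \<alpha> \<beta> (1 / c1)"
proof -
  interpret regular_source \<nu> \<alpha> \<beta> c1 c2 "law Z" by (rule regular_source_law[OF assms])
  show ?thesis unfolding tmap_def by (rule transport_map_axioms)
qed

lemma tmap_meas:
  assumes "Z \<in> L2 M G"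
  shows "tmap Z \<in> borel_measurable borel"
  using transport_map.measurable_T[OF transport_tmap[OF assms]] .

lemma tmap_in:
  assumes "Z \<in> L2 M G"
  shows "\<alpha> < tmap Z x" "tmap Z x < \<beta>"
  using transport_map.T_in[OF transport_tmap[OF assms]] by auto

lemma S_meas:
  assumes "Z \<in> L2 M G"
  shows "S Z \<in> borel_measurable H" "S Z \<in> borel_measurable M"
proof -
  have "Z \<in> borel_measurable H" using assms by (auto simp: L2_def intro: G_meas_H)
  note [measurable] = this XG_meas_H(2) tmap_meas[OF assms]
  have "(\<lambda>\<omega>. tmap Z (Z \<omega> + \<Gamma> \<omega>)) \<in> borel_measurable H" by measurable
  thus 1: "S Z \<in> borel_measurable H" by (simp add: S_def[abs_def])
  show "S Z \<in> borel_measurable M" by (rule measurable_from_subalg[OF subalgebra_H 1])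
qed

lemma S_in:
  assumes "Z \<in> L2 M G"
  shows "\<alpha> < S Z \<omega>" "S Z \<omega> < \<beta>"
  using tmap_in[OF assms] by (auto simp: S_def)

lemma S_L2:
  assumes "Z \<in> L2 M G"
  shows "S Z \<in> L2 M M"
proof (rule L2_bounded[OF S_meas(2)[OF assms]])
  show "AE \<omega> in M. \<bar>S Z \<omega>\<bar> \<le> max \<bar>\<alpha>\<bar> \<bar>\<beta>\<bar>"
    using S_in[OF assms] by (intro AE_I2 abs_le_max_abs less_imp_le) auto
qed

lemma distr_S:
  assumes "Z \<in> L2 M G"
  shows "distr M borel (S Z) = \<nu>"
proof -
  interpret regular_source \<nu> \<alpha> \<beta> c1 c2 "law Z" by (rule regular_source_law[OF assms])
  have "Z \<in> borel_measurable M" using assms by (auto simp: L2_def intro: G_meas)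
  note [measurable] = this tmap_meas[OF assms]
  have "distr (law Z) borel (tmap Z) = distr M borel (tmap Z \<circ> (\<lambda>\<omega>. Z \<omega> + \<Gamma> \<omega>))"
    unfolding law_def by (rule distr_distr) measurable
  moreover have "tmap Z \<circ> (\<lambda>\<omega>. Z \<omega> + \<Gamma> \<omega>) = S Z" by (auto simp: S_def)
  ultimately show ?thesis using distr_monotone_map by (simp add: tmap_def)
qed

lemma ZG_L2: "Z \<in> L2 M G \<Longrightarrow> (\<lambda>\<omega>. Z \<omega> + \<Gamma> \<omega>) \<in> L2 M M"
  by (intro L2_M_intros L2_G)

lemma law_gap:
  assumes Z: "Z \<in> L2 M G" and Y: "Y \<in> borel_measurable M" "distr M borel Y = \<nu>"
  shows "c1 / 2 * (\<integral>\<omega>. (S Z \<omega> - Y \<omega>)\<^sup>2 \<partial>M) \<le> (\<integral>\<omega>. (Z \<omega> + \<Gamma> \<omega>) * (S Z \<omega> - Y \<omega>) \<partial>M)"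
    and "AE \<omega> in M. \<alpha> < Y \<omega> \<and> Y \<omega> < \<beta>"
proof -
  have "distr M borel Y = distr M borel (\<lambda>\<omega>. tmap Z (Z \<omega> + \<Gamma> \<omega>))"
    using distr_S[OF Z] Y by (simp add: S_def[abs_def])
  from transport_gap[OF transport_tmap[OF Z] L2_integrable[OF ZG_L2[OF Z]] Y(1) this]
  show "c1 / 2 * (\<integral>\<omega>. (S Z \<omega> - Y \<omega>)\<^sup>2 \<partial>M) \<le> (\<integral>\<omega>. (Z \<omega> + \<Gamma> \<omega>) * (S Z \<omega> - Y \<omega>) \<partial>M)"
    and "AE \<omega> in M. \<alpha> < Y \<omega> \<and> Y \<omega> < \<beta>"
    by (simp_all add: S_def mult.commute)
qed

text \<open>Any admissible \<open>Y\<close> has the same law as \<open>S Z\<close>, so the transport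
  gap compares the two; its left side is nonnegative, hence \<open>S Z\<close> is optimal.\<close>

lemma bass_V_eq:
  assumes Z: "Z \<in> L2 M G"
  shows "V Z = (\<integral>\<omega>. (Z \<omega> + \<Gamma> \<omega>) * S Z \<omega> - Z \<omega> * X \<omega> \<partial>M)"
  unfolding bass_V_def
proof (rule cSup_eq_maximum)
  show "(\<integral>\<omega>. (Z \<omega> + \<Gamma> \<omega>) * S Z \<omega> - Z \<omega> * X \<omega> \<partial>M)
      \<in> (\<lambda>Y. \<integral>\<omega>. (Z \<omega> + \<Gamma> \<omega>) * Y \<omega> - Z \<omega> * X \<omega> \<partial>M) ` {Y \<in> L2 M H. distr M borel Y = \<nu>}"
    using S_L2[OF Z] S_meas[OF Z] distr_S[OF Z] by (intro imageI) (auto simp: L2_def)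
next
  fix x assume "x \<in> (\<lambda>Y. \<integral>\<omega>. (Z \<omega> + \<Gamma> \<omega>) * Y \<omega> - Z \<omega> * X \<omega> \<partial>M) ` {Y \<in> L2 M H. distr M borel Y = \<nu>}"
  then obtain Y where Y: "Y \<in> L2 M H" "distr M borel Y = \<nu>"
    and x: "x = (\<integral>\<omega>. (Z \<omega> + \<Gamma> \<omega>) * Y \<omega> - Z \<omega> * X \<omega> \<partial>M)" by blast
  have YM: "Y \<in> L2 M M" using Y(1) subalgebra_H by (auto simp: L2_def intro: measurable_from_subalg)
  note int = L2_mult_integrable[OF ZG_L2[OF Z] S_L2[OF Z]] L2_mult_integrable[OF ZG_L2[OF Z] YM]
    L2_mult_integrable[OF L2_G[OF Z] X_L2]
  have "0 \<le> c1 / 2 * (\<integral>\<omega>. (S Z \<omega> - Y \<omega>)\<^sup>2 \<partial>M)" using c1_pos by (simp add: integral_nonneg_AE)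
  also have "\<dots> \<le> (\<integral>\<omega>. (Z \<omega> + \<Gamma> \<omega>) * (S Z \<omega> - Y \<omega>) \<partial>M)"
    by (rule law_gap(1)[OF Z L2_D(1)[OF YM] Y(2)])
  also have "\<dots> = (\<integral>\<omega>. (Z \<omega> + \<Gamma> \<omega>) * S Z \<omega> \<partial>M) - (\<integral>\<omega>. (Z \<omega> + \<Gamma> \<omega>) * Y \<omega> \<partial>M)"
    using int by (simp only: right_diff_distrib Bochner_Integration.integral_diff)
  finally show "x \<le> (\<integral>\<omega>. (Z \<omega> + \<Gamma> \<omega>) * S Z \<omega> - Z \<omega> * X \<omega> \<partial>M)"
    unfolding x using int by simp
qed

text \<open>\<open>S Z - X\<close> is a subgradient of \<open>V\<close> at \<open>Z\<close>, because
  \<open>S Z\<close> is also an admissible competitor in the problem for \<open>W\<close>; the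
  difference of the two sides is its loss of optimality there.\<close>

lemma bass_V_diff_le:
  assumes Z: "Z \<in> L2 M G" and W: "W \<in> L2 M G"
  shows "V Z - V W \<le> (\<integral>\<omega>. (S Z \<omega> - X \<omega>) * (Z \<omega> - W \<omega>) \<partial>M)"
proof -
  note L = L2_G[OF Z] L2_G[OF W] S_L2[OF Z] S_L2[OF W] X_L2 \<Gamma>_L2 ZG_L2[OF Z] ZG_L2[OF W]
  have "0 \<le> c1 / 2 * (\<integral>\<omega>. (S W \<omega> - S Z \<omega>)\<^sup>2 \<partial>M)" using c1_pos by (simp add: integral_nonneg_AE)
  also have "\<dots> \<le> (\<integral>\<omega>. (W \<omega> + \<Gamma> \<omega>) * (S W \<omega> - S Z \<omega>) \<partial>M)"
    by (rule law_gap(1)[OF W S_meas(2)[OF Z] distr_S[OF Z]])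
  finally have *: "0 \<le> (\<integral>\<omega>. (W \<omega> + \<Gamma> \<omega>) * (S W \<omega> - S Z \<omega>) \<partial>M)" .
  have "V Z - V W = (\<integral>\<omega>. ((Z \<omega> + \<Gamma> \<omega>) * S Z \<omega> - Z \<omega> * X \<omega>) - ((W \<omega> + \<Gamma> \<omega>) * S W \<omega> - W \<omega> * X \<omega>) \<partial>M)"
    unfolding bass_V_eq[OF Z] bass_V_eq[OF W]
    by (intro Bochner_Integration.integral_diff[symmetric] Bochner_Integration.integrable_diff L2_mult_integrable L)
  also have "\<dots> = (\<integral>\<omega>. (S Z \<omega> - X \<omega>) * (Z \<omega> - W \<omega>) - (W \<omega> + \<Gamma> \<omega>) * (S W \<omega> - S Z \<omega>) \<partial>M)"
    by (intro Bochner_Integration.integral_cong) (auto simp: algebra_simps)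
  also have "\<dots> = (\<integral>\<omega>. (S Z \<omega> - X \<omega>) * (Z \<omega> - W \<omega>) \<partial>M) - (\<integral>\<omega>. (W \<omega> + \<Gamma> \<omega>) * (S W \<omega> - S Z \<omega>) \<partial>M)"
    by (intro Bochner_Integration.integral_diff L2_mult_integrable L2_M_intros L)
  finally show ?thesis using * by simp
qed

text \<open>The sum of two optimality statements: \<open>S W\<close> competes at \<open>Z\<close>
  and \<open>S Z\<close> competes at \<open>W\<close>. Only the second quadratic gain is kept,
  whence the constant \<open>c1 / 2\<close>.\<close>

lemma S_cocoercive:
  assumes Z: "Z \<in> L2 M G" and W: "W \<in> L2 M G"
  shows "c1 / 2 * (l2norm M (\<lambda>\<omega>. S Z \<omega> - S W \<omega>))\<^sup>2 \<le> (\<integral>\<omega>. (S Z \<omega> - S W \<omega>) * (Z \<omega> - W \<omega>) \<partial>M)"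
proof -
  note L = L2_G[OF Z] L2_G[OF W] S_L2[OF Z] S_L2[OF W] X_L2 \<Gamma>_L2 ZG_L2[OF Z] ZG_L2[OF W]
  have "0 \<le> c1 / 2 * (\<integral>\<omega>. (S Z \<omega> - S W \<omega>)\<^sup>2 \<partial>M)" using c1_pos by (simp add: integral_nonneg_AE)
  also have "\<dots> \<le> (\<integral>\<omega>. (Z \<omega> + \<Gamma> \<omega>) * (S Z \<omega> - S W \<omega>) \<partial>M)"
    by (rule law_gap(1)[OF Z S_meas(2)[OF W] distr_S[OF W]])
  finally have 1: "0 \<le> (\<integral>\<omega>. (Z \<omega> + \<Gamma> \<omega>) * (S Z \<omega> - S W \<omega>) \<partial>M)" .
  have 2: "c1 / 2 * (\<integral>\<omega>. (S W \<omega> - S Z \<omega>)\<^sup>2 \<partial>M) \<le> (\<integral>\<omega>. (W \<omega> + \<Gamma> \<omega>) * (S W \<omega> - S Z \<omega>) \<partial>M)"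
    by (rule law_gap(1)[OF W S_meas(2)[OF Z] distr_S[OF Z]])
  have "(\<integral>\<omega>. (S Z \<omega> - S W \<omega>) * (Z \<omega> - W \<omega>) \<partial>M)
     = (\<integral>\<omega>. (Z \<omega> + \<Gamma> \<omega>) * (S Z \<omega> - S W \<omega>) + (W \<omega> + \<Gamma> \<omega>) * (S W \<omega> - S Z \<omega>) \<partial>M)"
    by (intro Bochner_Integration.integral_cong) (auto simp: algebra_simps)
  also have "\<dots> = (\<integral>\<omega>. (Z \<omega> + \<Gamma> \<omega>) * (S Z \<omega> - S W \<omega>) \<partial>M) + (\<integral>\<omega>. (W \<omega> + \<Gamma> \<omega>) * (S W \<omega> - S Z \<omega>) \<partial>M)"
    by (intro Bochner_Integration.integral_add L2_mult_integrable L2_M_intros L)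
  finally show ?thesis using 1 2 by (simp add: l2norm_power2 power2_commute)
qed

lemma S_Lipschitz:
  assumes Z: "Z \<in> L2 M G" and W: "W \<in> L2 M G"
  shows "l2norm M (\<lambda>\<omega>. S Z \<omega> - S W \<omega>) \<le> 2 / c1 * l2norm M (\<lambda>\<omega>. Z \<omega> - W \<omega>)"
proof -
  note L = L2_G[OF Z] L2_G[OF W] S_L2[OF Z] S_L2[OF W]
  define s d where "s = l2norm M (\<lambda>\<omega>. S Z \<omega> - S W \<omega>)" and "d = l2norm M (\<lambda>\<omega>. Z \<omega> - W \<omega>)"
  have nn: "0 \<le> s" "0 \<le> d" by (simp_all add: s_def d_def)
  have "c1 / 2 * s\<^sup>2 \<le> (\<integral>\<omega>. (S Z \<omega> - S W \<omega>) * (Z \<omega> - W \<omega>) \<partial>M)"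
    unfolding s_def by (rule S_cocoercive[OF Z W])
  also have "\<dots> \<le> s * d"
    unfolding s_def d_def
    by (rule order_trans[OF abs_ge_self l2norm_Cauchy_Schwarz]) (intro L2_M_intros L)+
  finally have "s * (c1 / 2 * s) \<le> s * d" by (simp add: power2_eq_square mult_ac)
  hence "c1 / 2 * s \<le> d" using nn by (cases "s = 0") auto
  thus ?thesis using c1_pos by (simp add: s_def d_def field_simps)
qed

lemma AE_law:
  assumes "Z \<in> borel_measurable M" "AE x in law Z. P x"
  shows "AE \<omega> in M. P (Z \<omega> + \<Gamma> \<omega>)"
proof -
  note assms(1)[measurable]
  have "(\<lambda>\<omega>. Z \<omega> + \<Gamma> \<omega>) \<in> measurable M borel" by measurable
  from AE_distrD[OF this assms(2)[unfolded law_def]] show ?thesis .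
qed

text \<open>Conditioning on \<open>X\<close> integrates \<open>\<Gamma>\<close> out, so \<open>S Z - X\<close> and the gradient
  \<open>gauss_conv f Z - X\<close> have the same inner product with every \<open>G\<close>-measurable direction.\<close>

lemma integral_gauss_conv:
  assumes Z: "Z \<in> L2 M G" and h: "h \<in> L2 M G" and f: "f \<in> borel_measurable borel"
    and eq: "AE \<omega> in M. f (Z \<omega> + \<Gamma> \<omega>) = S Z \<omega>"
    and int: "integrable M (\<lambda>\<omega>. h \<omega> * (gauss_conv f (Z \<omega>) - X \<omega>))"
  shows "(\<integral>\<omega>. h \<omega> * (gauss_conv f (Z \<omega>) - X \<omega>) \<partial>M) = (\<integral>\<omega>. h \<omega> * (S Z \<omega> - X \<omega>) \<partial>M)"
proof -
  have [measurable]: "Z \<in> borel_measurable G" "h \<in> borel_measurable G" using Z h by (auto simp: L2_def)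
  have [measurable]: "Z \<in> borel_measurable M" "h \<in> borel_measurable M" using Z h by (auto simp: L2_def intro: G_meas)
  note f [measurable] S_meas(2)[OF Z, measurable]
  note L = L2_G[OF Z] S_L2[OF Z] X_L2 L2_G[OF h]
  have AEeq: "AE \<omega> in M. h \<omega> * f (Z \<omega> + \<Gamma> \<omega>) = h \<omega> * S Z \<omega>" using eq by eventually_elim simp
  have int1: "integrable M (\<lambda>\<omega>. h \<omega> * f (Z \<omega> + \<Gamma> \<omega>))"
    by (subst integrable_cong_AE[OF _ _ AEeq]) (auto intro: L2_mult_integrable L)
  have intX: "integrable M (\<lambda>\<omega>. h \<omega> * X \<omega>)" by (intro L2_mult_integrable L)
  have "(\<integral>\<omega>. h \<omega> * S Z \<omega> \<partial>M) = (\<integral>\<omega>. h \<omega> * f (Z \<omega> + \<Gamma> \<omega>) \<partial>M)"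
    using AEeq by (intro integral_cong_AE) (auto elim: eventually_mono)
  also have "\<dots> = (\<integral>\<omega>. (\<integral>g. h \<omega> * f (Z \<omega> + g) \<partial>gauss) \<partial>M)"
    by (rule integral_indep[where P = "\<lambda>\<omega> g. h \<omega> * f (Z \<omega> + g)", OF _ int1]) measurable
  also have "\<dots> = (\<integral>\<omega>. h \<omega> * gauss_conv f (Z \<omega>) \<partial>M)"
    by (simp add: gauss_conv_def)
  finally have eq': "(\<integral>\<omega>. h \<omega> * S Z \<omega> \<partial>M) = (\<integral>\<omega>. h \<omega> * gauss_conv f (Z \<omega>) \<partial>M)" .
  have intc: "integrable M (\<lambda>\<omega>. h \<omega> * gauss_conv f (Z \<omega>))"
    using Bochner_Integration.integrable_add[OF int intX] by (simp add: right_diff_distrib)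
  show ?thesis
    using eq' intc intX L2_mult_integrable[OF L(4) L(2)] by (simp add: right_diff_distrib)
qed

text \<open>A version of the conditional expectation of \<open>S Z - X\<close> given X.\<close>

definition grad :: "('a \<Rightarrow> real) \<Rightarrow> 'a \<Rightarrow> real" where
  "grad Z \<omega> = gauss_conv (tmap Z) (Z \<omega>) - X \<omega>"

lemma gauss_conv_bounds:
  assumes "f \<in> borel_measurable borel" "\<And>x. a \<le> f x \<and> f x \<le> b"
  shows "a \<le> gauss_conv f z" "gauss_conv f z \<le> b" "gauss_conv f \<in> borel_measurable borel"
    "integrable gauss (\<lambda>y. f (z + y))"
proof -
  interpret g: prob_space gauss by (rule prob_space_gauss)
  note assms(1)[measurable]
  have "f \<in> borel_measurable borel" by measurable
  hence "(\<lambda>y. f (z + y)) \<in> borel_measurable gauss" by measurable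
  thus int: "integrable gauss (\<lambda>y. f (z + y))"
    using assms(2) by (intro g.integrable_const_bound[of _ "max \<bar>a\<bar> \<bar>b\<bar>"] AE_I2)
      (auto simp del: max.bounded_iff intro!: abs_le_max_abs)
  show "a \<le> gauss_conv f z" unfolding gauss_conv_def using assms(2) by (intro g.integral_ge_const int AE_I2) auto
  show "gauss_conv f z \<le> b" unfolding gauss_conv_def using assms(2) by (intro g.integral_le_const int AE_I2) auto
  have "(\<lambda>z. \<integral>y. f (z + y) \<partial>gauss) \<in> borel_measurable borel"
    by (rule g.borel_measurable_lebesgue_integral) measurable
  thus "gauss_conv f \<in> borel_measurable borel" by (simp add: gauss_conv_def[abs_def])
qed

lemma gauss_conv_tmap:
  assumes "Z \<in> L2 M G"
  shows "\<alpha> \<le> gauss_conv (tmap Z) z" "gauss_conv (tmap Z) z \<le> \<beta>" "gauss_conv (tmap Z) \<in> borel_measurable borel"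
    "integrable gauss (\<lambda>y. tmap Z (z + y))"
proof -
  have "\<alpha> \<le> tmap Z x \<and> tmap Z x \<le> \<beta>" for x using tmap_in[OF assms, of x] by simp
  from gauss_conv_bounds[OF tmap_meas[OF assms] this]
  show "\<alpha> \<le> gauss_conv (tmap Z) z" "gauss_conv (tmap Z) z \<le> \<beta>" "gauss_conv (tmap Z) \<in> borel_measurable borel"
    "integrable gauss (\<lambda>y. tmap Z (z + y))" by auto
qed

lemma grad_L2:
  assumes "Z \<in> L2 M G"
  shows "grad Z \<in> L2 M G"
proof -
  have [measurable]: "Z \<in> borel_measurable G" using assms by (auto simp: L2_def)
  note gauss_conv_tmap(3)[OF assms, measurable]
  have m: "(\<lambda>\<omega>. gauss_conv (tmap Z) (Z \<omega>)) \<in> borel_measurable G" by measurable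
  have "(\<lambda>\<omega>. gauss_conv (tmap Z) (Z \<omega>)) \<in> L2 M M"
    by (rule L2_bounded[OF G_meas[OF m]]) (use gauss_conv_tmap[OF assms] in \<open>auto intro!: AE_I2 abs_le_max_abs\<close>)
  with m have "(\<lambda>\<omega>. gauss_conv (tmap Z) (Z \<omega>)) \<in> L2 M G" by (auto simp: L2_def)
  from L2_diff[OF this X_L2_G subalgebra_G] show ?thesis by (simp add: grad_def[abs_def])
qed

lemma integral_grad:
  assumes Z: "Z \<in> L2 M G" and h: "h \<in> L2 M G"
  shows "(\<integral>\<omega>. h \<omega> * grad Z \<omega> \<partial>M) = (\<integral>\<omega>. h \<omega> * (S Z \<omega> - X \<omega>) \<partial>M)"
  using L2_mult_integrable[OF L2_G[OF h] L2_G[OF grad_L2[OF Z]]] unfolding grad_def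
  by (intro integral_gauss_conv[OF Z h tmap_meas[OF Z]]) (auto simp: S_def)

text \<open>A single explicit gradient step from \<open>W\<close> would lower \<open>V\<close>
  unless the gradient vanishes. The subgradient is evaluated at the new point, and the Lipschitz
  bound on \<open>S\<close> compares it with the one at \<open>W\<close>.\<close>

lemma minimizer_grad_0:
  assumes min: "bass_minimizer M X \<Gamma> \<nu> W"
  shows "AE \<omega> in M. grad W \<omega> = 0"
proof -
  have W: "W \<in> L2 M G" using min by (simp add: bass_minimizer_def)
  define r where "r = grad W"
  have r: "r \<in> L2 M G" unfolding r_def by (rule grad_L2[OF W])
  \<comment> \<open>As \<open>S\<close> has Lipschitz constant \<open>2 / c1\<close>, this step size
    lets the error consume just half of \<open>(l2norm M r)^2\<close>.\<close>
  define \<epsilon> where "\<epsilon> = c1 / 4"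
  have "\<epsilon> > 0" using c1_pos by (simp add: \<epsilon>_def)
  define Z where "Z = (\<lambda>\<omega>. W \<omega> - \<epsilon> * r \<omega>)"
  have Z: "Z \<in> L2 M G" unfolding Z_def by (intro L2_diff L2_scale W r subalgebra_G)
  note L = L2_G[OF Z] L2_G[OF W] S_L2[OF Z] S_L2[OF W] X_L2 L2_G[OF r]
  have ZW: "Z \<omega> - W \<omega> = - \<epsilon> * r \<omega>" for \<omega> by (simp add: Z_def)
  have "0 \<le> V Z - V W" using min Z by (simp add: bass_minimizer_def)
  also have "\<dots> \<le> (\<integral>\<omega>. (S Z \<omega> - X \<omega>) * (Z \<omega> - W \<omega>) \<partial>M)" by (rule bass_V_diff_le[OF Z W])
  also have "\<dots> = (\<integral>\<omega>. - \<epsilon> * (r \<omega> * (S W \<omega> - X \<omega>) + r \<omega> * (S Z \<omega> - S W \<omega>)) \<partial>M)"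
    unfolding ZW by (intro Bochner_Integration.integral_cong) (auto simp: algebra_simps)
  also have "\<dots> = - \<epsilon> * ((\<integral>\<omega>. r \<omega> * (S W \<omega> - X \<omega>) \<partial>M) + (\<integral>\<omega>. r \<omega> * (S Z \<omega> - S W \<omega>) \<partial>M))"
    by (subst Bochner_Integration.integral_mult_right_zero, subst Bochner_Integration.integral_add)
       (intro L2_mult_integrable L2_M_intros L refl)+
  also have "(\<integral>\<omega>. r \<omega> * (S W \<omega> - X \<omega>) \<partial>M) = (\<integral>\<omega>. r \<omega> * grad W \<omega> \<partial>M)"
    by (rule integral_grad[OF W r, symmetric])
  also have "\<dots> = (l2norm M r)\<^sup>2" unfolding l2norm_power2 by (simp add: r_def power2_eq_square)
  finally have "(l2norm M r)\<^sup>2 \<le> - (\<integral>\<omega>. r \<omega> * (S Z \<omega> - S W \<omega>) \<partial>M)"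
    using \<open>\<epsilon> > 0\<close> by (simp add: mult_le_0_iff)
  also have "\<dots> \<le> l2norm M r * l2norm M (\<lambda>\<omega>. S Z \<omega> - S W \<omega>)"
    by (rule order_trans[OF abs_ge_minus_self l2norm_Cauchy_Schwarz]) (intro L2_M_intros L)+
  also have "\<dots> \<le> l2norm M r * (2 / c1 * l2norm M (\<lambda>\<omega>. Z \<omega> - W \<omega>))"
    by (intro mult_left_mono S_Lipschitz Z W) simp
  also have "l2norm M (\<lambda>\<omega>. Z \<omega> - W \<omega>) = \<epsilon> * l2norm M r"
    unfolding ZW l2norm_def using \<open>\<epsilon> > 0\<close> by (simp add: power_mult_distrib real_sqrt_mult)
  also have "l2norm M r * (2 / c1 * (\<epsilon> * l2norm M r)) = (l2norm M r)\<^sup>2 / 2"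
    using c1_pos by (simp add: \<epsilon>_def power2_eq_square)
  finally have "(l2norm M r)\<^sup>2 = 0" by (simp add: order.antisym)
  hence "(\<integral>\<omega>. (r \<omega>)\<^sup>2 \<partial>M) = 0" by (simp only: l2norm_power2)
  hence "AE \<omega> in M. (r \<omega>)\<^sup>2 = 0"
    using L2_D[OF L(6)] by (subst (asm) integral_nonneg_eq_0_iff_AE) auto
  thus ?thesis unfolding r_def by eventually_elim simp
qed

end

section \<open>Strong monotonicity\<close>

text \<open>The constant \<open>t\<close> is the preimage of \<open>s\<close>, clipped to \<open>[-r, r]\<close>; clipping is harmless because
  \<open>T\<close> is monotone.\<close>

lemma (in transport_map) separated_from_constant:
  assumes low: "\<And>x y. - K \<le> x \<Longrightarrow> x \<le> y \<Longrightarrow> y \<le> K \<Longrightarrow> l * (y - x) \<le> T y - T x"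
    and s: "\<alpha> < s" "s < \<beta>" and x: "\<bar>x\<bar> + r \<le> K" and r: "0 \<le> r" and l: "0 \<le> l"
  obtains t where "\<And>d. \<bar>d\<bar> \<le> r \<Longrightarrow> l * \<bar>d - t\<bar> \<le> \<bar>s - T (x + d)\<bar>"
proof -
  obtain y where y: "T y = s" using T_surj[OF s] by blast
  define t where "t = max (- r) (min r (y - x))"
  have tr: "- r \<le> t" "t \<le> r" using r by (auto simp: t_def)
  have "l * \<bar>d - t\<bar> \<le> \<bar>s - T (x + d)\<bar>" if d: "\<bar>d\<bar> \<le> r" for d
  proof (cases "d \<le> t")
    case True
    have "l * (t - d) \<le> T (x + t) - T (x + d)"
      using low[of "x + d" "x + t"] d x True tr by simp
    moreover have "d = t \<or> T (x + t) \<le> s"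
      using True d unfolding y[symmetric] T_le_iff t_def by auto
    ultimately show ?thesis using True by auto
  next
    case False
    have "l * (d - t) \<le> T (x + d) - T (x + t)"
      using low[of "x + t" "x + d"] d x False tr by simp
    moreover have "s \<le> T (x + t)"
      using False d unfolding y[symmetric] T_le_iff t_def by auto
    ultimately show ?thesis using False by auto
  qed
  thus ?thesis by (rule that)
qed

context bass_setting
begin

section \<open>Tail estimates and the inward drift\<close>

lemma integrable_gauss_power2: "integrable gauss (\<lambda>x. x\<^sup>2)"
  unfolding distr_\<Gamma>[symmetric] using L2_D[OF \<Gamma>_L2] by (subst integrable_distr_eq) auto

text \<open>Chebyshev's inequality for \<open>Z + \<Gamma>\<close>. The bound depends on
  \<open>Z\<close> through \<open>B\<close> alone, which makes all later consequences uniform in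
  time along the flow.\<close>

lemma law_second_moment_tail:
  assumes Z: "Z \<in> L2 M G" and B: "(\<integral>\<omega>. (Z \<omega>)\<^sup>2 \<partial>M) \<le> B" and "0 < x"
  shows "cdf (law Z) (- x) \<le> 2 * (B + (\<integral>y. y\<^sup>2 \<partial>gauss)) / x\<^sup>2"
    and "1 - cdf (law Z) x \<le> 2 * (B + (\<integral>y. y\<^sup>2 \<partial>gauss)) / x\<^sup>2"
proof -
  interpret \<rho>: real_distribution "law Z"
    using Z by (intro real_distribution_law) (auto simp: L2_def)
  note L2_D(1)[OF L2_G[OF Z], measurable]
  have "(\<integral>\<omega>. (Z \<omega> + \<Gamma> \<omega>)\<^sup>2 \<partial>M) \<le> (\<integral>\<omega>. 2 * (Z \<omega>)\<^sup>2 + 2 * (\<Gamma> \<omega>)\<^sup>2 \<partial>M)"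
  proof (rule integral_mono)
    show "(Z \<omega> + \<Gamma> \<omega>)\<^sup>2 \<le> 2 * (Z \<omega>)\<^sup>2 + 2 * (\<Gamma> \<omega>)\<^sup>2" for \<omega>
      using sum_squares_bound[of "Z \<omega>" "\<Gamma> \<omega>"] by (simp add: power2_sum)
  qed (use L2_D[OF ZG_L2[OF Z]] L2_D[OF L2_G[OF Z]] L2_D[OF \<Gamma>_L2] in auto)
  also have "\<dots> = 2 * ((\<integral>\<omega>. (Z \<omega>)\<^sup>2 \<partial>M) + (\<integral>\<omega>. (\<Gamma> \<omega>)\<^sup>2 \<partial>M))"
    using L2_D[OF L2_G[OF Z]] L2_D[OF \<Gamma>_L2] by simp
  also have "(\<integral>\<omega>. (\<Gamma> \<omega>)\<^sup>2 \<partial>M) = (\<integral>y. y\<^sup>2 \<partial>gauss)"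
    unfolding distr_\<Gamma>[symmetric] by (subst integral_distr) auto
  finally have m: "(\<integral>\<omega>. (Z \<omega> + \<Gamma> \<omega>)\<^sup>2 \<partial>M) \<le> 2 * (B + (\<integral>y. y\<^sup>2 \<partial>gauss))" using B by simp
  have "prob {\<omega> \<in> space M. x \<le> \<bar>Z \<omega> + \<Gamma> \<omega>\<bar>} \<le> (\<integral>\<omega>. (Z \<omega> + \<Gamma> \<omega>)\<^sup>2 \<partial>M) / x\<^sup>2"
    by (rule second_moment_tail[OF ZG_L2[OF Z] \<open>0 < x\<close>])
  also have "\<dots> \<le> 2 * (B + (\<integral>y. y\<^sup>2 \<partial>gauss)) / x\<^sup>2"
    using m by (intro divide_right_mono) auto
  finally have tail: "prob {\<omega> \<in> space M. x \<le> \<bar>Z \<omega> + \<Gamma> \<omega>\<bar>} \<le> 2 * (B + (\<integral>y. y\<^sup>2 \<partial>gauss)) / x\<^sup>2" .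
  have cdf_eq: "cdf (law Z) a = prob {\<omega> \<in> space M. Z \<omega> + \<Gamma> \<omega> \<le> a}" for a
    unfolding cdf_def law_def by (subst measure_distr) (auto intro!: arg_cong[where f=prob])
  have "cdf (law Z) (- x) \<le> prob {\<omega> \<in> space M. x \<le> \<bar>Z \<omega> + \<Gamma> \<omega>\<bar>}"
    unfolding cdf_eq using \<open>0 < x\<close> by (intro finite_measure_mono) auto
  with tail show "cdf (law Z) (- x) \<le> 2 * (B + (\<integral>y. y\<^sup>2 \<partial>gauss)) / x\<^sup>2" by simp
  have "1 - cdf (law Z) x = prob {\<omega> \<in> space M. \<not> Z \<omega> + \<Gamma> \<omega> \<le> x}"
    unfolding cdf_eq by (rule prob_neg[symmetric]) measurable
  also have "\<dots> \<le> prob {\<omega> \<in> space M. x \<le> \<bar>Z \<omega> + \<Gamma> \<omega>\<bar>}"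
    by (intro finite_measure_mono) auto
  finally show "1 - cdf (law Z) x \<le> 2 * (B + (\<integral>y. y\<^sup>2 \<partial>gauss)) / x\<^sup>2" using tail by simp
qed

text \<open>On \<open>\<bar>y\<bar> \<ge> z / 2\<close> the trivial bound on \<open>tmap Z\<close> is used together with \<open>1 \<le> 4 y\<^sup>2 / z\<^sup>2\<close>.\<close>

lemma gauss_conv_tmap_tail:
  assumes Z: "Z \<in> L2 M G" and B: "(\<integral>\<omega>. (Z \<omega>)\<^sup>2 \<partial>M) \<le> B" and z: "0 < z"
  defines "q \<equiv> (\<integral>y. y\<^sup>2 \<partial>gauss)"
  defines "C \<equiv> 8 * (B + q) / c1 + 4 * (\<beta> - \<alpha>) * q"
  shows "\<beta> - C / z\<^sup>2 \<le> gauss_conv (tmap Z) z"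
    and "gauss_conv (tmap Z) (- z) \<le> \<alpha> + C / z\<^sup>2"
proof -
  interpret regular_source \<nu> \<alpha> \<beta> c1 c2 "law Z" by (rule regular_source_law[OF Z])
  interpret g: prob_space gauss by (rule prob_space_gauss)
  \<comment> \<open>\<open>A\<close> bounds the distance of \<open>tmap Z\<close> at
    \<open>z / 2\<close> and \<open>- z / 2\<close> from \<beta> and \<alpha>: tail bound at
    \<open>z / 2\<close>, divided by \<open>c1\<close>. The term \<open>D * y^2\<close> exceeds the
    full length \<open>\<beta> - \<alpha>\<close> once \<open>|y| \<ge> z / 2\<close>.\<close>
  define A where "A = 8 * (B + q) / (c1 * z\<^sup>2)"
  define D where "D = 4 * (\<beta> - \<alpha>) / z\<^sup>2"
  have "0 \<le> (\<integral>\<omega>. (Z \<omega>)\<^sup>2 \<partial>M)" "0 \<le> q" by (simp_all add: q_def integral_nonneg_AE)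
  hence "0 \<le> B + q" using B by linarith
  hence A: "A \<ge> 0" using c1_pos unfolding A_def by (intro divide_nonneg_nonneg mult_nonneg_nonneg) auto
  have D: "D \<ge> 0" using \<alpha>_less_\<beta> by (simp add: D_def)
  have ADC: "A + D * q = C / z\<^sup>2" using z c1_pos by (simp add: A_def D_def C_def field_simps)
  note tails = law_second_moment_tail[OF Z B, of "z / 2", folded q_def]
  have "(1 - cdf (law Z) (z / 2)) / c1 \<le> (2 * (B + q) / (z / 2)\<^sup>2) / c1"
    using tails(2) z c1_pos by (intro divide_right_mono) auto
  also have "\<dots> = A" using z c1_pos by (simp add: A_def field_simps power2_eq_square)
  finally have up: "\<beta> - A \<le> tmap Z (z / 2)" using monotone_map_tails(2)[of "z / 2"] by (simp add: tmap_def)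
  have "cdf (law Z) (- (z / 2)) / c1 \<le> (2 * (B + q) / (z / 2)\<^sup>2) / c1"
    using tails(1) z c1_pos by (intro divide_right_mono) auto
  also have "\<dots> = A" using z c1_pos by (simp add: A_def field_simps power2_eq_square)
  finally have lo: "tmap Z (- (z / 2)) \<le> \<alpha> + A" using monotone_map_tails(1)[of "- (z / 2)"] by (simp add: tmap_def)
  have far: "\<beta> - \<alpha> \<le> D * y\<^sup>2" if "z / 2 \<le> \<bar>y\<bar>" for y
  proof -
    have "(z / 2)\<^sup>2 \<le> \<bar>y\<bar>\<^sup>2" using that z by (intro power_mono) auto
    hence "z\<^sup>2 \<le> 4 * y\<^sup>2" by (simp add: power_divide)
    hence "1 \<le> 4 * y\<^sup>2 / z\<^sup>2" using z by simp
    hence "(\<beta> - \<alpha>) * 1 \<le> (\<beta> - \<alpha>) * (4 * y\<^sup>2 / z\<^sup>2)" using \<alpha>_less_\<beta> by (intro mult_left_mono) auto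
    thus ?thesis by (simp add: D_def algebra_simps)
  qed
  have mono: "tmap Z a \<le> tmap Z b" if "a \<le> b" for a b
    using monotone_map_mono[OF that] by (simp add: tmap_def)
  have int: "integrable gauss (\<lambda>y. a + b * y\<^sup>2)" for a b :: real
    using integrable_gauss_power2 by (intro Bochner_Integration.integrable_add integrable_mult_right) auto
  have val: "(\<integral>y. a + b * y\<^sup>2 \<partial>gauss) = a + b * q" for a b :: real
    using integrable_gauss_power2 g.prob_space by (simp add: q_def)
  have "(\<integral>y. (\<beta> - A) + (- D) * y\<^sup>2 \<partial>gauss) \<le> gauss_conv (tmap Z) z"
    unfolding gauss_conv_def
  proof (rule integral_mono[OF int gauss_conv_tmap(4)[OF Z]])
    fix y
    show "(\<beta> - A) + (- D) * y\<^sup>2 \<le> tmap Z (z + y)"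
    proof (cases "z / 2 \<le> \<bar>y\<bar>")
      case True
      thus ?thesis using far[of y] tmap_in[OF Z, of "z + y"] A by simp
    next
      case False
      hence "tmap Z (z / 2) \<le> tmap Z (z + y)" by (intro mono) auto
      moreover have "0 \<le> D * y\<^sup>2" using D by simp
      ultimately show ?thesis using up by simp
    qed
  qed
  thus "\<beta> - C / z\<^sup>2 \<le> gauss_conv (tmap Z) z" unfolding val ADC[symmetric] by simp
  have "gauss_conv (tmap Z) (- z) \<le> (\<integral>y. (\<alpha> + A) + D * y\<^sup>2 \<partial>gauss)"
    unfolding gauss_conv_def
  proof (rule integral_mono[OF gauss_conv_tmap(4)[OF Z] int])
    fix y
    show "tmap Z (- z + y) \<le> (\<alpha> + A) + D * y\<^sup>2"
    proof (cases "z / 2 \<le> \<bar>y\<bar>")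
      case True
      thus ?thesis using far[of y] tmap_in[OF Z, of "- z + y"] A by simp
    next
      case False
      hence "tmap Z (- z + y) \<le> tmap Z (- (z / 2))" by (intro mono) auto
      moreover have "0 \<le> D * y\<^sup>2" using D by simp
      ultimately show ?thesis using lo by simp
    qed
  qed
  thus "gauss_conv (tmap Z) (- z) \<le> \<alpha> + C / z\<^sup>2" unfolding val ADC[symmetric] by simp
qed

lemma ex_drift_bound:
  obtains K where "1 \<le> K"
    "\<And>Z z. Z \<in> L2 M G \<Longrightarrow> (\<integral>\<omega>. (Z \<omega>)\<^sup>2 \<partial>M) \<le> B \<Longrightarrow> K \<le> z \<Longrightarrow>
       m2 < gauss_conv (tmap Z) z \<and> gauss_conv (tmap Z) (- z) < m1"
proof -
  define q where "q = (\<integral>y. y\<^sup>2 \<partial>gauss)"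
  define C where "C = 8 * (B + q) / c1 + 4 * (\<beta> - \<alpha>) * q"
  \<comment> \<open>The room between the range of X and the end points. The level \<open>K\<close>
    below makes \<open>C / z^2\<close> smaller than it for \<open>z \<ge> K\<close>; having
    \<open>K \<ge> 1\<close> allows \<open>z \<le> z^2\<close>.\<close>
  define \<eta> where "\<eta> = min (\<beta> - m2) (m1 - \<alpha>)"
  have "\<eta> > 0" using m12 by (simp add: \<eta>_def)
  define K where "K = \<bar>C\<bar> / \<eta> + 1"
  have K: "1 \<le> K" using \<open>\<eta> > 0\<close> by (simp add: K_def)
  show ?thesis
  proof (rule that[OF K])
    fix Z z assume Z: "Z \<in> L2 M G" "(\<integral>\<omega>. (Z \<omega>)\<^sup>2 \<partial>M) \<le> B" and z: "K \<le> z"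
    have "0 < z" using K z by simp
    have "C < \<eta> * K" using \<open>\<eta> > 0\<close> by (simp add: K_def algebra_simps)
    also have "\<dots> \<le> \<eta> * z" using z \<open>\<eta> > 0\<close> by simp
    also have "\<dots> \<le> \<eta> * z\<^sup>2" using z K \<open>\<eta> > 0\<close> by (intro mult_left_mono self_le_power) auto
    finally have "C / z\<^sup>2 < \<eta>" using \<open>0 < z\<close> by (simp add: divide_less_eq)
    moreover have "\<eta> \<le> \<beta> - m2" "\<eta> \<le> m1 - \<alpha>" by (simp_all add: \<eta>_def)
    ultimately show "m2 < gauss_conv (tmap Z) z \<and> gauss_conv (tmap Z) (- z) < m1"
      using gauss_conv_tmap_tail[OF Z \<open>0 < z\<close>, folded q_def, folded C_def] by linarith
  qed
qed

lemma minimizer_bounded: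
  assumes min: "bass_minimizer M X \<Gamma> \<nu> W"
  obtains R where "0 \<le> R" "AE \<omega> in M. \<bar>W \<omega>\<bar> \<le> R"
proof -
  have W: "W \<in> L2 M G" using min by (simp add: bass_minimizer_def)
  obtain K where K: "1 \<le> K" "\<And>Z z. Z \<in> L2 M G \<Longrightarrow> (\<integral>\<omega>. (Z \<omega>)\<^sup>2 \<partial>M) \<le> (\<integral>\<omega>. (W \<omega>)\<^sup>2 \<partial>M) \<Longrightarrow> K \<le> z \<Longrightarrow>
       m2 < gauss_conv (tmap Z) z \<and> gauss_conv (tmap Z) (- z) < m1"
    using ex_drift_bound[of "\<integral>\<omega>. (W \<omega>)\<^sup>2 \<partial>M"] by blast
  have "AE \<omega> in M. \<bar>W \<omega>\<bar> \<le> K"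
    using minimizer_grad_0[OF min] X_in
  proof eventually_elim
    case (elim \<omega>)
    show ?case
    proof (rule ccontr)
      assume "\<not> \<bar>W \<omega>\<bar> \<le> K"
      with K(2)[OF W order_refl, of "\<bar>W \<omega>\<bar>"] elim show False
        by (auto simp: grad_def abs_if split: if_splits)
    qed
  qed
  moreover have "0 \<le> K" using K(1) by simp
  ultimately show ?thesis by (rule that[rotated])
qed

lemma tmap_lower:
  assumes W: "W \<in> L2 M G" and R: "AE \<omega> in M. \<bar>W \<omega>\<bar> \<le> R" and xy: "- K \<le> x" "x \<le> y" "y \<le> K"
  shows "std_normal_density (K + R) / c2 * (y - x) \<le> tmap W y - tmap W x"
proof -
  interpret regular_source \<nu> \<alpha> \<beta> c1 c2 "law W" by (rule regular_source_law[OF W])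
  note L2_D(1)[OF L2_G[OF W], measurable]
  have "prob {\<omega> \<in> space M. \<bar>W \<omega>\<bar> \<le> R} = 1" using R by (intro prob_Collect_eq_1[THEN iffD2]) auto
  hence "1 * std_normal_density (K + R) * (y - x) \<le> cdf (law W) y - cdf (law W) x"
    using W xy by (intro cdf_law_lower) (auto simp: L2_def)
  thus ?thesis unfolding tmap_def using xy by (intro monotone_map_lower) auto
qed

lemma strong_monotonicity:
  assumes W: "W \<in> L2 M G" and RW: "AE \<omega> in M. \<bar>W \<omega>\<bar> \<le> R" and R: "0 \<le> R"
  obtains \<kappa> where "0 < \<kappa>"
    "\<And>Z. Z \<in> L2 M G \<Longrightarrow> AE \<omega> in M. \<bar>Z \<omega>\<bar> \<le> R \<Longrightarrow> (\<integral>\<omega>. Z \<omega> \<partial>M) = (\<integral>\<omega>. W \<omega> \<partial>M) \<Longrightarrow>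
       \<kappa> * (l2norm M (\<lambda>\<omega>. Z \<omega> - W \<omega>))\<^sup>2 \<le> (\<integral>\<omega>. (S Z \<omega> - S W \<omega>) * (Z \<omega> - W \<omega>) \<partial>M)"
proof -
  \<comment> \<open>For a position \<open>x\<close> in \<open>[-1, 1]\<close> and a shift
    \<open>W - Z\<close> of size at most \<open>2 * R\<close>, the argument of \<open>tmap W\<close>
    stays in \<open>[-K, K]\<close>, where its slope is at least \<open>l\<close>. Below,
    \<open>n\<close> bounds from below the density at such \<open>x\<close> of
    \<open>Z + \<Gamma>\<close> given \<open>Z\<close>.\<close>
  define K where "K = 1 + 2 * R"
  define l where "l = std_normal_density (K + R) / c2"
  have l: "0 < l" using std_normal_density_pos c2_pos by (simp add: l_def)
  define n where "n = std_normal_density (1 + R)"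
  have n: "0 < n" using std_normal_density_pos by (simp add: n_def)
  interpret TW: transport_map "tmap W" \<alpha> \<beta> "1 / c1" by (rule transport_tmap[OF W])
  have main: "2 * n * l\<^sup>2 * (l2norm M (\<lambda>\<omega>. Z \<omega> - W \<omega>))\<^sup>2 \<le> (l2norm M (\<lambda>\<omega>. S Z \<omega> - S W \<omega>))\<^sup>2"
    if Z: "Z \<in> L2 M G" and RZ: "AE \<omega> in M. \<bar>Z \<omega>\<bar> \<le> R" and mean: "(\<integral>\<omega>. Z \<omega> \<partial>M) = (\<integral>\<omega>. W \<omega> \<partial>M)" for Z
  proof -
    have [measurable]: "Z \<in> borel_measurable G" "W \<in> borel_measurable G" using Z W by (auto simp: L2_def)
    note [measurable] = L2_D(1)[OF L2_G[OF Z]] L2_D(1)[OF L2_G[OF W]] tmap_meas[OF Z] tmap_meas[OF W]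
    define D where "D \<omega> = W \<omega> - Z \<omega>" for \<omega>
    have D2: "D \<in> L2 M M" unfolding D_def[abs_def] by (intro L2_diff L2_G Z W subalgebra_refl)
    note L2_D(1)[OF D2, measurable]
    have D0: "(\<integral>\<omega>. D \<omega> \<partial>M) = 0"
      using mean L2_integrable[OF L2_G[OF Z]] L2_integrable[OF L2_G[OF W]] by (simp add: D_def)
    have DR: "AE \<omega> in M. \<bar>D \<omega>\<bar> \<le> 2 * R" using RZ RW by eventually_elim (auto simp: D_def)
    define Q where "Q = (\<integral>\<omega>. (D \<omega>)\<^sup>2 \<partial>M)"
    have Q: "0 \<le> Q" by (simp add: Q_def integral_nonneg_AE)
    have inner: "ennreal (l\<^sup>2 * Q) \<le> (\<integral>\<^sup>+\<omega>. ennreal ((tmap Z x - tmap W (x + D \<omega>))\<^sup>2) \<partial>M)"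
      if x: "\<bar>x\<bar> \<le> 1" for x
    proof -
      obtain t where t: "\<And>d. \<bar>d\<bar> \<le> 2 * R \<Longrightarrow> l * \<bar>d - t\<bar> \<le> \<bar>tmap Z x - tmap W (x + d)\<bar>"
        using TW.separated_from_constant[of K l "tmap Z x" x "2 * R"] tmap_lower[OF W RW, of K, folded l_def]
          tmap_in[OF Z] x R l by (auto simp: K_def)
      have Dt: "(\<lambda>\<omega>. D \<omega> - t) \<in> L2 M M" by (intro L2_diff D2 L2_const subalgebra_refl)
      \<comment> \<open>\<open>D\<close> is centred by the equality of means, so 0 is its best
        constant approximation in mean square and replacing it by \<open>t\<close> can only increase
        the distance.\<close>
      have "Q \<le> Q - 2 * t * (\<integral>\<omega>. D \<omega> \<partial>M) + t\<^sup>2" using D0 by simp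
      also have "\<dots> = (\<integral>\<omega>. (D \<omega>)\<^sup>2 - 2 * t * D \<omega> + t\<^sup>2 \<partial>M)"
        using L2_D(2)[OF D2] L2_integrable[OF D2] by (simp add: Q_def prob_space)
      also have "\<dots> = (\<integral>\<omega>. (D \<omega> - t)\<^sup>2 \<partial>M)"
        by (intro Bochner_Integration.integral_cong) (auto simp: power2_diff)
      finally have "ennreal (l\<^sup>2 * Q) \<le> ennreal (\<integral>\<omega>. l\<^sup>2 * (D \<omega> - t)\<^sup>2 \<partial>M)"
        by (intro ennreal_leI) (simp add: mult_left_mono)
      also have "\<dots> = (\<integral>\<^sup>+\<omega>. ennreal (l\<^sup>2 * (D \<omega> - t)\<^sup>2) \<partial>M)"
        using L2_D(2)[OF Dt] by (intro nn_integral_eq_integral[symmetric]) auto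
      also have "\<dots> \<le> (\<integral>\<^sup>+\<omega>. ennreal ((tmap Z x - tmap W (x + D \<omega>))\<^sup>2) \<partial>M)"
      proof (rule nn_integral_mono_AE)
        show "AE \<omega> in M. ennreal (l\<^sup>2 * (D \<omega> - t)\<^sup>2) \<le> ennreal ((tmap Z x - tmap W (x + D \<omega>))\<^sup>2)"
          using DR
        proof eventually_elim
          case (elim \<omega>)
          have "(l * \<bar>D \<omega> - t\<bar>)\<^sup>2 \<le> \<bar>tmap Z x - tmap W (x + D \<omega>)\<bar>\<^sup>2"
            using t[OF elim] l by (intro power_mono) auto
          thus ?case by (intro ennreal_leI) (simp add: power_mult_distrib)
        qed
      qed
      finally show ?thesis .
    qed
    interpret lb: pair_sigma_finite M lborel ..
    define F where "F \<omega> x = (tmap Z x - tmap W (x + D \<omega>))\<^sup>2" for \<omega> x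
    have Fm [measurable]: "case_prod F \<in> borel_measurable (M \<Otimes>\<^sub>M lborel)" unfolding F_def by measurable
    have e2: "emeasure lborel {-1..1::real} = ennreal 2" by (subst emeasure_lborel_Icc) auto
    have "ennreal (2 * n * l\<^sup>2 * Q) = ennreal (n * (l\<^sup>2 * Q)) * emeasure lborel {-1..1::real}"
      unfolding e2 using n Q by (subst ennreal_mult[symmetric]) (auto simp: mult_ac)
    also have "\<dots> = (\<integral>\<^sup>+x. ennreal (n * (l\<^sup>2 * Q)) * indicator {-1..1::real} x \<partial>lborel)"
      by (rule nn_integral_cmult_indicator[symmetric]) simp
    also have "\<dots> \<le> (\<integral>\<^sup>+x. (ennreal n * indicator {-1..1} x) * (\<integral>\<^sup>+\<omega>. ennreal (F \<omega> x) \<partial>M) \<partial>lborel)"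
    proof (rule nn_integral_mono)
      fix x :: real
      show "ennreal (n * (l\<^sup>2 * Q)) * indicator {-1..1} x \<le> (ennreal n * indicator {-1..1} x) * (\<integral>\<^sup>+\<omega>. ennreal (F \<omega> x) \<partial>M)"
        using inner[of x] n Q by (auto simp: indicator_def F_def ennreal_mult intro!: mult_left_mono)
    qed
    also have "\<dots> = (\<integral>\<^sup>+x. (\<integral>\<^sup>+\<omega>. (ennreal n * indicator {-1..1} x) * ennreal (F \<omega> x) \<partial>M) \<partial>lborel)"
      by (intro nn_integral_cong nn_integral_cmult[symmetric]) (simp add: F_def)
    also have "\<dots> = (\<integral>\<^sup>+\<omega>. (\<integral>\<^sup>+x. (ennreal n * indicator {-1..1} x) * ennreal (F \<omega> x) \<partial>lborel) \<partial>M)"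
      by (rule lb.Fubini') measurable
    also have "\<dots> \<le> (\<integral>\<^sup>+\<omega>. (\<integral>\<^sup>+x. ennreal (std_normal_density (x - Z \<omega>)) * ennreal (F \<omega> x) \<partial>lborel) \<partial>M)"
    proof (rule nn_integral_mono_AE)
      show "AE \<omega> in M. (\<integral>\<^sup>+x. (ennreal n * indicator {-1..1} x) * ennreal (F \<omega> x) \<partial>lborel)
          \<le> (\<integral>\<^sup>+x. ennreal (std_normal_density (x - Z \<omega>)) * ennreal (F \<omega> x) \<partial>lborel)"
        using RZ
      proof eventually_elim
        case (elim \<omega>)
        have "ennreal n * indicator {-1..1} x \<le> ennreal (std_normal_density (x - Z \<omega>))" for x :: real
          using elim R unfolding n_def
          by (auto simp: indicator_def intro!: ennreal_leI std_normal_density_antimono)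
        thus ?case by (intro nn_integral_mono mult_right_mono) auto
      qed
    qed
    also have "\<dots> = (\<integral>\<^sup>+\<omega>. (\<integral>\<^sup>+g. ennreal ((tmap Z (Z \<omega> + g) - tmap W (W \<omega> + g))\<^sup>2) \<partial>gauss) \<partial>M)"
    proof (rule nn_integral_cong)
      fix \<omega>
      have "(\<integral>\<^sup>+g. ennreal ((tmap Z (Z \<omega> + g) - tmap W (W \<omega> + g))\<^sup>2) \<partial>gauss)
          = (\<integral>\<^sup>+g. ennreal (std_normal_density g) * ennreal ((tmap Z (Z \<omega> + g) - tmap W (W \<omega> + g))\<^sup>2) \<partial>lborel)"
        by (subst nn_integral_density) auto
      \<comment> \<open>The substitution \<open>x = Z \<omega> + g\<close> gives
        \<open>W \<omega> + g = x + D \<omega>\<close>; now \<omega> enters the difference of the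
        two maps through \<open>D\<close> only.\<close>
      also have "\<dots> = (\<integral>\<^sup>+x. ennreal (std_normal_density (x - Z \<omega>)) * ennreal (F \<omega> x) \<partial>lborel)"
        by (subst nn_integral_real_affine[where c=1 and t="- Z \<omega>"]) (auto simp: F_def D_def algebra_simps)
      finally show "(\<integral>\<^sup>+x. ennreal (std_normal_density (x - Z \<omega>)) * ennreal (F \<omega> x) \<partial>lborel)
          = (\<integral>\<^sup>+g. ennreal ((tmap Z (Z \<omega> + g) - tmap W (W \<omega> + g))\<^sup>2) \<partial>gauss)" by simp
    qed
    also have "\<dots> = (\<integral>\<^sup>+\<omega>. ennreal ((tmap Z (Z \<omega> + \<Gamma> \<omega>) - tmap W (W \<omega> + \<Gamma> \<omega>))\<^sup>2) \<partial>M)"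
      by (rule nn_integral_indep[where P = "\<lambda>\<omega> g. ennreal ((tmap Z (Z \<omega> + g) - tmap W (W \<omega> + g))\<^sup>2)", symmetric]) measurable
    also have "\<dots> = (\<integral>\<^sup>+\<omega>. ennreal ((S Z \<omega> - S W \<omega>)\<^sup>2) \<partial>M)" by (simp add: S_def)
    also have "\<dots> = ennreal (\<integral>\<omega>. (S Z \<omega> - S W \<omega>)\<^sup>2 \<partial>M)"
      using L2_D(2)[OF L2_diff[OF S_L2[OF Z] S_L2[OF W] subalgebra_refl]] by (intro nn_integral_eq_integral) auto
    finally have "2 * n * l\<^sup>2 * Q \<le> (\<integral>\<omega>. (S Z \<omega> - S W \<omega>)\<^sup>2 \<partial>M)"
      by (subst (asm) ennreal_le_iff) (auto intro: integral_nonneg_AE)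
    thus ?thesis by (simp add: l2norm_power2 Q_def D_def power2_commute)
  qed
  show ?thesis
  proof (rule that[of "c1 / 2 * (2 * n * l\<^sup>2)"])
    show "0 < c1 / 2 * (2 * n * l\<^sup>2)" using c1_pos n l by simp
    fix Z assume Z: "Z \<in> L2 M G" "AE \<omega> in M. \<bar>Z \<omega>\<bar> \<le> R" "(\<integral>\<omega>. Z \<omega> \<partial>M) = (\<integral>\<omega>. W \<omega> \<partial>M)"
    have "c1 / 2 * (2 * n * l\<^sup>2 * (l2norm M (\<lambda>\<omega>. Z \<omega> - W \<omega>))\<^sup>2) \<le> c1 / 2 * (l2norm M (\<lambda>\<omega>. S Z \<omega> - S W \<omega>))\<^sup>2"
      using main[OF Z] c1_pos by (intro mult_left_mono) auto
    also have "\<dots> \<le> (\<integral>\<omega>. (S Z \<omega> - S W \<omega>) * (Z \<omega> - W \<omega>) \<partial>M)" by (rule S_cocoercive[OF Z(1) W])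
    finally show "c1 / 2 * (2 * n * l\<^sup>2) * (l2norm M (\<lambda>\<omega>. Z \<omega> - W \<omega>))\<^sup>2 \<le> (\<integral>\<omega>. (S Z \<omega> - S W \<omega>) * (Z \<omega> - W \<omega>) \<partial>M)"
      by (simp only: mult.assoc)
  qed
qed

end

section \<open>Decay along the flow\<close>

text \<open>If \<open>l2norm M f = 0\<close>, the normalized function is \<open>0\<close> because \<open>1 / 0 = 0\<close>.\<close>

lemma l2norm_normalized:
  shows "l2norm M (\<lambda>x. 1 / l2norm M f * f x) \<le> 1"
    and "(\<integral>x. 1 / l2norm M f * f x * f x \<partial>M) = l2norm M f"
proof -
  define N where "N = l2norm M f"
  have N2: "(\<integral>x. (f x)\<^sup>2 \<partial>M) = N\<^sup>2" by (simp only: N_def l2norm_power2)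
  have "(\<integral>x. (1 / N * f x)\<^sup>2 \<partial>M) = (1 / N)\<^sup>2 * (\<integral>x. (f x)\<^sup>2 \<partial>M)"
    unfolding power_mult_distrib by (rule Bochner_Integration.integral_mult_right_zero)
  hence "(l2norm M (\<lambda>x. 1 / N * f x))\<^sup>2 = (1 / N)\<^sup>2 * N\<^sup>2"
    by (simp only: l2norm_power2 N2)
  also have "\<dots> \<le> 1\<^sup>2" by (cases "N = 0") (auto simp: power_divide)
  finally have "l2norm M (\<lambda>x. 1 / N * f x) \<le> 1" by (rule power2_le_imp_le) simp
  thus "l2norm M (\<lambda>x. 1 / l2norm M f * f x) \<le> 1" by (simp only: N_def)
  have "(\<integral>x. 1 / N * f x * f x \<partial>M) = 1 / N * (\<integral>x. (f x)\<^sup>2 \<partial>M)"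
    unfolding mult.assoc power2_eq_square by (rule Bochner_Integration.integral_mult_right_zero)
  also have "\<dots> = N" unfolding N2 by (simp add: power2_eq_square)
  finally show "(\<integral>x. 1 / l2norm M f * f x * f x \<partial>M) = l2norm M f" by (simp only: N_def)
qed

lemma abs_cont_on_L2_Lipschitz:
  assumes ac: "L2_abs_cont M Z" and T: "0 \<le> T"
    and Lip: "\<And>s t. 0 \<le> s \<Longrightarrow> 0 \<le> t \<Longrightarrow> \<bar>\<phi> t - \<phi> s\<bar> \<le> C * l2norm M (\<lambda>\<omega>. Z t \<omega> - Z s \<omega>)"
  shows "abs_cont_on 0 T \<phi>"
  unfolding abs_cont_on_def
proof (intro allI impI)
  fix \<epsilon> :: real assume "0 < \<epsilon>"
  hence "0 < \<epsilon> / (\<bar>C\<bar> + 1)" by (intro divide_pos_pos) auto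
  with ac T obtain \<delta> where "0 < \<delta>" and \<delta>: "\<And>(n::nat) a b.
        (\<forall>i<n. 0 \<le> a i \<and> a i \<le> b i \<and> b i \<le> T) \<Longrightarrow>
        disjoint_family_on (\<lambda>i. {a i<..<b i}) {..<n} \<Longrightarrow>
        (\<Sum>i<n. b i - a i) < \<delta> \<Longrightarrow>
        (\<Sum>i<n. l2norm M (\<lambda>\<omega>. Z (b i) \<omega> - Z (a i) \<omega>)) < \<epsilon> / (\<bar>C\<bar> + 1)"
    unfolding L2_abs_cont_def by meson
  have "(\<Sum>i<n. \<bar>\<phi> (v i) - \<phi> (u i)\<bar>) < \<epsilon>"
    if uv: "\<forall>i<n. 0 \<le> u i \<and> u i \<le> v i \<and> v i \<le> T" "disjoint_family_on (\<lambda>i. {u i<..<v i}) {..<n}"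
      "(\<Sum>i<n. v i - u i) < \<delta>" for n :: nat and u v
  proof -
    have "(\<Sum>i<n. \<bar>\<phi> (v i) - \<phi> (u i)\<bar>) \<le> (\<Sum>i<n. (\<bar>C\<bar> + 1) * l2norm M (\<lambda>\<omega>. Z (v i) \<omega> - Z (u i) \<omega>))"
    proof (rule sum_mono)
      fix i assume "i \<in> {..<n}"
      hence "0 \<le> u i" "0 \<le> v i" using uv(1) by (auto intro: order_trans)
      hence "\<bar>\<phi> (v i) - \<phi> (u i)\<bar> \<le> C * l2norm M (\<lambda>\<omega>. Z (v i) \<omega> - Z (u i) \<omega>)" by (rule Lip)
      also have "\<dots> \<le> (\<bar>C\<bar> + 1) * l2norm M (\<lambda>\<omega>. Z (v i) \<omega> - Z (u i) \<omega>)"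
        by (intro mult_right_mono) auto
      finally show "\<bar>\<phi> (v i) - \<phi> (u i)\<bar> \<le> (\<bar>C\<bar> + 1) * l2norm M (\<lambda>\<omega>. Z (v i) \<omega> - Z (u i) \<omega>)" .
    qed
    also have "\<dots> = (\<bar>C\<bar> + 1) * (\<Sum>i<n. l2norm M (\<lambda>\<omega>. Z (v i) \<omega> - Z (u i) \<omega>))"
      by (simp only: sum_distrib_left)
    also have "\<dots> < (\<bar>C\<bar> + 1) * (\<epsilon> / (\<bar>C\<bar> + 1))"
      by (intro mult_strict_left_mono \<delta> uv) auto
    also have "\<dots> = \<epsilon>" by (simp add: add_nonneg_eq_0_iff)
    finally show ?thesis .
  qed
  thus "\<exists>\<delta>>0. \<forall>(n::nat) u v. (\<forall>i<n. 0 \<le> u i \<and> u i \<le> v i \<and> v i \<le> T) \<longrightarrow>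
        disjoint_family_on (\<lambda>i. {u i<..<v i}) {..<n} \<longrightarrow>
        (\<Sum>i<n. v i - u i) < \<delta> \<longrightarrow> (\<Sum>i<n. \<bar>\<phi> (v i) - \<phi> (u i)\<bar>) < \<epsilon>"
    using \<open>0 < \<delta>\<close> by blast
qed

text \<open>Here \<open>\<phi> t\<close> stands for a convex functional of \<open>Z t\<close> with subgradient \<open>g\<close>. Convexity only
  bounds the increments to the left of \<open>t\<close>, which is why left Dini derivatives are used.\<close>

lemma L2_curve_exp_decay:
  assumes Z: "\<And>t. 0 \<le> t \<Longrightarrow> Z t \<in> L2 M M" and ac: "L2_abs_cont M Z"
    and Lip: "\<And>s t. 0 \<le> s \<Longrightarrow> 0 \<le> t \<Longrightarrow> \<bar>\<phi> t - \<phi> s\<bar> \<le> C * l2norm M (\<lambda>\<omega>. Z t \<omega> - Z s \<omega>)"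
    and nonneg: "\<And>t. 0 \<le> t \<Longrightarrow> 0 \<le> \<phi> t" and "0 \<le> \<kappa>" and "0 \<le> T"
    and deriv: "AE t in lborel. 0 < t \<longrightarrow> (\<exists>D g. has_L2_derivative M Z D t \<and> g \<in> L2 M M \<and>
        (\<forall>s\<ge>0. \<phi> t - \<phi> s \<le> (\<integral>\<omega>. g \<omega> * (Z t \<omega> - Z s \<omega>) \<partial>M)) \<and>
        (\<integral>\<omega>. g \<omega> * D \<omega> \<partial>M) \<le> - \<kappa> * \<phi> t)"
  shows "\<phi> T \<le> \<phi> 0 * exp (- \<kappa> * T)"
proof (rule abs_cont_on_exp_decay[OF _ nonneg \<open>0 \<le> \<kappa>\<close> _ \<open>0 \<le> T\<close>])
  show "abs_cont_on 0 T \<phi>" if "0 \<le> T" for T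
    using ac that Lip by (rule abs_cont_on_L2_Lipschitz)
  show "AE t in lborel. 0 < t \<longrightarrow>
                 (\<forall>\<epsilon>>0. \<forall>\<^sub>F s in at_left t. \<phi> t - \<phi> s \<le> (\<epsilon> - \<kappa> * \<phi> t) * (t - s))"
    using deriv
  proof eventually_elim
    case (elim t)
    show ?case
    proof (intro impI allI)
      fix \<epsilon> :: real assume t: "0 < t" and \<epsilon>: "0 < \<epsilon>"
      with elim obtain D g where D: "has_L2_derivative M Z D t" and g: "g \<in> L2 M M"
        and sub: "\<And>s. 0 \<le> s \<Longrightarrow> \<phi> t - \<phi> s \<le> (\<integral>\<omega>. g \<omega> * (Z t \<omega> - Z s \<omega>) \<partial>M)"
        and gD: "(\<integral>\<omega>. g \<omega> * D \<omega> \<partial>M) \<le> - \<kappa> * \<phi> t" by blast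
      from D have DL: "D \<in> L2 M M" and
        lim: "((\<lambda>s. l2norm M (\<lambda>\<omega>. (Z s \<omega> - Z t \<omega>) / (s - t) - D \<omega>)) \<longlongrightarrow> 0) (at t within {0..})"
        by (auto simp: has_L2_derivative_def)
      \<comment> \<open>Accuracy of the difference quotient for which Cauchy-Schwarz against
        \<open>g\<close> loses at most \<epsilon>; the added 1 covers
        \<open>l2norm M g = 0\<close>.\<close>
      define \<eta> where "\<eta> = \<epsilon> / (l2norm M g + 1)"
      have "0 < \<eta>" using \<epsilon> by (simp add: \<eta>_def add_nonneg_pos)
      have g\<eta>: "l2norm M g * \<eta> \<le> \<epsilon>" using \<epsilon> unfolding \<eta>_def times_divide_eq_right
          by (subst pos_divide_le_eq) (auto simp: add_pos_nonneg algebra_simps)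
      from lim \<open>0 < \<eta>\<close> obtain d where "0 < d" and d: "\<And>s. 0 \<le> s \<Longrightarrow> s \<noteq> t \<Longrightarrow> dist s t < d \<Longrightarrow>
          l2norm M (\<lambda>\<omega>. (Z s \<omega> - Z t \<omega>) / (s - t) - D \<omega>) < \<eta>"
        unfolding tendsto_iff eventually_at by (auto simp: dist_real_def)
      show "\<forall>\<^sub>F s in at_left t. \<phi> t - \<phi> s \<le> (\<epsilon> - \<kappa> * \<phi> t) * (t - s)"
        unfolding eventually_at_left_field
      proof (intro exI[of _ "max 0 (t - d)"] conjI allI impI)
        fix s assume "max 0 (t - d) < s" and "s < t"
        hence s: "0 \<le> s" "s < t" "dist s t < d" by (auto simp: dist_real_def)
        \<comment> \<open>The remainder of the difference quotient, so that
          \<open>Z t - Z s = (t - s) * (D + R)\<close>.\<close>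
        define R where "R \<omega> = (Z s \<omega> - Z t \<omega>) / (s - t) - D \<omega>" for \<omega>
        have ZZ: "(\<lambda>\<omega>. Z s \<omega> - Z t \<omega>) \<in> L2 M M" using Z s t by (intro L2_diff) auto
        have "(\<lambda>\<omega>. 1 / (s - t) * (Z s \<omega> - Z t \<omega>) - D \<omega>) \<in> L2 M M"
          by (intro L2_diff L2_scale ZZ DL) auto
        hence RL: "R \<in> L2 M M" by (simp add: R_def[abs_def])
        have "\<phi> t - \<phi> s \<le> (\<integral>\<omega>. g \<omega> * (Z t \<omega> - Z s \<omega>) \<partial>M)" by (rule sub[OF s(1)])
        also have "\<dots> = (\<integral>\<omega>. (t - s) * (g \<omega> * D \<omega> + g \<omega> * R \<omega>) \<partial>M)"
          using s(2) by (intro Bochner_Integration.integral_cong) (auto simp: R_def field_simps)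
        also have "\<dots> = (t - s) * ((\<integral>\<omega>. g \<omega> * D \<omega> \<partial>M) + (\<integral>\<omega>. g \<omega> * R \<omega> \<partial>M))"
          using L2_mult_integrable[OF g DL] L2_mult_integrable[OF g RL] by simp
        also have "\<dots> \<le> (t - s) * (- \<kappa> * \<phi> t + \<epsilon>)"
        proof (intro mult_left_mono add_mono gD)
          have "(\<integral>\<omega>. g \<omega> * R \<omega> \<partial>M) \<le> l2norm M g * l2norm M R"
            using l2norm_Cauchy_Schwarz[OF g RL] by simp
          also have "\<dots> \<le> l2norm M g * \<eta>"
            using d[OF s(1) _ s(3)] s(2) unfolding R_def[abs_def] by (intro mult_left_mono) auto
          finally show "(\<integral>\<omega>. g \<omega> * R \<omega> \<partial>M) \<le> \<epsilon>" using g\<eta> by simp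
        qed (use s in auto)
        finally show "\<phi> t - \<phi> s \<le> (\<epsilon> - \<kappa> * \<phi> t) * (t - s)" by (simp add: algebra_simps)
      qed (use t \<open>0 < d\<close> in auto)
    qed
  qed
qed

context bass_setting
begin

section \<open>The flow tested against directions measurable in X\<close>

lemma flow_L2: "bass_flow M X \<nu> Z0 Z \<Longrightarrow> 0 \<le> t \<Longrightarrow> Z t \<in> L2 M G"
  by (simp add: bass_flow_def)

lemma flow_abs_cont: "bass_flow M X \<nu> Z0 Z \<Longrightarrow> L2_abs_cont M Z"
  by (simp add: bass_flow_def)

text \<open>The Brenier map in the flow is an arbitrary version, equal to \<open>tmap (Z t)\<close>
  almost everywhere for the law of \<open>Z t + \<Gamma>\<close>. Testing against \<open>h\<close>
  moves the comparison to \<open>Z t + \<Gamma>\<close>, where this suffices, and avoids comparing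
  the two Gaussian averages pointwise.\<close>

lemma flow_derivative:
  assumes flow: "bass_flow M X \<nu> Z0 Z"
  shows "AE t in lborel. 0 < t \<longrightarrow> (\<exists>D. has_L2_derivative M Z D t \<and>
           (\<forall>h \<in> L2 M G. (\<integral>\<omega>. h \<omega> * D \<omega> \<partial>M) = - (\<integral>\<omega>. h \<omega> * (S (Z t) \<omega> - X \<omega>) \<partial>M)))"
proof -
  have "AE t in lborel. 0 \<le> t \<longrightarrow>
        (\<exists>T. brenier_map (distr M borel (Z t) \<star> gauss) \<nu> T \<and>
             has_L2_derivative M Z (\<lambda>\<omega>. - (gauss_conv T (Z t \<omega>) - X \<omega>)) t)"
    using flow by (simp add: bass_flow_def)
  thus ?thesis
  proof eventually_elim
    case (elim t)
    show ?case
    proof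
      assume "0 < t"
      hence Zt: "Z t \<in> L2 M G" by (intro flow_L2[OF flow]) simp
      have Ztm: "Z t \<in> borel_measurable G" using Zt by (simp add: L2_def)
      from elim \<open>0 < t\<close> obtain T where T: "brenier_map (law (Z t)) \<nu> T" and
        D: "has_L2_derivative M Z (\<lambda>\<omega>. - (gauss_conv T (Z t \<omega>) - X \<omega>)) t"
        unfolding law_eq_convolution[OF Ztm] by auto
      interpret regular_source \<nu> \<alpha> \<beta> c1 c2 "law (Z t)" by (rule regular_source_law[OF Zt])
      have Tm: "T \<in> borel_measurable borel" using T by (simp add: brenier_map_def)
      have TS: "AE \<omega> in M. T (Z t \<omega> + \<Gamma> \<omega>) = S (Z t) \<omega>"
        using AE_law[OF G_meas[OF Ztm] brenier_map_AE_eq[OF T]] by (simp add: S_def tmap_def)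
      have "(\<integral>\<omega>. h \<omega> * - (gauss_conv T (Z t \<omega>) - X \<omega>) \<partial>M) = - (\<integral>\<omega>. h \<omega> * (S (Z t) \<omega> - X \<omega>) \<partial>M)"
        if h: "h \<in> L2 M G" for h
      proof -
        have "(\<lambda>\<omega>. - (gauss_conv T (Z t \<omega>) - X \<omega>)) \<in> L2 M M"
          using D by (simp add: has_L2_derivative_def)
        from L2_mult_integrable[OF L2_G[OF h] L2_scale[OF this, of "-1"]]
        have "integrable M (\<lambda>\<omega>. h \<omega> * (gauss_conv T (Z t \<omega>) - X \<omega>))" by simp
        from integral_gauss_conv[OF Zt h Tm TS this] show ?thesis
          by (simp only: mult_minus_right Bochner_Integration.integral_minus)
      qed
      with D show "\<exists>D. has_L2_derivative M Z D t \<and>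
           (\<forall>h \<in> L2 M G. (\<integral>\<omega>. h \<omega> * D \<omega> \<partial>M) = - (\<integral>\<omega>. h \<omega> * (S (Z t) \<omega> - X \<omega>) \<partial>M))" by blast
    qed
  qed
qed

text \<open>The form in which decay is applied: it suffices to find at each time a
  \<open>G\<close>-measurable subgradient \<open>g\<close> whose pairing with
  \<open>S (Z t) - X\<close>, the dissipation, dominates \<open>\<kappa> * \<phi> t\<close>. Both
  rate 0 and positive rates occur.\<close>

lemma flow_exp_decay:
  assumes flow: "bass_flow M X \<nu> Z0 Z"
    and Lip: "\<And>s t. 0 \<le> s \<Longrightarrow> 0 \<le> t \<Longrightarrow> \<bar>\<phi> t - \<phi> s\<bar> \<le> C * l2norm M (\<lambda>\<omega>. Z t \<omega> - Z s \<omega>)"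
    and nonneg: "\<And>t. 0 \<le> t \<Longrightarrow> 0 \<le> \<phi> t" and "0 \<le> \<kappa>" and "0 \<le> T"
    and sub: "\<And>t. 0 < t \<Longrightarrow> \<exists>g \<in> L2 M G.
        (\<forall>s\<ge>0. \<phi> t - \<phi> s \<le> (\<integral>\<omega>. g \<omega> * (Z t \<omega> - Z s \<omega>) \<partial>M)) \<and>
        \<kappa> * \<phi> t \<le> (\<integral>\<omega>. g \<omega> * (S (Z t) \<omega> - X \<omega>) \<partial>M)"
  shows "\<phi> T \<le> \<phi> 0 * exp (- \<kappa> * T)"
proof (rule L2_curve_exp_decay[OF L2_G[OF flow_L2[OF flow]] flow_abs_cont[OF flow] Lip nonneg \<open>0 \<le> \<kappa>\<close> \<open>0 \<le> T\<close>])
  show "AE t in lborel. 0 < t \<longrightarrow> (\<exists>D g. has_L2_derivative M Z D t \<and> g \<in> L2 M M \<and>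
        (\<forall>s\<ge>0. \<phi> t - \<phi> s \<le> (\<integral>\<omega>. g \<omega> * (Z t \<omega> - Z s \<omega>) \<partial>M)) \<and>
        (\<integral>\<omega>. g \<omega> * D \<omega> \<partial>M) \<le> - \<kappa> * \<phi> t)"
    using flow_derivative[OF flow]
  proof eventually_elim
    case (elim t)
    show ?case
    proof
      assume "0 < t"
      with elim obtain D where D: "has_L2_derivative M Z D t"
        "\<And>h. h \<in> L2 M G \<Longrightarrow> (\<integral>\<omega>. h \<omega> * D \<omega> \<partial>M) = - (\<integral>\<omega>. h \<omega> * (S (Z t) \<omega> - X \<omega>) \<partial>M)" by blast
      from sub[OF \<open>0 < t\<close>] obtain g where g: "g \<in> L2 M G"
        "\<forall>s\<ge>0. \<phi> t - \<phi> s \<le> (\<integral>\<omega>. g \<omega> * (Z t \<omega> - Z s \<omega>) \<partial>M)"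
        "\<kappa> * \<phi> t \<le> (\<integral>\<omega>. g \<omega> * (S (Z t) \<omega> - X \<omega>) \<partial>M)" by blast
      show "\<exists>D g. has_L2_derivative M Z D t \<and> g \<in> L2 M M \<and>
        (\<forall>s\<ge>0. \<phi> t - \<phi> s \<le> (\<integral>\<omega>. g \<omega> * (Z t \<omega> - Z s \<omega>) \<partial>M)) \<and>
        (\<integral>\<omega>. g \<omega> * D \<omega> \<partial>M) \<le> - \<kappa> * \<phi> t"
        using g D(1) D(2)[OF g(1)] L2_G[OF g(1)] by (intro exI[of _ D] exI[of _ g]) simp
    qed
  qed
qed

lemma const_L2_G: "(\<lambda>_. c) \<in> L2 M G"
  by (simp add: L2_def)

lemma mean_S:
  assumes "Z \<in> L2 M G"
  shows "(\<integral>\<omega>. S Z \<omega> - X \<omega> \<partial>M) = 0"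
proof -
  have "(\<integral>\<omega>. S Z \<omega> \<partial>M) = (\<integral>y. y \<partial>distr M borel (S Z))"
    using S_meas(2)[OF assms] by (subst integral_distr) auto
  thus ?thesis using L2_integrable[OF S_L2[OF assms]] L2_integrable[OF X_L2] mean_X
    by (simp add: distr_S[OF assms])
qed

text \<open>Decay at rate 0 for \<open>|m t - m 0|\<close>, which starts at 0. Its subgradient is a
  constant function, the sign of \<open>m t - m 0\<close>, and constants produce no dissipation
  because \<open>S Z\<close> and \<open>X\<close> have the same mean.\<close>

lemma flow_mean:
  assumes flow: "bass_flow M X \<nu> Z0 Z" and "0 \<le> t"
  shows "(\<integral>\<omega>. Z t \<omega> \<partial>M) = (\<integral>\<omega>. Z 0 \<omega> \<partial>M)"
proof -
  define m where "m t = (\<integral>\<omega>. Z t \<omega> \<partial>M)" for t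
  note ZL = flow_L2[OF flow]
  have diff: "m t - m s = (\<integral>\<omega>. Z t \<omega> - Z s \<omega> \<partial>M)" if "0 \<le> s" "0 \<le> t" for s t
    using L2_integrable[OF L2_G[OF ZL]] that by (simp add: m_def)
  have "\<bar>m t - m 0\<bar> \<le> \<bar>m 0 - m 0\<bar> * exp (- 0 * t)"
  proof (rule flow_exp_decay[OF flow, where \<kappa> = 0 and \<phi> = "\<lambda>t. \<bar>m t - m 0\<bar>" and C = 1])
    fix s t :: real assume st: "0 \<le> s" "0 \<le> t"
    have "\<bar>m t - m s\<bar> \<le> (\<integral>\<omega>. \<bar>Z t \<omega> - Z s \<omega>\<bar> \<partial>M)" unfolding diff[OF st] by (rule integral_abs_bound)
    also have "\<dots> \<le> l2norm M (\<lambda>\<omega>. Z t \<omega> - Z s \<omega>)"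
      by (intro expectation_abs_le_l2norm L2_diff L2_G ZL st subalgebra_refl)
    finally show "\<bar>\<bar>m t - m 0\<bar> - \<bar>m s - m 0\<bar>\<bar> \<le> 1 * l2norm M (\<lambda>\<omega>. Z t \<omega> - Z s \<omega>)" by simp
  next
    fix t :: real assume t: "0 < t"
    define c where "c = sgn (m t - m 0)"
    have "\<bar>m t - m 0\<bar> - \<bar>m s - m 0\<bar> \<le> (\<integral>\<omega>. c * (Z t \<omega> - Z s \<omega>) \<partial>M)" if "0 \<le> s" for s
    proof -
      have "\<bar>m t - m 0\<bar> - \<bar>m s - m 0\<bar> \<le> c * (m t - m s)"
        by (auto simp: c_def sgn_if)
      thus ?thesis using diff[of s t] that t by simp
    qed
    moreover have "(\<integral>\<omega>. c * (S (Z t) \<omega> - X \<omega>) \<partial>M) = 0"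
      using mean_S[OF ZL[of t]] t by simp
    ultimately show "\<exists>g \<in> L2 M G. (\<forall>s\<ge>0. \<bar>m t - m 0\<bar> - \<bar>m s - m 0\<bar> \<le> (\<integral>\<omega>. g \<omega> * (Z t \<omega> - Z s \<omega>) \<partial>M)) \<and>
        0 * \<bar>m t - m 0\<bar> \<le> (\<integral>\<omega>. g \<omega> * (S (Z t) \<omega> - X \<omega>) \<partial>M)"
      by (intro bexI[OF _ const_L2_G[of c]]) auto
  qed (use \<open>0 \<le> t\<close> in auto)
  thus ?thesis by (simp add: m_def)
qed

lemma minimizer_orthogonal:
  assumes min: "bass_minimizer M X \<Gamma> \<nu> W" and h: "h \<in> L2 M G"
  shows "(\<integral>\<omega>. h \<omega> * (S W \<omega> - X \<omega>) \<partial>M) = 0"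
proof -
  have W: "W \<in> L2 M G" using min by (simp add: bass_minimizer_def)
  have "(\<integral>\<omega>. h \<omega> * (S W \<omega> - X \<omega>) \<partial>M) = (\<integral>\<omega>. h \<omega> * grad W \<omega> \<partial>M)"
    by (rule integral_grad[OF W h, symmetric])
  also have "\<dots> = (\<integral>\<omega>. 0 \<partial>M)"
    using L2_D(1)[OF L2_G[OF h]] L2_D(1)[OF L2_G[OF grad_L2[OF W]]] minimizer_grad_0[OF min]
    by (intro integral_cong_AE) (auto elim: eventually_mono)
  finally show ?thesis by simp
qed

text \<open>The gradient vanishes at \<open>W\<close>, so against \<open>G\<close>-measurable
  directions \<open>S W\<close> may be replaced by X; monotonicity thereby becomes a statement about
  the drift of the flow.\<close>

lemma minimizer_monotone_eq:
  assumes min: "bass_minimizer M X \<Gamma> \<nu> W" and Z: "Z \<in> L2 M G"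
  shows "(\<integral>\<omega>. (S Z \<omega> - S W \<omega>) * (Z \<omega> - W \<omega>) \<partial>M) = (\<integral>\<omega>. (Z \<omega> - W \<omega>) * (S Z \<omega> - X \<omega>) \<partial>M)"
proof -
  have W: "W \<in> L2 M G" using min by (simp add: bass_minimizer_def)
  have ZW: "(\<lambda>\<omega>. Z \<omega> - W \<omega>) \<in> L2 M G" by (intro L2_diff Z W subalgebra_G)
  have "(\<integral>\<omega>. (S Z \<omega> - S W \<omega>) * (Z \<omega> - W \<omega>) \<partial>M)
      = (\<integral>\<omega>. (Z \<omega> - W \<omega>) * (S Z \<omega> - X \<omega>) - (Z \<omega> - W \<omega>) * (S W \<omega> - X \<omega>) \<partial>M)"
    by (intro Bochner_Integration.integral_cong) (auto simp: algebra_simps)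
  also have "\<dots> = (\<integral>\<omega>. (Z \<omega> - W \<omega>) * (S Z \<omega> - X \<omega>) \<partial>M) - (\<integral>\<omega>. (Z \<omega> - W \<omega>) * (S W \<omega> - X \<omega>) \<partial>M)"
    by (intro Bochner_Integration.integral_diff L2_mult_integrable L2_G[OF ZW] L2_M_intros S_L2 Z W)
  finally show ?thesis using minimizer_orthogonal[OF min ZW] by simp
qed

text \<open>Applied to the norm rather than its square, since the norm is 1-Lipschitz along the
  curve. The subgradient is the normalized \<open>Z t - W\<close>; dividing the monotonicity
  inequality by the norm keeps the rate \<kappa>. At norm 0 the subgradient is 0 and the condition
  is trivial.\<close>

lemma flow_norm_decay:
  assumes flow: "bass_flow M X \<nu> Z0 Z" and min: "bass_minimizer M X \<Gamma> \<nu> W" and "0 \<le> \<kappa>"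
    and mono: "\<And>t. 0 \<le> t \<Longrightarrow> \<kappa> * (l2norm M (\<lambda>\<omega>. Z t \<omega> - W \<omega>))\<^sup>2
      \<le> (\<integral>\<omega>. (S (Z t) \<omega> - S W \<omega>) * (Z t \<omega> - W \<omega>) \<partial>M)"
    and "0 \<le> T"
  shows "l2norm M (\<lambda>\<omega>. Z T \<omega> - W \<omega>) \<le> l2norm M (\<lambda>\<omega>. Z 0 \<omega> - W \<omega>) * exp (- \<kappa> * T)"
proof (rule flow_exp_decay[OF flow, where \<phi> = "\<lambda>t. l2norm M (\<lambda>\<omega>. Z t \<omega> - W \<omega>)" and C = 1])
  have W: "W \<in> L2 M G" using min by (simp add: bass_minimizer_def)
  note ZL = flow_L2[OF flow]
  have ZW: "(\<lambda>\<omega>. Z t \<omega> - W \<omega>) \<in> L2 M G" if "0 \<le> t" for t by (intro L2_diff ZL W subalgebra_G that)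
  {
    fix s t :: real assume st: "0 \<le> s" "0 \<le> t"
    show "\<bar>l2norm M (\<lambda>\<omega>. Z t \<omega> - W \<omega>) - l2norm M (\<lambda>\<omega>. Z s \<omega> - W \<omega>)\<bar> \<le> 1 * l2norm M (\<lambda>\<omega>. Z t \<omega> - Z s \<omega>)"
      using l2norm_reverse_triangle[OF L2_G[OF ZW[OF st(2)]] L2_G[OF ZW[OF st(1)]]] by simp
  }
  fix t :: real assume t: "0 < t"
  define N where "N = l2norm M (\<lambda>\<omega>. Z t \<omega> - W \<omega>)"
  define g where "g \<omega> = 1 / N * (Z t \<omega> - W \<omega>)" for \<omega>
  have g: "g \<in> L2 M G" unfolding g_def[abs_def] using t by (intro L2_scale ZW) simp
  have gnorm: "l2norm M g \<le> 1" and gN: "(\<integral>\<omega>. g \<omega> * (Z t \<omega> - W \<omega>) \<partial>M) = N"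
    unfolding g_def[abs_def] N_def by (rule l2norm_normalized)+
  have "N - l2norm M (\<lambda>\<omega>. Z s \<omega> - W \<omega>) \<le> (\<integral>\<omega>. g \<omega> * (Z t \<omega> - Z s \<omega>) \<partial>M)" if "0 \<le> s" for s
  proof -
    have "(\<integral>\<omega>. g \<omega> * (Z s \<omega> - W \<omega>) \<partial>M) \<le> l2norm M g * l2norm M (\<lambda>\<omega>. Z s \<omega> - W \<omega>)"
      using l2norm_Cauchy_Schwarz[OF L2_G[OF g] L2_G[OF ZW[OF that]]] by simp
    also have "\<dots> \<le> 1 * l2norm M (\<lambda>\<omega>. Z s \<omega> - W \<omega>)" by (intro mult_right_mono gnorm) simp
    finally have "N - l2norm M (\<lambda>\<omega>. Z s \<omega> - W \<omega>) \<le> (\<integral>\<omega>. g \<omega> * (Z t \<omega> - W \<omega>) \<partial>M) - (\<integral>\<omega>. g \<omega> * (Z s \<omega> - W \<omega>) \<partial>M)"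
      using gN by simp
    also have "\<dots> = (\<integral>\<omega>. g \<omega> * (Z t \<omega> - W \<omega>) - g \<omega> * (Z s \<omega> - W \<omega>) \<partial>M)"
      using t that by (intro Bochner_Integration.integral_diff[symmetric] L2_mult_integrable L2_G g ZW) auto
    also have "\<dots> = (\<integral>\<omega>. g \<omega> * (Z t \<omega> - Z s \<omega>) \<partial>M)"
      by (intro Bochner_Integration.integral_cong) (auto simp: algebra_simps)
    finally show ?thesis .
  qed
  moreover have "\<kappa> * N \<le> (\<integral>\<omega>. g \<omega> * (S (Z t) \<omega> - X \<omega>) \<partial>M)"
  proof -
    have "\<kappa> * N\<^sup>2 \<le> (\<integral>\<omega>. (Z t \<omega> - W \<omega>) * (S (Z t) \<omega> - X \<omega>) \<partial>M)"
      using mono[of t] minimizer_monotone_eq[OF min ZL[of t]] t by (simp add: N_def)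
    hence "1 / N * (\<kappa> * N\<^sup>2) \<le> 1 / N * (\<integral>\<omega>. (Z t \<omega> - W \<omega>) * (S (Z t) \<omega> - X \<omega>) \<partial>M)"
      by (intro mult_left_mono) (auto simp: N_def)
    also have "\<dots> = (\<integral>\<omega>. g \<omega> * (S (Z t) \<omega> - X \<omega>) \<partial>M)"
      unfolding g_def mult.assoc by (rule Bochner_Integration.integral_mult_right_zero[symmetric])
    finally show ?thesis by (simp add: power2_eq_square split: if_splits)
  qed
  ultimately show "\<exists>g \<in> L2 M G. (\<forall>s\<ge>0. l2norm M (\<lambda>\<omega>. Z t \<omega> - W \<omega>) - l2norm M (\<lambda>\<omega>. Z s \<omega> - W \<omega>) \<le> (\<integral>\<omega>. g \<omega> * (Z t \<omega> - Z s \<omega>) \<partial>M)) \<and>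
        \<kappa> * l2norm M (\<lambda>\<omega>. Z t \<omega> - W \<omega>) \<le> (\<integral>\<omega>. g \<omega> * (S (Z t) \<omega> - X \<omega>) \<partial>M)"
    using g unfolding N_def by blast
qed (use assms in auto)

text \<open>Co-coercivity makes the distance to \<open>W\<close> nonincreasing, which bounds the
  second moments and gives one drift level for all times. The norm of the excess over that level
  starts at 0 and cannot grow, as the gradient has the sign of \<open>Z t\<close> wherever the
  excess is positive.\<close>

lemma flow_bounded:
  assumes flow: "bass_flow M X \<nu> Z0 Z" and min: "bass_minimizer M X \<Gamma> \<nu> W"
    and Z0: "AE \<omega> in M. \<bar>Z 0 \<omega>\<bar> \<le> c"
  obtains R where "0 \<le> R" "\<And>t. 0 \<le> t \<Longrightarrow> AE \<omega> in M. \<bar>Z t \<omega>\<bar> \<le> R"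
proof -
  have W: "W \<in> L2 M G" using min by (simp add: bass_minimizer_def)
  note ZL = flow_L2[OF flow]
  define B where "B = (l2norm M (\<lambda>\<omega>. Z 0 \<omega> - W \<omega>) + l2norm M W)\<^sup>2"
  have B: "(\<integral>\<omega>. (Z t \<omega>)\<^sup>2 \<partial>M) \<le> B" if "0 \<le> t" for t
  proof -
    have "l2norm M (\<lambda>\<omega>. Z t \<omega> - W \<omega>) \<le> l2norm M (\<lambda>\<omega>. Z 0 \<omega> - W \<omega>) * exp (- 0 * t)"
    proof (rule flow_norm_decay[OF flow min _ _ that])
      fix t :: real assume "0 \<le> t"
      have "0 \<le> c1 / 2 * (l2norm M (\<lambda>\<omega>. S (Z t) \<omega> - S W \<omega>))\<^sup>2" using c1_pos by simp
      also have "\<dots> \<le> (\<integral>\<omega>. (S (Z t) \<omega> - S W \<omega>) * (Z t \<omega> - W \<omega>) \<partial>M)"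
        by (intro S_cocoercive ZL \<open>0 \<le> t\<close> W)
      finally show "0 * (l2norm M (\<lambda>\<omega>. Z t \<omega> - W \<omega>))\<^sup>2 \<le> (\<integral>\<omega>. (S (Z t) \<omega> - S W \<omega>) * (Z t \<omega> - W \<omega>) \<partial>M)" by simp
    qed simp
    moreover have "l2norm M (Z t) \<le> l2norm M (\<lambda>\<omega>. Z t \<omega> - W \<omega>) + l2norm M W"
      using l2norm_triangle[OF L2_diff[OF L2_G[OF ZL[OF that]] L2_G[OF W] subalgebra_refl] L2_G[OF W]] by simp
    ultimately have "l2norm M (Z t) \<le> l2norm M (\<lambda>\<omega>. Z 0 \<omega> - W \<omega>) + l2norm M W" by simp
    hence "(l2norm M (Z t))\<^sup>2 \<le> B" unfolding B_def by (intro power_mono) auto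
    thus ?thesis by (simp add: l2norm_power2)
  qed
  obtain K0 where K0: "1 \<le> K0" "\<And>Z z. Z \<in> L2 M G \<Longrightarrow> (\<integral>\<omega>. (Z \<omega>)\<^sup>2 \<partial>M) \<le> B \<Longrightarrow> K0 \<le> z \<Longrightarrow>
       m2 < gauss_conv (tmap Z) z \<and> gauss_conv (tmap Z) (- z) < m1"
    using ex_drift_bound[of B] by blast
  \<comment> \<open>Beyond \<open>K0\<close> the drift points inwards; including \<open>c\<close>
    makes the excess \<open>P\<close> vanish at time 0.\<close>
  define K where "K = max K0 c"
  have K: "0 \<le> K" using K0(1) by (simp add: K_def)
  define P where "P t \<omega> = max 0 (\<bar>Z t \<omega>\<bar> - K)" for t \<omega>
  have P: "P t \<in> L2 M G" if "0 \<le> t" for t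
  proof -
    have [measurable]: "Z t \<in> borel_measurable G" using ZL[OF that] by (simp add: L2_def)
    have Pm: "P t \<in> borel_measurable G" unfolding P_def[abs_def] by measurable
    have "P t \<in> L2 M M"
      by (rule L2_bound[OF L2_G[OF ZL[OF that]] G_meas[OF Pm]]) (use K in \<open>auto simp: P_def\<close>)
    thus ?thesis using Pm by (simp add: L2_def)
  qed
  have "AE \<omega> in M. \<bar>Z T \<omega>\<bar> \<le> K" if T: "0 \<le> T" for T
  proof -
    have "l2norm M (P T) \<le> l2norm M (P 0) * exp (- 0 * T)"
    proof (rule flow_exp_decay[OF flow, where \<phi> = "\<lambda>t. l2norm M (P t)" and C = 1])
      fix s t :: real assume st: "0 \<le> s" "0 \<le> t"
      have "\<bar>l2norm M (P t) - l2norm M (P s)\<bar> \<le> l2norm M (\<lambda>\<omega>. P t \<omega> - P s \<omega>)"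
        by (intro l2norm_reverse_triangle L2_G P st)
      also have "\<dots> \<le> l2norm M (\<lambda>\<omega>. Z t \<omega> - Z s \<omega>)"
      proof (rule l2norm_mono)
        show "(\<lambda>\<omega>. Z t \<omega> - Z s \<omega>) \<in> L2 M M" by (intro L2_diff L2_G ZL st subalgebra_refl)
        show "(\<lambda>\<omega>. P t \<omega> - P s \<omega>) \<in> borel_measurable M"
          using L2_D(1)[OF L2_G[OF P[OF st(1)]]] L2_D(1)[OF L2_G[OF P[OF st(2)]]] by measurable
        show "AE \<omega> in M. \<bar>P t \<omega> - P s \<omega>\<bar> \<le> \<bar>Z t \<omega> - Z s \<omega>\<bar>"
          by (intro AE_I2) (auto simp: P_def max_def)
      qed
      finally show "\<bar>l2norm M (P t) - l2norm M (P s)\<bar> \<le> 1 * l2norm M (\<lambda>\<omega>. Z t \<omega> - Z s \<omega>)" by simp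
    next
      fix t :: real assume "0 < t"
      hence t: "0 \<le> t" by simp
      define N where "N = l2norm M (P t)"
      have N: "0 \<le> N" by (simp add: N_def)
      define u where "u \<omega> = 1 / N * P t \<omega>" for \<omega>
      have u: "u \<in> L2 M G" unfolding u_def[abs_def] by (intro L2_scale P t)
      have u0: "0 \<le> u \<omega>" for \<omega> using N by (simp add: u_def P_def)
      \<comment> \<open>A subgradient at \<open>Z t\<close> of the norm of the excess: the
        normalized excess carrying the sign of \<open>Z t\<close>.\<close>
      define g where "g \<omega> = u \<omega> * sgn (Z t \<omega>)" for \<omega>
      have Ztm [measurable]: "Z t \<in> borel_measurable G" using ZL[OF t] by (simp add: L2_def)
      have um [measurable]: "u \<in> borel_measurable G" using u by (simp add: L2_def)
      have gm: "g \<in> borel_measurable G" unfolding g_def[abs_def] by measurable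
      have "g \<in> L2 M M"
        by (rule L2_bound[OF L2_G[OF u] G_meas[OF gm]]) (auto simp: g_def abs_mult sgn_if)
      hence g: "g \<in> L2 M G" using gm by (simp add: L2_def)
      have unorm: "l2norm M u \<le> 1" and uN: "(\<integral>\<omega>. u \<omega> * P t \<omega> \<partial>M) = N"
        unfolding u_def[abs_def] N_def by (rule l2norm_normalized)+
      have "N - l2norm M (P s) \<le> (\<integral>\<omega>. g \<omega> * (Z t \<omega> - Z s \<omega>) \<partial>M)" if s: "0 \<le> s" for s
      proof -
        have "(\<integral>\<omega>. u \<omega> * P s \<omega> \<partial>M) \<le> l2norm M u * l2norm M (P s)"
          using l2norm_Cauchy_Schwarz[OF L2_G[OF u] L2_G[OF P[OF s]]] by simp
        also have "\<dots> \<le> 1 * l2norm M (P s)" by (intro mult_right_mono unorm) simp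
        finally have "N - l2norm M (P s) \<le> (\<integral>\<omega>. u \<omega> * P t \<omega> \<partial>M) - (\<integral>\<omega>. u \<omega> * P s \<omega> \<partial>M)"
          using uN by simp
        also have "\<dots> = (\<integral>\<omega>. u \<omega> * P t \<omega> - u \<omega> * P s \<omega> \<partial>M)"
          by (intro Bochner_Integration.integral_diff[symmetric] L2_mult_integrable L2_G u P t s)
        also have "\<dots> \<le> (\<integral>\<omega>. g \<omega> * (Z t \<omega> - Z s \<omega>) \<partial>M)"
        proof (rule integral_mono)
          show "integrable M (\<lambda>\<omega>. u \<omega> * P t \<omega> - u \<omega> * P s \<omega>)"
            by (intro Bochner_Integration.integrable_diff L2_mult_integrable L2_G u P t s)
          show "integrable M (\<lambda>\<omega>. g \<omega> * (Z t \<omega> - Z s \<omega>))"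
            by (intro L2_mult_integrable L2_diff L2_G g ZL t s subalgebra_refl)
          fix \<omega>
          \<comment> \<open>Where the excess is positive it equals \<open>|Z t| - K\<close>, so the
            claim is convexity of the excess in \<open>Z t\<close>; elsewhere the weight
            \<open>u\<close> vanishes.\<close>
          have "P t \<omega> - P s \<omega> \<le> sgn (Z t \<omega>) * (Z t \<omega> - Z s \<omega>)" if "P t \<omega> \<noteq> 0"
            using that K by (auto simp: P_def max_def sgn_if split: if_splits)
          hence "u \<omega> * (P t \<omega> - P s \<omega>) \<le> u \<omega> * (sgn (Z t \<omega>) * (Z t \<omega> - Z s \<omega>))"
            using mult_left_mono[OF _ u0] by (cases "P t \<omega> = 0") (simp add: u_def, blast)
          thus "u \<omega> * P t \<omega> - u \<omega> * P s \<omega> \<le> g \<omega> * (Z t \<omega> - Z s \<omega>)"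
            by (simp add: g_def right_diff_distrib mult.assoc)
        qed
        finally show ?thesis .
      qed
      moreover have "0 \<le> (\<integral>\<omega>. g \<omega> * (S (Z t) \<omega> - X \<omega>) \<partial>M)"
      proof -
        have "0 \<le> (\<integral>\<omega>. g \<omega> * grad (Z t) \<omega> \<partial>M)"
        proof (rule integral_nonneg_AE)
          show "AE \<omega> in M. 0 \<le> g \<omega> * grad (Z t) \<omega>"
            using X_in
          proof eventually_elim
            case (elim \<omega>)
            have "\<bar>Z t \<omega>\<bar> \<le> K \<or> Z t \<omega> > K \<or> - Z t \<omega> > K" by linarith
            then consider "P t \<omega> = 0" | "Z t \<omega> > K" | "- Z t \<omega> > K" by (auto simp: P_def)
            thus ?case
            proof cases
              case 1
              thus ?thesis by (simp add: g_def u_def)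
            next
              case 2
              hence "m2 < gauss_conv (tmap (Z t)) (Z t \<omega>)"
                using K0(2)[OF ZL[OF t] B[OF t], of "Z t \<omega>"] by (simp add: K_def)
              hence "0 \<le> grad (Z t) \<omega>" using elim by (simp add: grad_def)
              moreover have "0 \<le> g \<omega>" using 2 K u0[of \<omega>] by (simp add: g_def)
              ultimately show ?thesis by simp
            next
              case 3
              hence "gauss_conv (tmap (Z t)) (Z t \<omega>) < m1"
                using K0(2)[OF ZL[OF t] B[OF t], of "- Z t \<omega>"] by (simp add: K_def)
              hence "grad (Z t) \<omega> \<le> 0" using elim by (simp add: grad_def)
              moreover have "g \<omega> \<le> 0" using 3 K u0[of \<omega>] by (simp add: g_def sgn_if)
              ultimately show ?thesis by (simp add: mult_nonpos_nonpos)
            qed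
          qed
        qed
        thus ?thesis using integral_grad[OF ZL[OF t] g] by simp
      qed
      ultimately show "\<exists>g \<in> L2 M G. (\<forall>s\<ge>0. l2norm M (P t) - l2norm M (P s) \<le> (\<integral>\<omega>. g \<omega> * (Z t \<omega> - Z s \<omega>) \<partial>M)) \<and>
          0 * l2norm M (P t) \<le> (\<integral>\<omega>. g \<omega> * (S (Z t) \<omega> - X \<omega>) \<partial>M)"
        using g unfolding N_def by auto
    qed (use T in auto)
    moreover have "l2norm M (P 0) = 0"
    proof -
      have "AE \<omega> in M. (P 0 \<omega>)\<^sup>2 = 0" using Z0 by eventually_elim (simp add: P_def K_def)
      hence "(\<integral>\<omega>. (P 0 \<omega>)\<^sup>2 \<partial>M) = (\<integral>\<omega>. 0 \<partial>M)"
        using L2_D[OF L2_G[OF P[of 0]]] by (intro integral_cong_AE) auto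
      thus ?thesis by (simp add: l2norm_def)
    qed
    ultimately have "l2norm M (P T) \<le> 0" by simp
    hence "l2norm M (P T) = 0" by (rule order.antisym) simp
    hence "(\<integral>\<omega>. (P T \<omega>)\<^sup>2 \<partial>M) = 0" unfolding l2norm_power2[symmetric] by simp
    hence "AE \<omega> in M. (P T \<omega>)\<^sup>2 = 0"
      using L2_D[OF L2_G[OF P[OF T]]] by (subst (asm) integral_nonneg_eq_0_iff_AE) auto
    thus ?thesis by eventually_elim (auto simp: P_def max_def split: if_splits)
  qed
  with K show ?thesis by (rule that)
qed

text \<open>Transfers absolute continuity from the curve to \<open>V\<close>. The constant is global
  because \<open>S Z\<close> and \<open>X\<close> both take values between \<alpha> and
  \<beta>.\<close>

lemma bass_V_Lipschitz:
  assumes Z: "Z \<in> L2 M G" and W: "W \<in> L2 M G"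
  shows "\<bar>V Z - V W\<bar> \<le> (\<beta> - \<alpha>) * l2norm M (\<lambda>\<omega>. Z \<omega> - W \<omega>)"
proof -
  have *: "V Z - V W \<le> (\<beta> - \<alpha>) * l2norm M (\<lambda>\<omega>. Z \<omega> - W \<omega>)" if Z: "Z \<in> L2 M G" and W: "W \<in> L2 M G" for Z W
  proof -
    have SX: "(\<lambda>\<omega>. S Z \<omega> - X \<omega>) \<in> L2 M M" by (intro L2_M_intros S_L2 Z)
    have "l2norm M (\<lambda>\<omega>. S Z \<omega> - X \<omega>) \<le> l2norm M (\<lambda>_. \<beta> - \<alpha>)"
    proof (rule l2norm_mono[OF L2_const L2_D(1)[OF SX]])
      show "AE \<omega> in M. \<bar>S Z \<omega> - X \<omega>\<bar> \<le> \<bar>\<beta> - \<alpha>\<bar>"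
        using X_in
      proof eventually_elim
        case (elim \<omega>)
        thus ?case using S_in[OF Z, of \<omega>] m12 by linarith
      qed
    qed
    also have "\<dots> = \<beta> - \<alpha>" using \<alpha>_less_\<beta> by (simp add: l2norm_def prob_space)
    finally have b: "l2norm M (\<lambda>\<omega>. S Z \<omega> - X \<omega>) \<le> \<beta> - \<alpha>" .
    have "V Z - V W \<le> (\<integral>\<omega>. (S Z \<omega> - X \<omega>) * (Z \<omega> - W \<omega>) \<partial>M)" by (rule bass_V_diff_le[OF Z W])
    also have "\<dots> \<le> l2norm M (\<lambda>\<omega>. S Z \<omega> - X \<omega>) * l2norm M (\<lambda>\<omega>. Z \<omega> - W \<omega>)"
      by (rule order_trans[OF abs_ge_self l2norm_Cauchy_Schwarz]) (intro SX L2_M_intros L2_G Z W)+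
    also have "\<dots> \<le> (\<beta> - \<alpha>) * l2norm M (\<lambda>\<omega>. Z \<omega> - W \<omega>)" by (intro mult_right_mono b) simp
    finally show ?thesis .
  qed
  from *[OF Z W] *[OF W Z] l2norm_minus_commute[of M Z W] show ?thesis by (simp add: abs_le_iff)
qed

text \<open>A Polyak-Lojasiewicz inequality. With \<open>r\<close> the norm of the gradient and
  \<open>d\<close> the distance to \<open>W\<close>, strong monotonicity gives
  \<open>\<kappa> * d \<le> r\<close> and the subgradient inequality bounds the gap by
  \<open>r * d\<close>; hence \<kappa> times the gap is at most \<open>r^2\<close>, the dissipation.
  The subgradient \<open>S (Z t) - X\<close> is traded for \<open>grad (Z t)\<close>, which is
  \<open>G\<close>-measurable.\<close>

lemma flow_V_decay:
  assumes flow: "bass_flow M X \<nu> Z0 Z" and min: "bass_minimizer M X \<Gamma> \<nu> W" and "0 \<le> \<kappa>"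
    and mono: "\<And>t. 0 \<le> t \<Longrightarrow> \<kappa> * (l2norm M (\<lambda>\<omega>. Z t \<omega> - W \<omega>))\<^sup>2
      \<le> (\<integral>\<omega>. (S (Z t) \<omega> - S W \<omega>) * (Z t \<omega> - W \<omega>) \<partial>M)"
    and "0 \<le> T"
  shows "V (Z T) - V W \<le> (V (Z 0) - V W) * exp (- \<kappa> * T)"
proof (rule flow_exp_decay[OF flow, where \<phi> = "\<lambda>t. V (Z t) - V W" and C = "\<beta> - \<alpha>"])
  have W: "W \<in> L2 M G" using min by (simp add: bass_minimizer_def)
  note ZL = flow_L2[OF flow]
  show "\<bar>V (Z t) - V W - (V (Z s) - V W)\<bar> \<le> (\<beta> - \<alpha>) * l2norm M (\<lambda>\<omega>. Z t \<omega> - Z s \<omega>)" if "0 \<le> s" "0 \<le> t" for s t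
    using bass_V_Lipschitz[OF ZL[OF that(2)] ZL[OF that(1)]] by simp
  show "0 \<le> V (Z t) - V W" if "0 \<le> t" for t
    using min ZL[OF that] by (simp add: bass_minimizer_def)
  fix t :: real assume "0 < t"
  hence t: "0 \<le> t" by simp
  note Zt = ZL[OF t]
  define r d where "r = l2norm M (grad (Z t))" and "d = l2norm M (\<lambda>\<omega>. Z t \<omega> - W \<omega>)"
  have rd: "0 \<le> r" "0 \<le> d" by (simp_all add: r_def d_def)
  have ZW: "(\<lambda>\<omega>. Z t \<omega> - U \<omega>) \<in> L2 M G" if "U \<in> L2 M G" for U by (intro L2_diff Zt that subalgebra_G)
  have swap: "(\<integral>\<omega>. (S (Z t) \<omega> - X \<omega>) * (Z t \<omega> - U \<omega>) \<partial>M) = (\<integral>\<omega>. grad (Z t) \<omega> * (Z t \<omega> - U \<omega>) \<partial>M)"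
    if "U \<in> L2 M G" for U
    using integral_grad[OF Zt ZW[OF that]] by (simp add: mult.commute)
  have CS: "(\<integral>\<omega>. grad (Z t) \<omega> * (Z t \<omega> - W \<omega>) \<partial>M) \<le> r * d"
    unfolding r_def d_def
    by (rule order_trans[OF abs_ge_self l2norm_Cauchy_Schwarz]) (intro L2_G grad_L2 Zt ZW W)+
  have "\<kappa> * d\<^sup>2 \<le> (\<integral>\<omega>. (S (Z t) \<omega> - X \<omega>) * (Z t \<omega> - W \<omega>) \<partial>M)"
    using mono[OF t] minimizer_monotone_eq[OF min Zt] by (simp add: d_def mult.commute)
  also have "\<dots> \<le> r * d" using CS swap[OF W] by simp
  finally have "(\<kappa> * d) * d \<le> r * d" by (simp add: power2_eq_square mult.assoc)
  hence \<kappa>d: "\<kappa> * d \<le> r" using rd by (cases "d = 0") auto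
  have "\<kappa> * (V (Z t) - V W) \<le> \<kappa> * (r * d)"
    using bass_V_diff_le[OF Zt W] CS swap[OF W] \<open>0 \<le> \<kappa>\<close> by (intro mult_left_mono) auto
  also have "\<dots> \<le> r * r" using mult_left_mono[OF \<kappa>d rd(1)] by (simp add: mult_ac)
  also have "\<dots> = (\<integral>\<omega>. grad (Z t) \<omega> * grad (Z t) \<omega> \<partial>M)"
    using l2norm_power2[of M "grad (Z t)"] by (simp add: r_def power2_eq_square)
  also have "\<dots> = (\<integral>\<omega>. grad (Z t) \<omega> * (S (Z t) \<omega> - X \<omega>) \<partial>M)" by (rule integral_grad[OF Zt grad_L2[OF Zt]])
  finally have "\<kappa> * (V (Z t) - V W) \<le> (\<integral>\<omega>. grad (Z t) \<omega> * (S (Z t) \<omega> - X \<omega>) \<partial>M)" .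
  moreover have "V (Z t) - V W - (V (Z s) - V W) \<le> (\<integral>\<omega>. grad (Z t) \<omega> * (Z t \<omega> - Z s \<omega>) \<partial>M)" if "0 \<le> s" for s
    using bass_V_diff_le[OF Zt ZL[OF that]] swap[OF ZL[OF that]] by simp
  ultimately show "\<exists>g \<in> L2 M G. (\<forall>s\<ge>0. V (Z t) - V W - (V (Z s) - V W) \<le> (\<integral>\<omega>. g \<omega> * (Z t \<omega> - Z s \<omega>) \<partial>M)) \<and>
        \<kappa> * (V (Z t) - V W) \<le> (\<integral>\<omega>. g \<omega> * (S (Z t) \<omega> - X \<omega>) \<partial>M)"
    using grad_L2[OF Zt] by blast
qed (use assms in auto)

theorem exponential_convergence:
  assumes flow: "bass_flow M X \<nu> Z0 Z" and min: "bass_minimizer M X \<Gamma> \<nu> W"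
    and Z0: "Z0 \<in> Linf M G" and mean: "(\<integral>\<omega>. W \<omega> \<partial>M) = (\<integral>\<omega>. Z0 \<omega> \<partial>M)"
  shows "\<exists>\<kappa>>0. \<forall>t\<ge>0.
     l2norm M (\<lambda>\<omega>. Z t \<omega> - W \<omega>) \<le> l2norm M (\<lambda>\<omega>. Z0 \<omega> - W \<omega>) * exp (- \<kappa> * t) \<and>
     V (Z t) - bass_inf M X \<Gamma> \<nu> \<le> (V Z0 - bass_inf M X \<Gamma> \<nu>) * exp (- \<kappa> * t)"
proof -
  have W: "W \<in> L2 M G" using min by (simp add: bass_minimizer_def)
  note ZL = flow_L2[OF flow]
  have Z00: "AE \<omega> in M. Z 0 \<omega> = Z0 \<omega>" using flow by (simp add: bass_flow_def)
  from Z0 obtain c where c: "AE \<omega> in M. \<bar>Z0 \<omega>\<bar> \<le> c" and Z0m: "Z0 \<in> borel_measurable G" by (auto simp: Linf_def)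
  have Z0L: "Z0 \<in> L2 M G" using L2_bounded[OF G_meas[OF Z0m] c] Z0m by (simp add: L2_def)
  note [measurable] = L2_D(1)[OF L2_G[OF ZL[of 0]]] L2_D(1)[OF L2_G[OF W]] L2_D(1)[OF L2_G[OF Z0L]]
  have "AE \<omega> in M. \<bar>Z 0 \<omega>\<bar> \<le> c" using c Z00 by eventually_elim simp
  then obtain R1 where R1: "0 \<le> R1" "\<And>t. 0 \<le> t \<Longrightarrow> AE \<omega> in M. \<bar>Z t \<omega>\<bar> \<le> R1"
    using flow_bounded[OF flow min] by blast
  obtain R2 where R2: "0 \<le> R2" "AE \<omega> in M. \<bar>W \<omega>\<bar> \<le> R2" using minimizer_bounded[OF min] by blast
  define R where "R = max R1 R2"
  have RW: "AE \<omega> in M. \<bar>W \<omega>\<bar> \<le> R" using R2(2) by eventually_elim (simp add: R_def)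
  have RZ: "AE \<omega> in M. \<bar>Z t \<omega>\<bar> \<le> R" if "0 \<le> t" for t using R1(2)[OF that] by eventually_elim (simp add: R_def)
  have "0 \<le> R" using R1(1) by (simp add: R_def)
  obtain \<kappa> where \<kappa>: "0 < \<kappa>" and \<kappa>': "\<And>Z. Z \<in> L2 M G \<Longrightarrow> AE \<omega> in M. \<bar>Z \<omega>\<bar> \<le> R \<Longrightarrow> (\<integral>\<omega>. Z \<omega> \<partial>M) = (\<integral>\<omega>. W \<omega> \<partial>M) \<Longrightarrow>
       \<kappa> * (l2norm M (\<lambda>\<omega>. Z \<omega> - W \<omega>))\<^sup>2 \<le> (\<integral>\<omega>. (S Z \<omega> - S W \<omega>) * (Z \<omega> - W \<omega>) \<partial>M)"
    using strong_monotonicity[OF W RW \<open>0 \<le> R\<close>] by blast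
  have "(\<integral>\<omega>. Z 0 \<omega> \<partial>M) = (\<integral>\<omega>. Z0 \<omega> \<partial>M)" using Z00 by (intro integral_cong_AE) auto
  hence meanZ: "(\<integral>\<omega>. Z t \<omega> \<partial>M) = (\<integral>\<omega>. W \<omega> \<partial>M)" if "0 \<le> t" for t
    using flow_mean[OF flow that] mean by simp
  note mono = \<kappa>'[OF ZL RZ meanZ]
  have inf: "bass_inf M X \<Gamma> \<nu> = V W"
    unfolding bass_inf_def
  proof (rule cInf_eq_minimum)
    show "V W \<in> V ` L2 M G" using W by (rule imageI)
    show "V W \<le> x" if "x \<in> V ` L2 M G" for x using that min by (auto simp: bass_minimizer_def)
  qed
  \<comment> \<open>\<open>Z 0\<close> is only almost surely equal to \<open>Z0\<close>, so the
    initial values have to be identified.\<close>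
  have norm0: "l2norm M (\<lambda>\<omega>. Z 0 \<omega> - W \<omega>) = l2norm M (\<lambda>\<omega>. Z0 \<omega> - W \<omega>)"
    unfolding l2norm_def using Z00 by (intro arg_cong[where f=sqrt] integral_cong_AE) (auto elim: eventually_mono)
  have V0: "V (Z 0) = V Z0"
    unfolding bass_V_def
  proof (rule SUP_cong[OF refl])
    fix Y assume "Y \<in> {Y \<in> L2 M H. distr M borel Y = \<nu>}"
    hence [measurable]: "Y \<in> borel_measurable M" using subalgebra_H by (auto simp: L2_def intro: measurable_from_subalg)
    show "(\<integral>\<omega>. (Z 0 \<omega> + \<Gamma> \<omega>) * Y \<omega> - Z 0 \<omega> * X \<omega> \<partial>M) = (\<integral>\<omega>. (Z0 \<omega> + \<Gamma> \<omega>) * Y \<omega> - Z0 \<omega> * X \<omega> \<partial>M)"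
      using Z00 by (intro integral_cong_AE) (auto elim: eventually_mono)
  qed
  show ?thesis
    using flow_norm_decay[OF flow min less_imp_le[OF \<kappa>] mono] flow_V_decay[OF flow min less_imp_le[OF \<kappa>] mono] \<kappa>
    unfolding norm0 V0 inf by blast
qed

end

section \<open>Supports\<close>

text \<open>The complement of the support is a union of open null sets; by Lindelof's theorem
  countably many of them already cover it.\<close>

lemma AE_in_msupport:
  assumes "sets \<rho> = sets borel"
  shows "AE x in \<rho>. x \<in> msupport \<rho>"
proof -
  define F where "F = {U. open U \<and> emeasure \<rho> U = 0}"
  obtain F' where F': "F' \<subseteq> F" "countable F'" "\<Union>F' = \<Union>F"
    by (rule Lindelof[of F]) (auto simp: F_def)
  have "U \<in> null_sets \<rho>" if "U \<in> F'" for U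
    using that F'(1) assms by (auto simp: F_def null_sets_def)
  hence "\<Union>F' \<in> null_sets \<rho>" using F'(2) by (metis null_sets_UN' image_ident)
  hence "AE x in \<rho>. x \<notin> \<Union>F'" by (rule AE_not_in)
  thus ?thesis
    unfolding F'(3) by eventually_elim (auto simp: F_def msupport_def zero_less_iff_neq_zero)
qed

lemma closed_msupport: "closed (msupport \<rho>)"
proof -
  have "- msupport \<rho> = \<Union>{U. open U \<and> emeasure \<rho> U = 0}"
    by (auto simp: msupport_def zero_less_iff_neq_zero)
  thus ?thesis by (auto simp: closed_def)
qed

lemma msupport_nonempty:
  fixes \<rho> :: "real measure"
  assumes "prob_space \<rho>" "sets \<rho> = sets borel"
  shows "msupport \<rho> \<noteq> {}"
proof
  assume "msupport \<rho> = {}"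
  hence "AE x in \<rho>. False" using AE_in_msupport[OF assms(2)] by simp
  thus False using prob_space.AE_False[OF assms(1)] by simp
qed

lemma convex_compact_real_interval:
  fixes A :: "real set"
  assumes "compact A" "convex A" "A \<noteq> {}"
  obtains a b where "a \<le> b" "A = {a..b}"
  using assms connected_compact_interval_1[of A] convex_connected[of A]
  by (metis atLeastatMost_empty_iff2 box_real(2) linorder_not_le)

lemma convex_order_mean:
  assumes "convex_order \<mu> \<nu>" "integrable \<nu> (\<lambda>x. x)"
  shows "(\<integral>x. x \<partial>\<mu>) = (\<integral>x. x \<partial>\<nu>)"
proof -
  have "convex_on UNIV (\<lambda>x::real. x)" "convex_on UNIV (\<lambda>x::real. - x)"
    by (auto simp: convex_on_def algebra_simps)
  with assms have "(\<integral>x. x \<partial>\<mu>) \<le> (\<integral>x. x \<partial>\<nu>)" "(\<integral>x. - x \<partial>\<mu>) \<le> (\<integral>x. - x \<partial>\<nu>)"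
    unfolding convex_order_def by auto
  thus ?thesis by simp
qed

text \<open>Turns bounds on the density into bounds on increments of the distribution function.
  Taking \<open>\<bar>c2\<bar>\<close> makes the upper constant visibly nonnegative, as integration
  in the extended nonnegative reals requires.\<close>

lemma transport_target_of_density:
  fixes \<nu> :: "real measure"
  assumes prob: "prob_space \<nu>" and dens: "\<nu> = density lborel (\<lambda>x. ennreal (f x))"
    and f [measurable]: "f \<in> borel_measurable borel" and supp: "msupport \<nu> = {\<alpha>..\<beta>}"
    and bounds: "AE x in lborel. x \<in> msupport \<nu> \<longrightarrow> c1 \<le> f x \<and> f x \<le> c2" and c1: "0 < c1"
  shows "transport_target \<nu> \<alpha> \<beta> c1 \<bar>c2\<bar>"
proof (rule transport_target.intro)
  have sets: "sets \<nu> = sets borel" by (simp add: dens)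
  show "real_distribution \<nu>" using prob sets by (simp add: real_distribution_def real_distribution_axioms_def)
  then interpret \<nu>: real_distribution \<nu> .
  have "AE x in \<nu>. x \<in> {\<alpha>..\<beta>}" using AE_in_msupport[OF sets] by (simp add: supp)
  \<comment> \<open>\<open>cdf \<nu> \<alpha>\<close> counts the point \<alpha> itself, so its
    vanishing rests on the absence of an atom there.\<close>
  have ne: "AE x in \<nu>. x \<noteq> \<alpha>"
    unfolding dens using AE_lborel_singleton[of \<alpha>] by (subst AE_density) (auto elim: eventually_mono)
  have "AE x in \<nu>. x \<notin> {..\<alpha>}" using ne \<open>AE x in \<nu>. x \<in> {\<alpha>..\<beta>}\<close> by eventually_elim auto
  thus "cdf \<nu> \<alpha> = 0" unfolding cdf_def by (subst \<nu>.prob_eq_0) auto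
  have "AE x in \<nu>. x \<in> {..\<beta>}" using \<open>AE x in \<nu>. x \<in> {\<alpha>..\<beta>}\<close> by eventually_elim auto
  thus "cdf \<nu> \<beta> = 1" unfolding cdf_def by (subst \<nu>.prob_eq_1) auto
  fix y y' assume y: "\<alpha> \<le> y" "y \<le> y'" "y' \<le> \<beta>"
  have em: "emeasure \<nu> {y<..y'} = (\<integral>\<^sup>+x. ennreal (f x) * indicator {y<..y'} x \<partial>lborel)"
    unfolding dens by (subst emeasure_density) auto
  have b: "AE x in lborel. x \<in> {y<..y'} \<longrightarrow> c1 \<le> f x \<and> f x \<le> \<bar>c2\<bar>"
    using bounds unfolding supp by eventually_elim (use y in auto)
  have "ennreal (c1 * (y' - y)) = (\<integral>\<^sup>+x. ennreal c1 * indicator {y<..y'} x \<partial>lborel)"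
    using y c1 by (subst nn_integral_cmult_indicator) (auto simp: ennreal_mult)
  also have "\<dots> \<le> (\<integral>\<^sup>+x. ennreal (f x) * indicator {y<..y'} x \<partial>lborel)"
    using b by (intro nn_integral_mono_AE) (auto elim!: eventually_mono simp: indicator_def intro: ennreal_leI)
  also have "\<dots> = ennreal (measure \<nu> {y<..y'})" by (simp add: em[symmetric] \<nu>.emeasure_eq_measure)
  finally have 1: "c1 * (y' - y) \<le> measure \<nu> {y<..y'}" by simp
  have "ennreal (measure \<nu> {y<..y'}) = (\<integral>\<^sup>+x. ennreal (f x) * indicator {y<..y'} x \<partial>lborel)"
    by (simp add: em[symmetric] \<nu>.emeasure_eq_measure)
  also have "\<dots> \<le> (\<integral>\<^sup>+x. ennreal \<bar>c2\<bar> * indicator {y<..y'} x \<partial>lborel)"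
    using b by (intro nn_integral_mono_AE) (auto elim!: eventually_mono simp: indicator_def intro: ennreal_leI)
  also have "\<dots> = ennreal (\<bar>c2\<bar> * (y' - y))"
    using y by (subst nn_integral_cmult_indicator) (auto simp: ennreal_mult)
  finally have 2: "measure \<nu> {y<..y'} \<le> \<bar>c2\<bar> * (y' - y)" using y by (subst (asm) ennreal_le_iff) auto
  have "cdf \<nu> y' - cdf \<nu> y = measure \<nu> {y<..y'}"
    using \<nu>.cdf_diff_eq[of y y'] y by (cases "y = y'") auto
  with 1 2 show "c1 * (y' - y) \<le> cdf \<nu> y' - cdf \<nu> y" "cdf \<nu> y' - cdf \<nu> y \<le> \<bar>c2\<bar> * (y' - y)" by simp_all
qed (rule c1)

theorem theorem1p9:
  fixes M :: "'a measure" and X \<Gamma> Z0 Zs :: "'a \<Rightarrow> real"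
    and \<mu> \<nu> :: "real measure" and Z :: "real \<Rightarrow> 'a \<Rightarrow> real"
  assumes "prob_space M"
    and "X \<in> borel_measurable M" and "distr M borel X = \<mu>"
    and "\<Gamma> \<in> borel_measurable M" and "distr M borel \<Gamma> = gauss"
    and "prob_space.indep_var M borel X borel \<Gamma>"
    and "\<mu> \<in> P2" and "\<nu> \<in> P2" and "assumption_A \<mu> \<nu>"
    and "convex (msupport \<nu>)"
    and "\<exists>f c1 c2. f \<in> borel_measurable borel \<and> \<nu> = density lborel (\<lambda>x. ennreal (f x)) \<and>
           0 < c1 \<and> (AE x in lborel. x \<in> msupport \<nu> \<longrightarrow> c1 \<le> f x \<and> f x \<le> (c2::real))"
    and "Z0 \<in> Linf M (sigX M X)"
    and "bass_flow M X \<nu> Z0 Z"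
    and "bass_minimizer M X \<Gamma> \<nu> Zs"
    and "(\<integral>\<omega>. Zs \<omega> \<partial>M) = (\<integral>\<omega>. Z0 \<omega> \<partial>M)"
  shows "\<exists>\<kappa>>0. \<forall>t\<ge>0.
     l2norm M (\<lambda>\<omega>. Z t \<omega> - Zs \<omega>) \<le> l2norm M (\<lambda>\<omega>. Z0 \<omega> - Zs \<omega>) * exp (- \<kappa> * t) \<and>
     bass_V M X \<Gamma> \<nu> (Z t) - bass_inf M X \<Gamma> \<nu>
       \<le> (bass_V M X \<Gamma> \<nu> Z0 - bass_inf M X \<Gamma> \<nu>) * exp (- \<kappa> * t)"
proof -
  interpret M: prob_space M by fact
  obtain f c1 c2 where f: "f \<in> borel_measurable borel" "\<nu> = density lborel (\<lambda>x. ennreal (f x))" "0 < c1"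
    "AE x in lborel. x \<in> msupport \<nu> \<longrightarrow> c1 \<le> f x \<and> f x \<le> (c2::real)"
    using assms(11) by blast
  have \<nu>: "prob_space \<nu>" "sets \<nu> = sets borel" "integrable \<nu> (\<lambda>x. x\<^sup>2)" using \<open>\<nu> \<in> P2\<close> by (auto simp: P2_def)
  have \<mu>: "prob_space \<mu>" "sets \<mu> = sets borel" using \<open>\<mu> \<in> P2\<close> by (auto simp: P2_def)
  have hull: "supp_hull \<nu> = msupport \<nu>"
    unfolding supp_hull_def using \<open>convex (msupport \<nu>)\<close> by (rule hull_same)
  have A: "convex_order \<mu> \<nu>" "compact (msupport \<nu>)" "msupport \<mu> \<subseteq> interior (msupport \<nu>)"
    using \<open>assumption_A \<mu> \<nu>\<close> by (auto simp: assumption_A_def hull)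
  obtain \<alpha> \<beta> where \<alpha>\<beta>: "msupport \<nu> = {\<alpha>..\<beta>}"
    by (rule convex_compact_real_interval[OF A(2) \<open>convex (msupport \<nu>)\<close> msupport_nonempty[OF \<nu>(1,2)]])
  have target: "transport_target \<nu> \<alpha> \<beta> c1 \<bar>c2\<bar>"
    by (rule transport_target_of_density[OF \<nu>(1) f(2,1) \<alpha>\<beta> f(4,3)])
  \<comment> \<open>The support of \<mu> is compact, so its extreme points \<open>m1\<close> and
    \<open>m2\<close> are attained; lying in the open interval, they leave a strict gap to \<alpha>
    and \<beta>.\<close>
  have "bounded (msupport \<mu>)"
    using compact_imp_bounded[OF A(2)] subset_trans[OF A(3) interior_subset] by (rule bounded_subset)
  hence cpt: "compact (msupport \<mu>)" using closed_msupport by (simp add: compact_eq_bounded_closed)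
  obtain m1 where m1: "m1 \<in> msupport \<mu>" "\<And>x. x \<in> msupport \<mu> \<Longrightarrow> m1 \<le> x"
    using compact_attains_inf[OF cpt msupport_nonempty[OF \<mu>]] by blast
  obtain m2 where m2: "m2 \<in> msupport \<mu>" "\<And>x. x \<in> msupport \<mu> \<Longrightarrow> x \<le> m2"
    using compact_attains_sup[OF cpt msupport_nonempty[OF \<mu>]] by blast
  note m = m1(1) m2(1) conjI[OF m1(2) m2(2)]
  hence m12: "\<alpha> < m1" "m2 < \<beta>" using A(3) by (auto simp: \<alpha>\<beta>)
  have "AE x in \<mu>. m1 \<le> x \<and> x \<le> m2" using AE_in_msupport[OF \<mu>(2)] by eventually_elim (use m(3) in blast)
  hence X_in: "AE \<omega> in M. m1 \<le> X \<omega> \<and> X \<omega> \<le> m2"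
    unfolding \<open>distr M borel X = \<mu>\<close>[symmetric] by (rule AE_distrD[OF assms(2)])
  have "(\<lambda>x. x) \<in> borel_measurable \<nu>" by (rule measurable_ident_sets[OF \<nu>(2)])
  hence "(\<lambda>x. x) \<in> L2 \<nu> \<nu>" using \<nu>(3) by (simp add: L2_def)
  hence "integrable \<nu> (\<lambda>x. x)" by (rule prob_space.L2_integrable[OF \<nu>(1)])
  hence "(\<integral>x. x \<partial>\<mu>) = (\<integral>x. x \<partial>\<nu>)" by (rule convex_order_mean[OF A(1)])
  moreover have "(\<integral>x. x \<partial>\<mu>) = (\<integral>\<omega>. X \<omega> \<partial>M)"
    unfolding \<open>distr M borel X = \<mu>\<close>[symmetric] by (rule integral_distr[OF assms(2)]) simp
  ultimately have mean: "(\<integral>\<omega>. X \<omega> \<partial>M) = (\<integral>y. y \<partial>\<nu>)" by simp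
  interpret bass_setting M \<nu> \<alpha> \<beta> c1 "\<bar>c2\<bar>" X \<Gamma> m1 m2
    by (intro bass_setting.intro bass_setting_axioms.intro target) (use assms m12 X_in mean in auto)
  show ?thesis by (rule exponential_convergence) fact+
qed

end
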